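(* Let $K\ge2$ be even and let $A_1,\dots,A_L$ be fixed-strength $K$-user channel states each of the following form: there is a set $B_\ell$ of $K/2$ ordered pairs $(r,t)$, $r\ne t$, whose underlying unordered pairs $\{r,t\}$ are mutually disjoint (hence cover all of $\mathcal K$), such that $(A_\ell)_{rt}=\sqrt{\mathrm{SNR}}$ for $(r,t)\in B_\ell$, $(A_\ell)_{kk}=\sqrt{\mathrm{SNR}}$ for all $k$, and all other entries of $A_\ell$ are $0$ (the sets $B_\ell$ may differ across $\ell$). Then the parallel interference channel formed by $A_1,\dots,A_L$ is separable: its sum capacity equals $L\cdot\frac K2\log(1+2\,\mathrm{SNR})$, i.e. $\frac K2\log(1+2\,\mathrm{SNR})$ per subchannel, which is achieved by separate coding on each subchannel.
   Context: Model: fix an integer $K\ge 2$, $\mathcal K=\{1,\dots,K\}$, and a constant $\mathrm{SNR}>0$. At each channel use $n$, receiver $r$ observes $Y^{[r]}(n)=\sum_{t}H^{[rt]}(n)e^{j\phi^{[rt]}(n)}X^{[t]}(n)+Z^{[r]}(n)$, with power constraint $E|X^{[t]}|^2\le1$, zero-mean unit-variance circularly symmetric complex Gaussian noise i.i.d. over $n$, phases i.i.d. uniform on $[0,2\pi)$ independent of strengths, and $H^{[rt]}$ the link from transmitter $t$ to receiver $r$. Full channel knowledge at all nodes; independent messages $W_k$ from transmitter $k$ to receiver $k$; sum capacity in the standard Shannon sense; logs base 2. A fixed-strength channel state is a $K\times K$ matrix $A$ of nonnegative entries with $A_{kk}=\sqrt{\mathrm{SNR}}$; its channel is the model with $H^{[rt]}(n)=A_{rt}$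 for all $n$ (phases still i.i.d. uniform), with sum capacity $C_\Sigma(A)$. The parallel interference channel formed by states $A_1,\dots,A_L$: at each channel use every transmitter $t$ sends one symbol on each subchannel $\ell$, with power constraint $E|X^{[t]}_\ell|^2\le1$ per subchannel, and each receiver observes all $L$ subchannel outputs, subchannel $\ell$ behaving as the channel of $A_\ell$ with phases and noise independent across subchannels; coding may be joint across subchannels. The parallel channel is separable if its sum capacity equals $\sum_\ell C_\Sigma(A_\ell)$. *)

theory Defs
  imports "HOL-Probability.Probability"
begin

text \<open>Indexing conventions (all 0-based): users/receivers/transmitters in {..<K},
  subchannels in {..<L} with L = length As, channel uses in {..<N}.
  A channel state is a matrix A :: nat => nat => real, A r t = strength of the link
  from transmitter t to receiver r.\<close>

type_synonym phases = "nat \<times> nat \<times> nat \<times> nat \<Rightarrow> real"   \<comment> \<open>(n, l, r, t)\<close>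
type_synonym noises = "nat \<times> nat \<times> nat \<Rightarrow> complex"         \<comment> \<open>(n, l, r)\<close>

definition phase_meas :: "real measure" where
  "phase_meas = uniform_measure lborel {0..<2*pi}"

text \<open>Zero-mean unit-variance circularly symmetric complex Gaussian: density exp(-|z|^2)/pi.\<close>
definition cgauss :: "complex measure" where
  "cgauss = density lborel (\<lambda>z. ennreal (exp (- ((cmod z)\<^sup>2)) / pi))"

definition phase_space :: "nat \<Rightarrow> nat \<Rightarrow> nat \<Rightarrow> phases measure" where
  "phase_space N L K = PiM ({..<N} \<times> {..<L} \<times> {..<K} \<times> {..<K}) (\<lambda>_. phase_meas)"

definition noise_space :: "nat \<Rightarrow> nat \<Rightarrow> nat \<Rightarrow> noises measure" where
  "noise_space N L K = PiM ({..<N} \<times> {..<L} \<times> {..<K}) (\<lambda>_. cgauss)"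

definition chan_space :: "nat \<Rightarrow> nat \<Rightarrow> nat \<Rightarrow> (phases \<times> noises) measure" where
  "chan_space N L K = phase_space N L K \<Otimes>\<^sub>M noise_space N L K"

definition recv :: "(nat \<Rightarrow> nat \<Rightarrow> real) list \<Rightarrow> nat \<Rightarrow> nat \<Rightarrow>
    (nat \<Rightarrow> nat \<Rightarrow> nat \<Rightarrow> complex) \<Rightarrow> phases \<Rightarrow> noises \<Rightarrow> nat \<Rightarrow> nat \<Rightarrow> nat \<Rightarrow> complex" where
  "recv As K N x \<Phi> Z r n l =
     (if n < N \<and> l < length As then
        (\<Sum>t<K. complex_of_real ((As ! l) r t) * cis (\<Phi> (n, l, r, t)) * x t n l) + Z (n, l, r)
      else 0)"

definition msgs :: "nat \<Rightarrow> (nat \<Rightarrow> nat) \<Rightarrow> (nat \<Rightarrow> nat) set" where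
  "msgs K M = PiE {..<K} (\<lambda>k. {..<M k})"

text \<open>A code of block length N with message set sizes M k.
  enc t w n \<Phi> l : symbol sent by transmitter t with message w at channel use n on
  subchannel l (causal knowledge of all phases up to time n).
  dec r \<Phi> y : estimate of receiver r from all phases and its received signal.\<close>
definition is_code :: "(nat \<Rightarrow> nat \<Rightarrow> real) list \<Rightarrow> nat \<Rightarrow> nat \<Rightarrow> (nat \<Rightarrow> nat) \<Rightarrow>
    (nat \<Rightarrow> nat \<Rightarrow> nat \<Rightarrow> phases \<Rightarrow> nat \<Rightarrow> complex) \<Rightarrow>
    (nat \<Rightarrow> phases \<Rightarrow> (nat \<Rightarrow> nat \<Rightarrow> complex) \<Rightarrow> nat) \<Rightarrow> bool" where
  "is_code As K N M enc dec \<longleftrightarrow>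
     (\<forall>k<K. M k \<ge> 1) \<and>
     (\<forall>t w n \<Phi> \<Phi>'. (\<forall>m\<le>n. \<forall>l r s. \<Phi> (m, l, r, s) = \<Phi>' (m, l, r, s)) \<longrightarrow>
         enc t w n \<Phi> = enc t w n \<Phi>') \<and>
     (\<forall>t<K. \<forall>w<M t. \<forall>n<N. \<forall>l<length As.
         (\<lambda>\<Phi>. enc t w n \<Phi> l) \<in> borel_measurable (phase_space N (length As) K)) \<and>
     (\<forall>t<K. \<forall>l<length As.
         (\<Sum>w<M t. \<Sum>n<N. \<integral>\<^sup>+\<Phi>. ennreal ((cmod (enc t w n \<Phi> l))\<^sup>2) \<partial>phase_space N (length As) K)
           \<le> ennreal (real N * real (M t))) \<and>
     (\<forall>r<K. \<forall>w\<in>msgs K M.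
         (\<lambda>(\<Phi>, Z). dec r \<Phi> (recv As K N (\<lambda>t n l. enc t (w t) n \<Phi> l) \<Phi> Z r))
           \<in> measurable (chan_space N (length As) K) (count_space UNIV))"

definition err_prob :: "(nat \<Rightarrow> nat \<Rightarrow> real) list \<Rightarrow> nat \<Rightarrow> nat \<Rightarrow> (nat \<Rightarrow> nat) \<Rightarrow>
    (nat \<Rightarrow> nat \<Rightarrow> nat \<Rightarrow> phases \<Rightarrow> nat \<Rightarrow> complex) \<Rightarrow>
    (nat \<Rightarrow> phases \<Rightarrow> (nat \<Rightarrow> nat \<Rightarrow> complex) \<Rightarrow> nat) \<Rightarrow> real" where
  "err_prob As K N M enc dec =
     (\<Sum>w\<in>msgs K M. measure (chan_space N (length As) K)
        {(\<Phi>, Z) \<in> space (chan_space N (length As) K).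
           \<exists>r<K. dec r \<Phi> (recv As K N (\<lambda>t n l. enc t (w t) n \<Phi> l) \<Phi> Z r) \<noteq> w r})
     / real (\<Prod>k<K. M k)"

definition achievable :: "(nat \<Rightarrow> nat \<Rightarrow> real) list \<Rightarrow> nat \<Rightarrow> (nat \<Rightarrow> real) \<Rightarrow> bool" where
  "achievable As K R \<longleftrightarrow> (\<forall>k<K. R k \<ge> 0) \<and>
     (\<forall>\<epsilon>>0. \<exists>N0. \<forall>N\<ge>N0. \<exists>M enc dec. is_code As K N M enc dec \<and>
        (\<forall>k<K. real (M k) \<ge> 2 powr (real N * R k)) \<and> err_prob As K N M enc dec \<le> \<epsilon>)"

text \<open>Sum capacity of the parallel channel formed by the states As; for a single
  state A, C_Sigma(A) = psum_capacity K [A].\<close>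
definition psum_capacity :: "nat \<Rightarrow> (nat \<Rightarrow> nat \<Rightarrow> real) list \<Rightarrow> real" where
  "psum_capacity K As = Sup {\<Sum>k<K. R k | R. achievable As K R}"

definition paired_state :: "nat \<Rightarrow> real \<Rightarrow> (nat \<Rightarrow> nat \<Rightarrow> real) \<Rightarrow> bool" where
  "paired_state K SNR A \<longleftrightarrow> (\<exists>B. B \<subseteq> {..<K} \<times> {..<K} \<and> card B = K div 2 \<and>
     (\<forall>(r, t)\<in>B. r \<noteq> t) \<and>
     (\<forall>(r, t)\<in>B. \<forall>(r', t')\<in>B. (r, t) \<noteq> (r', t') \<longrightarrow> {r, t} \<inter> {r', t'} = {}) \<and>
     (\<forall>r<K. \<forall>t<K. A r t = (if r = t \<or> (r, t) \<in> B then sqrt SNR else 0)))"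

end

theory Submission
  imports Defs
begin

text \<open>
  Converse. Condition on the phases. With uniform messages, Gibbs' inequality bounds the information
  that receiver \<open>k\<close> has about its message by
  \<open>E ln q\<^sub>k(Y\<^sub>k | W\<^sub>k) - E ln p\<^sub>k(Y\<^sub>k)\<close> for \<^emph>\<open>any\<close> output density \<open>p\<^sub>k\<close>. Take \<open>p\<^sub>k\<close> Gaussian of variance
  \<open>1 + 2 SNR\<close> on the interfered coordinates and, on the clean ones, the product over \<open>j\<close> of the true laws
  of the blocks of coordinates on which \<open>k\<close> interferes with \<open>j\<close>. The conditional density \<open>q\<^sub>j\<close> factors into
  the laws of the same blocks, seen through a rotation of the phase, so after summation over all receivers
  every term involving the codebooks cancels. What remains is \<open>ln (1 + 2 SNR)\<close> per interfered
  coordinate; it is linear in the transmit powers, so the power constraint can be averaged over the phases.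

  Achievability. Draw Gaussian codebooks and treat interference as noise. On every subchannel a pair of
  users then gets \<open>log (1 + SNR) + log (1 + SNR / (1 + SNR)) = log (1 + 2 SNR)\<close>.
\<close>

section \<open>The complex Gaussian distribution\<close>

text \<open>The pairings differ between subchannels, so the clean coordinates of a user are divided
  among several disturbed receivers, and a joint codebook may correlate them. The entropy of the
  whole clean signal would have no counterpart at any other receiver. Ignoring the correlation in
  the test density cuts the signal into exactly the pieces that others suffer as interference,
  because on each coordinate \<open>\<tau>\<close> is a bijection from the interfered to the clean
  receivers: every clean user disturbs exactly one other. The Gaussian part of the test density is
  centred at the codebook averages. Encoders know the phases, so the means of two users could add up
  coherently; only after centring does the independence of the messages remove the cross term. Its
  variance \<open>v\<close> stays fixed instead of following the actual power. With x the received
  signal power, an interfered and a clean coordinate together leave ln v - 1 + (1 + x) / v, the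
  tangent to ln (1 + x) at x = v - 1. This is the source of the linearity, and v = 1 + 2 SNR puts
  the point of contact at full power, where the bound equals ln v.\<close>

lemma lborel_complex_eq_distr:
  "(lborel :: complex measure) = distr (lborel \<Otimes>\<^sub>M lborel) borel (\<lambda>(x, y). Complex x y)"
proof (rule lborel_eqI)
  have [measurable]: "(\<lambda>(x, y). Complex x y) \<in> (lborel \<Otimes>\<^sub>M lborel) \<rightarrow>\<^sub>M (borel :: complex measure)"
    unfolding Complex_eq by measurable
  fix l u :: complex assume le: "\<And>b. b \<in> Basis \<Longrightarrow> l \<bullet> b \<le> u \<bullet> b"
  have "(\<lambda>(x, y). Complex x y) -` box l u = box (Re l) (Re u) \<times> box (Im l) (Im u)"
    by (auto simp: box_def Basis_complex_def inner_complex_def)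
  moreover have "Re l \<le> Re u" "Im l \<le> Im u"
    using le[of 1] le[of \<i>] by (auto simp: Basis_complex_def inner_complex_def)
  ultimately show "emeasure (distr (lborel \<Otimes>\<^sub>M lborel) borel (\<lambda>(x, y). Complex x y)) (box l u)
      = (\<Prod>b\<in>Basis. (u - l) \<bullet> b)"
    by (subst emeasure_distr)
      (auto simp: space_pair_measure lborel.emeasure_pair_measure_Times Basis_complex_def inner_complex_def
        simp flip: ennreal_mult)
qed simp

lemma nn_integral_lborel_complex:
  fixes f :: "complex \<Rightarrow> ennreal"
  assumes [measurable]: "f \<in> borel_measurable borel"
  shows "(\<integral>\<^sup>+z. f z \<partial>lborel) = (\<integral>\<^sup>+x. \<integral>\<^sup>+y. f (Complex x y) \<partial>lborel \<partial>lborel)"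
proof -
  have [measurable]: "(\<lambda>(x, y). Complex x y) \<in> (lborel \<Otimes>\<^sub>M lborel) \<rightarrow>\<^sub>M (borel :: complex measure)"
    unfolding Complex_eq by measurable
  show ?thesis
    by (subst lborel_complex_eq_distr)
      (simp add: nn_integral_distr lborel.nn_integral_fst[symmetric] split_beta')
qed

lemma nn_integral_lborel_complex_swap:
  fixes f :: "complex \<Rightarrow> ennreal"
  assumes [measurable]: "f \<in> borel_measurable borel"
  shows "(\<integral>\<^sup>+z. f z \<partial>lborel) = (\<integral>\<^sup>+y. \<integral>\<^sup>+x. f (Complex x y) \<partial>lborel \<partial>lborel)"
proof -
  have [measurable]: "(\<lambda>(x, y). f (Complex x y)) \<in> borel_measurable (lborel \<Otimes>\<^sub>M lborel)"
    unfolding Complex_eq by measurable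
  show ?thesis
    by (subst nn_integral_lborel_complex[OF assms]) (rule lborel_pair.Fubini', simp)
qed

text \<open>A rotation is a composition of one-dimensional affine substitutions: first the real part
  at fixed \<open>y\<close>, then the imaginary part at fixed new \<open>x\<close>, with Jacobians
  that cancel. The division by \<open>c\<close> fails for quarter turns, which are treated
  separately.\<close>

lemma nn_integral_lborel_rotate:
  fixes f :: "complex \<Rightarrow> ennreal"
  assumes [measurable]: "f \<in> borel_measurable borel" and u: "cmod u = 1"
  shows "(\<integral>\<^sup>+z. f (u * z) \<partial>lborel) = (\<integral>\<^sup>+z. f z \<partial>lborel)"
proof -
  define c s where "c = Re u" and "s = Im u"
  have cs: "c * c + s * s = 1"
    using u by (simp add: c_def s_def cmod_def power2_eq_square)
  have mult: "u * Complex x y = Complex (- s * y + c * x) (c * y + s * x)" for x y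
    by (simp add: c_def s_def complex_eq_iff)
  have [measurable]: "(\<lambda>x. f (Complex (a x) (b x))) \<in> borel_measurable M"
    if [measurable]: "a \<in> borel_measurable M" "b \<in> borel_measurable M" for a b and M :: "'a measure"
    unfolding Complex_eq by measurable
  show ?thesis
  proof (cases "c = 0")
    case True
    then have s: "\<bar>s\<bar> = 1" using cs by (simp add: power2_eq_square flip: abs_square_eq_1)
    have "(\<integral>\<^sup>+z. f (u * z) \<partial>lborel) = (\<integral>\<^sup>+x. \<integral>\<^sup>+y. f (Complex (- s * y) (s * x)) \<partial>lborel \<partial>lborel)"
      by (subst nn_integral_lborel_complex) (simp_all add: mult True)
    also have "\<dots> = (\<integral>\<^sup>+x. \<integral>\<^sup>+y. f (Complex y (s * x)) \<partial>lborel \<partial>lborel)"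
      using s nn_integral_real_affine[of "\<lambda>y. f (Complex y (s * x))" "- s" 0 for x] by simp
    also have "\<dots> = (\<integral>\<^sup>+x. \<integral>\<^sup>+y. f (Complex y x) \<partial>lborel \<partial>lborel)"
      using s nn_integral_real_affine[of "\<lambda>x. \<integral>\<^sup>+y. f (Complex y x) \<partial>lborel" s 0] by simp
    finally show ?thesis by (simp add: nn_integral_lborel_complex_swap)
  next
    case False
    have "(\<integral>\<^sup>+z. f (u * z) \<partial>lborel) =
        (\<integral>\<^sup>+y. \<integral>\<^sup>+x. f (Complex (- s * y + c * x) (c * y + s * x)) \<partial>lborel \<partial>lborel)"
      by (subst nn_integral_lborel_complex_swap) (simp_all add: mult)
    also have "\<dots> = (\<integral>\<^sup>+y. ennreal (1 / \<bar>c\<bar>) * (\<integral>\<^sup>+x. f (Complex x (s / c * x + 1 / c * y)) \<partial>lborel) \<partial>lborel)"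
    proof (intro nn_integral_cong)
      fix y :: real
      \<comment> \<open>The new imaginary part in terms of the new real part; this is where the
        modulus of \<open>u\<close> being 1 enters.\<close>
      have *: "s / c * (- s * y + c * x) + 1 / c * y = c * y + s * x" for x
      proof -
        have "c * (s / c * (- s * y + c * x) + 1 / c * y) = s * (- s * y + c * x) + y"
          using False by (simp add: distrib_left)
        also have "\<dots> = c * (c * y + s * x) + (1 - (c * c + s * s)) * y"
          by (simp add: algebra_simps)
        finally have "c * (s / c * (- s * y + c * x) + 1 / c * y) = c * (c * y + s * x)"
          using cs by simp
        then show ?thesis using False by simp
      qed
      have "(\<integral>\<^sup>+x. f (Complex x (s / c * x + 1 / c * y)) \<partial>lborel)
          = ennreal \<bar>c\<bar> * (\<integral>\<^sup>+x. f (Complex (- s * y + c * x) (c * y + s * x)) \<partial>lborel)"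
        by (subst nn_integral_real_affine[of _ c "- s * y"]) (use False in \<open>simp_all only: * , auto\<close>)
      then show "(\<integral>\<^sup>+x. f (Complex (- s * y + c * x) (c * y + s * x)) \<partial>lborel) =
          ennreal (1 / \<bar>c\<bar>) * (\<integral>\<^sup>+x. f (Complex x (s / c * x + 1 / c * y)) \<partial>lborel)"
        using False by (simp add: mult.assoc[symmetric] flip: ennreal_mult)
    qed
    also have "\<dots> = ennreal (1 / \<bar>c\<bar>) * (\<integral>\<^sup>+y. \<integral>\<^sup>+x. f (Complex x (s / c * x + 1 / c * y)) \<partial>lborel \<partial>lborel)"
      by (rule nn_integral_cmult) measurable
    also have "(\<integral>\<^sup>+y. \<integral>\<^sup>+x. f (Complex x (s / c * x + 1 / c * y)) \<partial>lborel \<partial>lborel)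
       = (\<integral>\<^sup>+x. \<integral>\<^sup>+y. f (Complex x (s / c * x + 1 / c * y)) \<partial>lborel \<partial>lborel)"
      by (rule lborel_pair.Fubini') simp
    also have "\<dots> = (\<integral>\<^sup>+x. ennreal \<bar>c\<bar> * (\<integral>\<^sup>+y. f (Complex x y) \<partial>lborel) \<partial>lborel)"
    proof (intro nn_integral_cong)
      fix x
      have "(\<integral>\<^sup>+y. f (Complex x y) \<partial>lborel) = ennreal (1 / \<bar>c\<bar>) * (\<integral>\<^sup>+y. f (Complex x (s / c * x + 1 / c * y)) \<partial>lborel)"
        by (subst nn_integral_real_affine[of _ "1 / c" "s / c * x"]) (use False in auto)
      then show "(\<integral>\<^sup>+y. f (Complex x (s / c * x + 1 / c * y)) \<partial>lborel) = ennreal \<bar>c\<bar> * (\<integral>\<^sup>+y. f (Complex x y) \<partial>lborel)"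
        using False by (simp add: mult.assoc[symmetric] flip: ennreal_mult)
    qed
    also have "\<dots> = ennreal \<bar>c\<bar> * (\<integral>\<^sup>+x. \<integral>\<^sup>+y. f (Complex x y) \<partial>lborel \<partial>lborel)"
      by (rule nn_integral_cmult) measurable
    finally show ?thesis
      using False by (simp add: nn_integral_lborel_complex mult.assoc[symmetric] flip: ennreal_mult)
  qed
qed

text \<open>The parameter \<open>v\<close> is the total variance: real and imaginary part have
  variance v / 2 each.\<close>

definition gden :: "real \<Rightarrow> complex \<Rightarrow> complex \<Rightarrow> real" where
  "gden v \<mu> z = exp (- ((cmod (z - \<mu>))\<^sup>2) / v) / (pi * v)"

lemma gden_measurable [measurable]: "gden v \<mu> \<in> borel_measurable borel"
  unfolding gden_def[abs_def] by measurable

lemma gden_pos: "v > 0 \<Longrightarrow> gden v \<mu> z > 0"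
  by (simp add: gden_def)

lemma ln_gden: "v > 0 \<Longrightarrow> ln (gden v \<mu> z) = - ((cmod (z - \<mu>))\<^sup>2) / v - ln (pi * v)"
  by (simp add: gden_def ln_div)

lemma gden_Complex:
  assumes "v > 0"
  shows "gden v \<mu> (Complex x y) =
    normal_density (Re \<mu>) (sqrt (v / 2)) x * normal_density (Im \<mu>) (sqrt (v / 2)) y"
proof -
  have "(cmod (Complex x y - \<mu>))\<^sup>2 = (x - Re \<mu>)\<^sup>2 + (y - Im \<mu>)\<^sup>2"
    by (simp add: cmod_power2)
  then have "gden v \<mu> (Complex x y) = exp (- (x - Re \<mu>)\<^sup>2 / v) * exp (- (y - Im \<mu>)\<^sup>2 / v) / (pi * v)"
    by (simp add: gden_def diff_divide_distrib flip: exp_add)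
  also have "pi * v = sqrt (pi * v) * sqrt (pi * v)"
    using assms by simp
  finally show ?thesis
    using assms by (simp add: normal_density_def)
qed

lemma nn_integral_normal_density: "\<sigma> > 0 \<Longrightarrow> (\<integral>\<^sup>+x. ennreal (normal_density \<mu> \<sigma> x) \<partial>lborel) = 1"
  using prob_space_normal_density[of \<sigma> \<mu>]
  by (simp add: prob_space_def prob_space_axioms_def emeasure_density)

lemma nn_integral_gden:
  assumes "v > 0"
  shows "(\<integral>\<^sup>+z. ennreal (gden v \<mu> z) \<partial>lborel) = 1"
  using assms
  by (simp add: nn_integral_lborel_complex gden_Complex ennreal_mult nn_integral_cmult nn_integral_normal_density)

lemma cgauss_eq: "cgauss = density lborel (\<lambda>z. ennreal (gden 1 0 z))"
  by (simp add: cgauss_def gden_def)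

lemma sets_cgauss [measurable_cong, simp]: "sets cgauss = sets borel"
  and space_cgauss [simp]: "space cgauss = UNIV"
  by (simp_all add: cgauss_def)

lemma prob_space_cgauss: "prob_space cgauss"
  by standard (simp add: cgauss_eq emeasure_density nn_integral_gden)

interpretation cgauss: prob_space cgauss by (rule prob_space_cgauss)

lemma nn_integral_cgauss:
  "f \<in> borel_measurable borel \<Longrightarrow> (\<integral>\<^sup>+z. f z \<partial>cgauss) = (\<integral>\<^sup>+z. ennreal (gden 1 0 z) * f z \<partial>lborel)"
  by (simp add: cgauss_eq nn_integral_density)

text \<open>Circular symmetry, by invariance of both Lebesgue measure and the modulus. In the
  converse it makes link phases invisible to entropies.\<close>

lemma cgauss_rotate:
  assumes u: "cmod u = 1"
  shows "distr cgauss cgauss (\<lambda>z. u * z) = cgauss"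
proof (rule measure_eqI)
  fix A assume "A \<in> sets (distr cgauss cgauss (\<lambda>z. u * z))"
  then have [measurable]: "A \<in> sets borel" by simp
  have [simp]: "gden 1 0 (u * z) = gden 1 0 z" for z
    using u by (simp add: gden_def norm_mult)
  have "emeasure (distr cgauss cgauss (\<lambda>z. u * z)) A = (\<integral>\<^sup>+z. indicator A z \<partial>distr cgauss cgauss (\<lambda>z. u * z))"
    by (rule nn_integral_indicator[symmetric]) simp
  also have "\<dots> = (\<integral>\<^sup>+z. indicator A (u * z) \<partial>cgauss)"
    by (rule nn_integral_distr) auto
  also have "\<dots> = (\<integral>\<^sup>+z. ennreal (gden 1 0 (u * z)) * indicator A (u * z) \<partial>lborel)"
    by (simp add: nn_integral_cgauss)
  also have "\<dots> = (\<integral>\<^sup>+z. ennreal (gden 1 0 z) * indicator A z \<partial>lborel)"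
    using nn_integral_lborel_rotate[OF _ u, of "\<lambda>z. ennreal (gden 1 0 z) * indicator A z"] by simp
  also have "\<dots> = emeasure cgauss A"
    by (simp add: nn_integral_cgauss flip: nn_integral_indicator)
  finally show "emeasure (distr cgauss cgauss (\<lambda>z. u * z)) A = emeasure cgauss A" .
qed simp

lemma cgauss_shift:
  "distr cgauss borel (\<lambda>z. m + z) = density lborel (\<lambda>z. ennreal (gden 1 m z))"
proof (rule measure_eqI)
  fix A assume "A \<in> sets (distr cgauss borel (\<lambda>z. m + z))"
  then have [measurable]: "A \<in> sets borel" by simp
  have *: "gden 1 0 z = gden 1 m (m + z)" for z by (simp add: gden_def)
  have "emeasure (distr cgauss borel (\<lambda>z. m + z)) A = (\<integral>\<^sup>+z. indicator A z \<partial>distr cgauss borel (\<lambda>z. m + z))"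
    by (rule nn_integral_indicator[symmetric]) simp
  also have "\<dots> = (\<integral>\<^sup>+z. indicator A (m + z) \<partial>cgauss)"
    by (rule nn_integral_distr) auto
  also have "\<dots> = (\<integral>\<^sup>+z. ennreal (gden 1 m (m + z)) * indicator A (m + z) \<partial>lborel)"
    by (simp add: nn_integral_cgauss *)
  also have "\<dots> = (\<integral>\<^sup>+z. ennreal (gden 1 m z) * indicator A z \<partial>distr lborel borel ((+) m))"
    by (subst nn_integral_distr) auto
  also have "\<dots> = emeasure (density lborel (\<lambda>z. ennreal (gden 1 m z))) A"
    by (simp add: lborel_distr_plus emeasure_density)
  finally show "emeasure (distr cgauss borel (\<lambda>z. m + z)) A = emeasure (density lborel (\<lambda>z. ennreal (gden 1 m z))) A" .
qed simp

text \<open>Both components are real Gaussians of variance 1/2, so their even moments are known.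
  Finiteness of the fourth moment is what allows Chebyshev's inequality for squared
  magnitudes.\<close>

lemma cgauss_moments:
  shows cgauss_integrable_norm4: "integrable cgauss (\<lambda>z. (cmod z) ^ 4)"
    and cgauss_integrable_norm2: "integrable cgauss (\<lambda>z. (cmod z)\<^sup>2)"
    and cgauss_integral_norm2: "(\<integral>z. (cmod z)\<^sup>2 \<partial>cgauss) = 1"
    and cgauss_integrable_id: "integrable cgauss (\<lambda>z. z)"
    and cgauss_integral_id: "(\<integral>z. z \<partial>cgauss) = 0"
proof -
  define \<sigma> :: real where "\<sigma> = sqrt (1 / 2)"
  have \<sigma>: "\<sigma> > 0" "\<sigma>\<^sup>2 = 1 / 2" by (auto simp: \<sigma>_def)
  have nn_moment: "(\<integral>\<^sup>+x. ennreal (normal_density 0 \<sigma> x) * ennreal (x ^ (2 * k)) \<partial>lborel)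
      = ennreal (fact (2 * k) / (4 ^ k * fact k))" for k
  proof -
    have "(\<integral>\<^sup>+x. ennreal (normal_density 0 \<sigma> x * x ^ (2 * k)) \<partial>lborel)
        = ennreal (fact (2 * k) / ((2 / \<sigma>\<^sup>2) ^ k * fact k))"
      using normal_moment_even[OF \<sigma>(1), of 0 k]
      by (intro nn_integral_eq_integral[THEN trans])
        (auto simp: has_bochner_integral_iff)
    then show ?thesis by (simp add: \<sigma> ennreal_mult)
  qed
  have split: "(\<integral>\<^sup>+z. f (Re z) \<partial>cgauss) = (\<integral>\<^sup>+x. ennreal (normal_density 0 \<sigma> x) * f x \<partial>lborel)"
    "(\<integral>\<^sup>+z. f (Im z) \<partial>cgauss) = (\<integral>\<^sup>+x. ennreal (normal_density 0 \<sigma> x) * f x \<partial>lborel)"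
    if [measurable]: "f \<in> borel_measurable borel" for f :: "real \<Rightarrow> ennreal"
  proof -
    have "(\<integral>\<^sup>+z. f (Re z) \<partial>cgauss) = (\<integral>\<^sup>+x. \<integral>\<^sup>+y. (ennreal (normal_density 0 \<sigma> x) * f x) * ennreal (normal_density 0 \<sigma> y) \<partial>lborel \<partial>lborel)"
      by (simp add: nn_integral_cgauss nn_integral_lborel_complex gden_Complex \<sigma>_def ennreal_mult ac_simps)
    then show "(\<integral>\<^sup>+z. f (Re z) \<partial>cgauss) = (\<integral>\<^sup>+x. ennreal (normal_density 0 \<sigma> x) * f x \<partial>lborel)"
      by (simp add: nn_integral_cmult nn_integral_normal_density \<sigma>)
    have "(\<integral>\<^sup>+z. f (Im z) \<partial>cgauss) = (\<integral>\<^sup>+y. \<integral>\<^sup>+x. (ennreal (normal_density 0 \<sigma> y) * f y) * ennreal (normal_density 0 \<sigma> x) \<partial>lborel \<partial>lborel)"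
      by (simp add: nn_integral_cgauss nn_integral_lborel_complex_swap gden_Complex \<sigma>_def ennreal_mult ac_simps)
    then show "(\<integral>\<^sup>+z. f (Im z) \<partial>cgauss) = (\<integral>\<^sup>+x. ennreal (normal_density 0 \<sigma> x) * f x \<partial>lborel)"
      by (simp add: nn_integral_cmult nn_integral_normal_density \<sigma>)
  qed
  have m: "(\<integral>\<^sup>+z. ennreal (Re z ^ (2 * k)) \<partial>cgauss) = ennreal (fact (2 * k) / (4 ^ k * fact k))"
    "(\<integral>\<^sup>+z. ennreal (Im z ^ (2 * k)) \<partial>cgauss) = ennreal (fact (2 * k) / (4 ^ k * fact k))" for k
    by (subst split; simp add: nn_moment)+
  have hb: "has_bochner_integral cgauss (\<lambda>z. Re z ^ (2 * k)) (fact (2 * k) / (4 ^ k * fact k))"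
    "has_bochner_integral cgauss (\<lambda>z. Im z ^ (2 * k)) (fact (2 * k) / (4 ^ k * fact k))" for k
    by (rule has_bochner_integral_nn_integral; simp add: m)+
  have "has_bochner_integral cgauss (\<lambda>z. Re z ^ 2 + Im z ^ 2) (1 / 2 + 1 / 2)"
    using has_bochner_integral_add[OF hb(1)[of 1] hb(2)[of 1]] by (simp add: fact_numeral)
  then have hb2: "has_bochner_integral cgauss (\<lambda>z. (cmod z)\<^sup>2) 1"
    by (simp add: cmod_power2)
  then show 2: "integrable cgauss (\<lambda>z. (cmod z)\<^sup>2)" "(\<integral>z. (cmod z)\<^sup>2 \<partial>cgauss) = 1"
    by (auto simp: has_bochner_integral_iff)
  have "integrable cgauss (\<lambda>z. 2 * (Re z ^ 4 + Im z ^ 4))"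
    using hb(1)[of 2] hb(2)[of 2] by (auto simp: has_bochner_integral_iff)
  then show "integrable cgauss (\<lambda>z. (cmod z) ^ 4)"
  proof (rule Bochner_Integration.integrable_bound)
    show "AE z in cgauss. norm (cmod z ^ 4) \<le> norm (2 * (Re z ^ 4 + Im z ^ 4))"
    proof (intro AE_I2)
      fix z :: complex
      have "cmod z ^ 4 = ((Re z)\<^sup>2 + (Im z)\<^sup>2)\<^sup>2"
        by (simp flip: cmod_power2)
      also have "\<dots> \<le> 2 * (Re z ^ 4 + Im z ^ 4)"
        using zero_le_power2[of "(Re z)\<^sup>2 - (Im z)\<^sup>2"]
        by (simp add: power2_sum power2_diff)
      finally show "norm (cmod z ^ 4) \<le> norm (2 * (Re z ^ 4 + Im z ^ 4))" by simp
    qed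
  qed simp
  show i: "integrable cgauss (\<lambda>z. z)"
  proof (rule Bochner_Integration.integrable_bound)
    show "integrable cgauss (\<lambda>z. 1 + (cmod z)\<^sup>2)" using 2 by simp
    have "norm z \<le> norm (1 + (cmod z)\<^sup>2)" for z :: complex
      using zero_le_power2[of "cmod z - 1"] by (simp add: power2_diff) (smt (verit) norm_ge_zero)
    then show "AE z in cgauss. norm z \<le> norm (1 + (cmod z)\<^sup>2)" by simp
  qed simp
  \<comment> \<open>The symmetry z to -z forces the mean to vanish.\<close>
  have "(\<integral>z. z \<partial>cgauss) = (\<integral>z. z \<partial>distr cgauss cgauss (\<lambda>z. (-1) * z))"
    by (subst cgauss_rotate) auto
  also have "\<dots> = - (\<integral>z. z \<partial>cgauss)"
    by (subst integral_distr) auto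
  finally show "(\<integral>z. z \<partial>cgauss) = 0" by simp
qed

section \<open>Finite product measures\<close>

lemma product_sigma_finite_const: "sigma_finite_measure M \<Longrightarrow> product_sigma_finite (\<lambda>_. M)"
  by (simp add: product_sigma_finite_def)

lemma prob_space_PiM_cgauss: "prob_space (PiM J (\<lambda>_. cgauss))"
  by (intro prob_space_PiM prob_space_cgauss)

lemma PiM_density:
  assumes "finite I" and "\<And>i. sigma_finite_measure (M i)" and "\<And>i. sigma_finite_measure (density (M i) (f i))"
    and [measurable]: "\<And>i. f i \<in> borel_measurable (M i)"
  shows "PiM I (\<lambda>i. density (M i) (f i)) = density (PiM I M) (\<lambda>x. \<Prod>i\<in>I. f i (x i))"
proof -
  interpret M: product_sigma_finite M
    using assms by (simp add: product_sigma_finite_def)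
  interpret D: product_sigma_finite "\<lambda>i. density (M i) (f i)"
    using assms by (simp add: product_sigma_finite_def)
  show ?thesis
  proof (rule D.PiM_eqI[OF \<open>finite I\<close>, symmetric])
    show "sets (density (PiM I M) (\<lambda>x. \<Prod>i\<in>I. f i (x i))) = sets (PiM I (\<lambda>i. density (M i) (f i)))"
      by (simp cong: sets_PiM_cong)
    fix A assume A: "\<And>i. i \<in> I \<Longrightarrow> A i \<in> sets (density (M i) (f i))"
    then have A': "\<And>i. i \<in> I \<Longrightarrow> A i \<in> sets (M i)" by simp
    then have [measurable]: "Pi\<^sub>E I A \<in> sets (PiM I M)"
      using \<open>finite I\<close> by (intro sets_PiM_I_finite)
    have "emeasure (density (PiM I M) (\<lambda>x. \<Prod>i\<in>I. f i (x i))) (Pi\<^sub>E I A)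
        = (\<integral>\<^sup>+x. (\<Prod>i\<in>I. f i (x i)) * indicator (Pi\<^sub>E I A) x \<partial>PiM I M)"
      by (rule emeasure_density) measurable
    also have "\<dots> = (\<integral>\<^sup>+x. (\<Prod>i\<in>I. f i (x i) * indicator (A i) (x i)) \<partial>PiM I M)"
    proof (rule nn_integral_cong)
      fix x assume x: "x \<in> space (PiM I M)"
      then have "indicator (Pi\<^sub>E I A) x = (\<Prod>i\<in>I. indicator (A i) (x i) :: ennreal)"
        using \<open>finite I\<close> by (auto simp: space_PiM PiE_iff indicator_def prod_zero_iff intro!: prod.neutral[symmetric])
      then show "(\<Prod>i\<in>I. f i (x i)) * indicator (Pi\<^sub>E I A) x = (\<Prod>i\<in>I. f i (x i) * indicator (A i) (x i))"
        by (simp add: prod.distrib)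
    qed
    also have "\<dots> = (\<Prod>i\<in>I. \<integral>\<^sup>+x. f i x * indicator (A i) x \<partial>M i)"
      using A' by (intro M.product_nn_integral_prod \<open>finite I\<close>) auto
    also have "\<dots> = (\<Prod>i\<in>I. emeasure (density (M i) (f i)) (A i))"
      using A' by (intro prod.cong) (auto simp: emeasure_density)
    finally show "emeasure (density (PiM I M) (\<lambda>x. \<Prod>i\<in>I. f i (x i))) (Pi\<^sub>E I A) =
        (\<Prod>i\<in>I. emeasure (density (M i) (f i)) (A i))" .
  qed
qed

lemma distr_PiM_coordinatewise:
  assumes "finite I" and M: "\<And>i. prob_space (M i)"
    and fi [measurable]: "\<And>i. f i \<in> M i \<rightarrow>\<^sub>M N i"
  shows "distr (PiM I M) (PiM I N) (\<lambda>x. \<lambda>i\<in>I. f i (x i)) = PiM I (\<lambda>i. distr (M i) (N i) (f i))"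
proof -
  interpret M: product_sigma_finite M
    using M by (simp add: product_sigma_finite_def prob_space_imp_sigma_finite)
  interpret D: product_sigma_finite "\<lambda>i. distr (M i) (N i) (f i)"
    using M by (simp add: product_sigma_finite_def prob_space_imp_sigma_finite prob_space.prob_space_distr)
  show ?thesis
  proof (rule D.PiM_eqI[OF \<open>finite I\<close>])
    show "sets (distr (PiM I M) (PiM I N) (\<lambda>x. \<lambda>i\<in>I. f i (x i))) = sets (PiM I (\<lambda>i. distr (M i) (N i) (f i)))"
      by (simp cong: sets_PiM_cong)
    fix A assume A: "\<And>i. i \<in> I \<Longrightarrow> A i \<in> sets (distr (M i) (N i) (f i))"
    then have A': "\<And>i. i \<in> I \<Longrightarrow> A i \<in> sets (N i)" by simp
    have "emeasure (distr (PiM I M) (PiM I N) (\<lambda>x. \<lambda>i\<in>I. f i (x i))) (Pi\<^sub>E I A)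
        = emeasure (PiM I M) ((\<lambda>x. \<lambda>i\<in>I. f i (x i)) -` Pi\<^sub>E I A \<inter> space (PiM I M))"
      using A' \<open>finite I\<close> by (intro emeasure_distr sets_PiM_I_finite) auto
    also have "(\<lambda>x. \<lambda>i\<in>I. f i (x i)) -` Pi\<^sub>E I A \<inter> space (PiM I M) = Pi\<^sub>E I (\<lambda>i. f i -` A i \<inter> space (M i))"
      by (auto simp: space_PiM PiE_iff)
    also have "emeasure (PiM I M) \<dots> = (\<Prod>i\<in>I. emeasure (M i) (f i -` A i \<inter> space (M i)))"
      using A' by (intro M.emeasure_PiM \<open>finite I\<close>) auto
    also have "\<dots> = (\<Prod>i\<in>I. emeasure (distr (M i) (N i) (f i)) (A i))"
      using A' by (intro prod.cong) (auto simp: emeasure_distr)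
    finally show "emeasure (distr (PiM I M) (PiM I N) (\<lambda>x. \<lambda>i\<in>I. f i (x i))) (Pi\<^sub>E I A) =
        (\<Prod>i\<in>I. emeasure (distr (M i) (N i) (f i)) (A i))" .
  qed
qed

lemma distr_PiM_cgauss_component: "i \<in> J \<Longrightarrow> distr (PiM J (\<lambda>_. cgauss)) cgauss (\<lambda>\<omega>. \<omega> i) = cgauss"
  by (rule distr_PiM_component) (auto intro: prob_space_cgauss)

lemma integrable_PiM_cgauss_component:
  fixes f :: "complex \<Rightarrow> 'b :: {banach, second_countable_topology}"
  assumes "i \<in> J" and "f \<in> borel_measurable borel"
  shows "integrable (PiM J (\<lambda>_. cgauss)) (\<lambda>\<omega>. f (\<omega> i)) \<longleftrightarrow> integrable cgauss f"
  using assms integrable_distr_eq[of "\<lambda>\<omega>. \<omega> i" "PiM J (\<lambda>_. cgauss)" cgauss f]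
  by (simp add: distr_PiM_cgauss_component)

lemma integral_PiM_cgauss_component:
  fixes f :: "complex \<Rightarrow> 'b :: {banach, second_countable_topology}"
  assumes "i \<in> J" and "f \<in> borel_measurable borel"
  shows "(\<integral>\<omega>. f (\<omega> i) \<partial>PiM J (\<lambda>_. cgauss)) = (\<integral>z. f z \<partial>cgauss)"
  using assms integral_distr[of "\<lambda>\<omega>. \<omega> i" "PiM J (\<lambda>_. cgauss)" cgauss f]
  by (simp add: distr_PiM_cgauss_component)

lemma indep_vars_PiM_coordinates:
  assumes "\<And>i. i \<in> J \<Longrightarrow> prob_space (M i)"
  shows "prob_space.indep_vars (PiM J M) M (\<lambda>i \<omega>. \<omega> i) J"
proof (cases "J = {}")
  case True
  interpret prob_space "PiM J M" using assms by (intro prob_space_PiM)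
  show ?thesis unfolding indep_vars_def indep_sets_def using True by simp
next
  case False
  interpret prob_space "PiM J M" using assms by (intro prob_space_PiM)
  show ?thesis
  proof (subst indep_vars_iff_distr_eq_PiM'[OF False])
    have "distr (PiM J M) (PiM J M) (\<lambda>x. restrict x J) = distr (PiM J M) (PiM J M) (\<lambda>x. x)"
      by (intro distr_cong) (auto simp: space_PiM)
    also have "\<dots> = PiM J M" by (rule distr_id)
    also have "\<dots> = PiM J (\<lambda>i. distr (PiM J M) (M i) (\<lambda>\<omega>. \<omega> i))"
      using assms by (intro PiM_cong refl distr_PiM_component[symmetric]) auto
    finally show "distr (PiM J M) (PiM J M) (\<lambda>x. \<lambda>i\<in>J. x i) = PiM J (\<lambda>i. distr (PiM J M) (M i) (\<lambda>\<omega>. \<omega> i))" .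
  qed simp
qed

text \<open>Functions of disjoint blocks of coordinates are independent, so centred terms are
  uncorrelated and their variances add. Applied to the information density and to the energy of a
  codebook.\<close>

lemma Chebyshev_sum_blocks:
  fixes T :: "'i \<Rightarrow> ('j \<Rightarrow> complex) \<Rightarrow> real"
  assumes "finite I" and block: "\<And>i. i \<in> I \<Longrightarrow> b i \<subseteq> J" and disj: "disjoint_family_on b I"
    and [measurable]: "\<And>i. i \<in> I \<Longrightarrow> T i \<in> borel_measurable (PiM (b i) (\<lambda>_. cgauss))"
    and int: "\<And>i. i \<in> I \<Longrightarrow> integrable (PiM J (\<lambda>_. cgauss)) (\<lambda>\<omega>. (T i (restrict \<omega> (b i)))\<^sup>2)"
    and mean: "\<And>i. i \<in> I \<Longrightarrow> (\<integral>\<omega>. T i (restrict \<omega> (b i)) \<partial>PiM J (\<lambda>_. cgauss)) = 0"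
    and var: "\<And>i. i \<in> I \<Longrightarrow> (\<integral>\<omega>. (T i (restrict \<omega> (b i)))\<^sup>2 \<partial>PiM J (\<lambda>_. cgauss)) \<le> C"
    and "a > 0"
  shows "measure (PiM J (\<lambda>_. cgauss)) {\<omega> \<in> space (PiM J (\<lambda>_. cgauss)). a \<le> \<bar>\<Sum>i\<in>I. T i (restrict \<omega> (b i))\<bar>}
           \<le> real (card I) * C / a\<^sup>2"
proof -
  let ?P = "PiM J (\<lambda>_. cgauss)" and ?X = "\<lambda>i \<omega>. T i (restrict \<omega> (b i))"
  interpret prob_space ?P by (rule prob_space_PiM_cgauss)
  have indep: "indep_vars (\<lambda>_. borel) ?X I"
    using indep_vars_compose2[OF indep_vars_restrict[OF indep_vars_PiM_coordinates[of J "\<lambda>_. cgauss"] block disj], of T "\<lambda>_. borel"]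
    by (simp add: prob_space_cgauss)
  have rv: "?X i \<in> borel_measurable ?P" if "i \<in> I" for i
    using indep that unfolding indep_vars_def by auto
  have int1: "integrable ?P (?X i)" if "i \<in> I" for i
    by (rule square_integrable_imp_integrable[OF rv[OF that] int[OF that]])
  have pair: "integrable ?P (\<lambda>\<omega>. ?X i \<omega> * ?X j \<omega>) \<and> expectation (\<lambda>\<omega>. ?X i \<omega> * ?X j \<omega>) = 0"
    if "i \<in> I" "j \<in> I" "i \<noteq> j" for i j
  proof -
    have ind: "indep_vars (\<lambda>_. borel) ?X {i, j}"
      using indep that by (auto intro: indep_vars_subset)
    have "integrable ?P (?X k)" if "k \<in> {i, j}" for k
      using int1 that \<open>i \<in> I\<close> \<open>j \<in> I\<close> by auto
    from indep_vars_lebesgue_integral[OF _ ind this] indep_vars_integrable[OF _ ind this] show ?thesis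
      using mean that by simp
  qed
  let ?S = "\<lambda>\<omega>. \<Sum>i\<in>I. ?X i \<omega>"
  have sq: "(?S \<omega>)\<^sup>2 = (\<Sum>i\<in>I. \<Sum>j\<in>I. ?X i \<omega> * ?X j \<omega>)" for \<omega>
    by (simp add: power2_eq_square sum_product)
  have intp: "integrable ?P (\<lambda>\<omega>. ?X i \<omega> * ?X j \<omega>)" if "i \<in> I" "j \<in> I" for i j
    using pair[of i j] int[of i] that by (cases "i = j") (auto simp: power2_eq_square)
  have int2: "integrable ?P (\<lambda>\<omega>. (?S \<omega>)\<^sup>2)"
    unfolding sq using intp by auto
  have "expectation (\<lambda>\<omega>. (?S \<omega>)\<^sup>2) = (\<Sum>i\<in>I. \<Sum>j\<in>I. expectation (\<lambda>\<omega>. ?X i \<omega> * ?X j \<omega>))"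
    unfolding sq using intp by (simp add: Bochner_Integration.integral_sum)
  also have "\<dots> = (\<Sum>i\<in>I. \<Sum>j\<in>I. if i = j then expectation (\<lambda>\<omega>. (?X i \<omega>)\<^sup>2) else 0)"
    using pair by (intro sum.cong refl) (auto simp: power2_eq_square)
  also have "\<dots> = (\<Sum>i\<in>I. expectation (\<lambda>\<omega>. (?X i \<omega>)\<^sup>2))"
    using \<open>finite I\<close> by simp
  also have "\<dots> \<le> (\<Sum>i\<in>I. C)" by (intro sum_mono var)
  finally have le: "expectation (\<lambda>\<omega>. (?S \<omega>)\<^sup>2) \<le> real (card I) * C" by simp
  have S0: "expectation ?S = 0"
    using int1 mean by (simp add: Bochner_Integration.integral_sum)
  have "prob {\<omega> \<in> space ?P. a \<le> \<bar>?S \<omega> - expectation ?S\<bar>} \<le> variance ?S / a\<^sup>2"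
    using int2 \<open>a > 0\<close> rv by (intro Chebyshev_inequality) auto
  also have "\<dots> \<le> real (card I) * C / a\<^sup>2"
    using le by (intro divide_right_mono) (auto simp: S0)
  finally show ?thesis by (simp add: S0)
qed

text \<open>Joins codebook and noise into a single family of independent variables, so that one
  linear form can mix transmitted symbols and noise.\<close>

lemma distr_PiM_Plus:
  assumes "finite A" "finite B" and M: "\<And>i. prob_space (M i)" "\<And>i. prob_space (N i)"
  shows "distr (PiM A M \<Otimes>\<^sub>M PiM B N) (PiM (A <+> B) (case_sum M N))
      (\<lambda>(x, y). \<lambda>j\<in>A <+> B. case_sum x y j) = PiM (A <+> B) (case_sum M N)"
proof -
  interpret M: product_sigma_finite M
    using M by (simp add: product_sigma_finite_def prob_space_imp_sigma_finite)
  interpret N: product_sigma_finite N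
    using M by (simp add: product_sigma_finite_def prob_space_imp_sigma_finite)
  interpret S: product_sigma_finite "case_sum M N"
    using M by (auto simp: product_sigma_finite_def prob_space_imp_sigma_finite split: sum.split)
  interpret PN: prob_space "PiM B N" using M by (intro prob_space_PiM)
  have comp: "(\<lambda>z. case_sum (fst z) (snd z) j) \<in> (PiM A M \<Otimes>\<^sub>M PiM B N) \<rightarrow>\<^sub>M case_sum M N j" if "j \<in> A <+> B" for j
    using that by (cases j) auto
  have meas: "(\<lambda>(x, y). \<lambda>j\<in>A <+> B. case_sum x y j) \<in> (PiM A M \<Otimes>\<^sub>M PiM B N) \<rightarrow>\<^sub>M PiM (A <+> B) (case_sum M N)"
    unfolding split_beta' by (intro measurable_restrict comp)
  show ?thesis
  proof (rule S.PiM_eqI)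
    fix E assume E: "\<And>i. i \<in> A <+> B \<Longrightarrow> E i \<in> sets (case_sum M N i)"
    have EA: "i \<in> A \<Longrightarrow> E (Inl i) \<in> sets (M i)" and EB: "j \<in> B \<Longrightarrow> E (Inr j) \<in> sets (N j)" for i j
      using E[of "Inl i"] E[of "Inr j"] by auto
    have "emeasure (distr (PiM A M \<Otimes>\<^sub>M PiM B N) (PiM (A <+> B) (case_sum M N))
        (\<lambda>(x, y). \<lambda>j\<in>A <+> B. case_sum x y j)) (Pi\<^sub>E (A <+> B) E)
      = emeasure (PiM A M \<Otimes>\<^sub>M PiM B N)
         ((\<lambda>(x, y). \<lambda>j\<in>A <+> B. case_sum x y j) -` Pi\<^sub>E (A <+> B) E \<inter> space (PiM A M \<Otimes>\<^sub>M PiM B N))"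
      using E assms by (intro emeasure_distr meas sets_PiM_I_finite) auto
    also have "(\<lambda>(x, y). \<lambda>j\<in>A <+> B. case_sum x y j) -` Pi\<^sub>E (A <+> B) E \<inter> space (PiM A M \<Otimes>\<^sub>M PiM B N)
       = Pi\<^sub>E A (\<lambda>i. E (Inl i)) \<times> Pi\<^sub>E B (\<lambda>j. E (Inr j))"
      (is "?L = ?R")
    proof (intro set_eqI)
      fix z :: "('a \<Rightarrow> 'c) \<times> ('b \<Rightarrow> 'c)"
      obtain x y where z: "z = (x, y)" by (cases z) auto
      have "z \<in> ?L \<longleftrightarrow> (\<forall>i\<in>A. x i \<in> E (Inl i)) \<and> (\<forall>j\<in>B. y j \<in> E (Inr j)) \<and>
          x \<in> extensional A \<and> y \<in> extensional B \<and> (\<forall>i\<in>A. x i \<in> space (M i)) \<and> (\<forall>j\<in>B. y j \<in> space (N j))"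
        unfolding z by (auto simp: space_pair_measure space_PiM PiE_iff Plus_def ball_Un)
      also have "\<dots> \<longleftrightarrow> z \<in> ?R"
        unfolding z using EA[THEN sets.sets_into_space] EB[THEN sets.sets_into_space]
        by (auto simp: PiE_iff) blast+
      finally show "z \<in> ?L \<longleftrightarrow> z \<in> ?R" .
    qed
    also have "emeasure (PiM A M \<Otimes>\<^sub>M PiM B N) \<dots> =
        (\<Prod>i\<in>A. emeasure (M i) (E (Inl i))) * (\<Prod>j\<in>B. emeasure (N j) (E (Inr j)))"
      using EA EB assms by (subst PN.emeasure_pair_measure_Times) (auto simp: M.emeasure_PiM N.emeasure_PiM)
    also have "\<dots> = (\<Prod>j\<in>A <+> B. emeasure (case_sum M N j) (E j))"
      using assms by (simp add: prod.Plus)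
    finally show "emeasure (distr (PiM A M \<Otimes>\<^sub>M PiM B N) (PiM (A <+> B) (case_sum M N))
        (\<lambda>(x, y). \<lambda>j\<in>A <+> B. case_sum x y j)) (Pi\<^sub>E (A <+> B) E)
        = (\<Prod>j\<in>A <+> B. emeasure (case_sum M N j) (E j))" .
  qed (use assms in auto)
qed

section \<open>Gaussian mixtures\<close>

lemma PiM_cgauss_component_measurable:
  "i \<in> I \<Longrightarrow> (\<lambda>z. z i) \<in> borel_measurable (PiM I (\<lambda>_. cgauss))"
  using measurable_component_singleton[of i I "\<lambda>_. cgauss"] by simp

text \<open>Independence of two users' uniform messages in counting form: inserting the factor 1 at
  all other coordinates makes the sum of products a product of sums.\<close>

lemma sum_PiE_prod2:
  fixes f g :: "'b \<Rightarrow> 'c :: comm_semiring_1"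
  assumes "finite A" "\<And>x. x \<in> A \<Longrightarrow> finite (B x)" "k \<in> A" "t \<in> A" "k \<noteq> t"
  shows "(\<Sum>w\<in>PiE A B. f (w k) * g (w t)) =
    (\<Sum>x\<in>B k. f x) * (\<Sum>x\<in>B t. g x) * of_nat (\<Prod>x\<in>A - {k, t}. card (B x))"
proof -
  define h where "h x y = (if x = k then f y else if x = t then g y else 1)" for x y
  have rem: "(\<Prod>x\<in>A. H x) = H k * H t * (\<Prod>x\<in>A - {k, t}. H x)" for H :: "'a \<Rightarrow> 'c"
  proof -
    have "A - {k, t} = A - {k} - {t}" by auto
    then show ?thesis
      using assms prod.remove[of A k H] prod.remove[of "A - {k}" t H] by (simp add: mult.assoc)
  qed
  have "(\<Sum>w\<in>PiE A B. f (w k) * g (w t)) = (\<Sum>w\<in>PiE A B. \<Prod>x\<in>A. h x (w x))"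
    by (intro sum.cong refl, subst rem) (auto simp: h_def \<open>k \<noteq> t\<close>[symmetric])
  also have "\<dots> = (\<Prod>x\<in>A. \<Sum>y\<in>B x. h x y)"
    using assms by (simp add: prod_sum_PiE)
  also have "\<dots> = (\<Sum>x\<in>B k. f x) * (\<Sum>x\<in>B t. g x) * of_nat (\<Prod>x\<in>A - {k, t}. card (B x))"
    by (subst rem) (use \<open>k \<noteq> t\<close> in \<open>auto simp: h_def intro!: arg_cong2[where f = "(*)"] prod.cong\<close>)
  finally show ?thesis .
qed

lemma finite_msgs: "finite (msgs K M)"
  by (simp add: msgs_def finite_PiE)

lemma card_msgs: "card (msgs K M) = (\<Prod>k<K. M k)"
  by (simp add: msgs_def card_PiE)

text \<open>An average lies between its extreme terms, so a bound on all logarithms survives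
  averaging. This dominates the log-density of a mixture by those of its components.\<close>

lemma ln_average_bound:
  fixes x :: "'w \<Rightarrow> real"
  assumes "finite W" "W \<noteq> {}" and "\<And>w. w \<in> W \<Longrightarrow> x w > 0" and "\<And>w. w \<in> W \<Longrightarrow> \<bar>ln (x w)\<bar> \<le> B"
  shows "\<bar>ln ((\<Sum>w\<in>W. x w) / real (card W))\<bar> \<le> B"
proof -
  have c: "real (card W) > 0" using assms by (simp add: card_gt_0_iff)
  have *: "exp (- B) \<le> x w" "x w \<le> exp B" if "w \<in> W" for w
    using assms(3,4)[OF that] by (smt (verit) exp_le_cancel_iff exp_ln)+
  have "exp (- B) * card W \<le> (\<Sum>w\<in>W. x w)"
    using sum_mono[of W "\<lambda>_. exp (- B)" x] * by (simp add: mult.commute)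
  moreover have "(\<Sum>w\<in>W. x w) \<le> exp B * card W"
    using sum_mono[of W x "\<lambda>_. exp B"] * by (simp add: mult.commute)
  ultimately have "exp (- B) \<le> (\<Sum>w\<in>W. x w) / card W" "(\<Sum>w\<in>W. x w) / card W \<le> exp B"
    using c by (auto simp: field_simps)
  moreover have "(\<Sum>w\<in>W. x w) / card W > 0"
    using assms c by (auto intro!: divide_pos_pos sum_pos)
  ultimately have "- B \<le> ln ((\<Sum>w\<in>W. x w) / card W)" "ln ((\<Sum>w\<in>W. x w) / card W) \<le> B"
    by (smt (verit) exp_gt_zero ln_exp ln_le_cancel_iff)+
  then show ?thesis by (auto simp: abs_le_iff)
qed

lemma ln_prod_gden: 
  "finite S \<Longrightarrow> ln (\<Prod>i\<in>S. gden 1 0 (x i)) = (\<Sum>i\<in>S. - (cmod (x i))\<^sup>2 - ln pi)"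
  by (subst ln_prod) (auto simp: gden_pos gden_pos[THEN less_imp_neq, symmetric] ln_gden)

lemma integrable_PiM_cgauss_norm2:
  assumes "i \<in> I"
  shows "integrable (PiM I (\<lambda>_. cgauss)) (\<lambda>z. (cmod (b + z i))\<^sup>2)"
    and "(\<integral>z. (cmod (b + z i))\<^sup>2 \<partial>PiM I (\<lambda>_. cgauss)) = (cmod b)\<^sup>2 + 1"
proof -
  have eq: "(cmod (b + z))\<^sup>2 = (cmod b)\<^sup>2 + 2 * Re (cnj b * z) + (cmod z)\<^sup>2" for z
    by (simp add: cmod_power2 power2_sum algebra_simps)
  have int: "integrable cgauss (\<lambda>z. cnj b * z)" and "(\<integral>z. cnj b * z \<partial>cgauss) = 0"
    by (simp_all add: cgauss_integrable_id cgauss_integral_id)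
  then have int': "integrable cgauss (\<lambda>z. Re (cnj b * z))" and "(\<integral>z. Re (cnj b * z) \<partial>cgauss) = 0"
    using integrable_Re[OF int] integral_Re[OF int] by (simp_all add: cgauss_integral_id)
  then have "integrable cgauss (\<lambda>z. (cmod b)\<^sup>2 + 2 * Re (cnj b * z) + (cmod z)\<^sup>2)"
    "(\<integral>z. (cmod b)\<^sup>2 + 2 * Re (cnj b * z) + (cmod z)\<^sup>2 \<partial>cgauss) = (cmod b)\<^sup>2 + 2 * 0 + 1"
    using cgauss_integrable_norm2 cgauss_integral_norm2 cgauss.prob_space
    by (simp_all only: Bochner_Integration.integrable_add Bochner_Integration.integral_add cgauss.integrable_const
        integrable_mult_right integral_mult_right_zero integral_const lebesgue_integral_const space_cgauss scaleR_one)
  then have "integrable cgauss (\<lambda>z. (cmod (b + z))\<^sup>2)" "(\<integral>z. (cmod (b + z))\<^sup>2 \<partial>cgauss) = (cmod b)\<^sup>2 + 1"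
    unfolding eq by simp_all
  then show "integrable (PiM I (\<lambda>_. cgauss)) (\<lambda>z. (cmod (b + z i))\<^sup>2)"
    and "(\<integral>z. (cmod (b + z i))\<^sup>2 \<partial>PiM I (\<lambda>_. cgauss)) = (cmod b)\<^sup>2 + 1"
    using assms by (simp_all add: integrable_PiM_cgauss_component[where f = "\<lambda>z. (cmod (b + z))\<^sup>2"]
        integral_PiM_cgauss_component[where f = "\<lambda>z. (cmod (b + z))\<^sup>2"])
qed

text \<open>Log-density of the output \<open>b w + z\<close>, restricted to the coordinates \<open>S\<close>, under a uniform mixture
  of the \<open>m\<close> signals \<open>b\<close>; its expectation is minus the differential entropy of a signal plus noise.\<close>

definition mix_ln :: "'i set \<Rightarrow> nat \<Rightarrow> (nat \<Rightarrow> 'i \<Rightarrow> complex) \<Rightarrow> nat \<Rightarrow> ('i \<Rightarrow> complex) \<Rightarrow> real" where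
  "mix_ln S m b w z = ln ((\<Sum>w'<m. \<Prod>i\<in>S. gden 1 0 (b w i - b w' i + z i)) / real m)"

lemma mix_ln_measurable:
  assumes "finite I" "S \<subseteq> I"
  shows "mix_ln S m b w \<in> borel_measurable (PiM I (\<lambda>_. cgauss))"
proof -
  have [measurable]: "(\<lambda>z. z i) \<in> borel_measurable (PiM I (\<lambda>_. cgauss))" if "i \<in> S" for i
    using assms that by (intro PiM_cgauss_component_measurable) auto
  show ?thesis
    unfolding mix_ln_def[abs_def] by measurable
qed

text \<open>The logarithm of a product of Gaussian densities is quadratic in the noise, which is
  integrable; \<open>ln_average_bound\<close> carries this over to the mixture.\<close>

lemma mix_ln_integrable:
  assumes "finite I" "S \<subseteq> I" "m \<ge> 1"
  shows "integrable (PiM I (\<lambda>_. cgauss)) (mix_ln S m b w)"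
proof (rule Bochner_Integration.integrable_bound)
  \<comment> \<open>Summing over \<open>w'\<close> replaces a maximum over the components, so one
    majorant serves all of them.\<close>
  let ?B = "\<lambda>z. \<Sum>w'<m. \<Sum>i\<in>S. (cmod ((b w i - b w' i) + z i))\<^sup>2 + ln pi"
  have fS: "finite S" using assms finite_subset by auto
  interpret prob_space "PiM I (\<lambda>_. cgauss)" by (rule prob_space_PiM_cgauss)
  show "integrable (PiM I (\<lambda>_. cgauss)) ?B"
    using assms by (intro Bochner_Integration.integrable_sum Bochner_Integration.integrable_add
        integrable_PiM_cgauss_norm2) auto
  show "mix_ln S m b w \<in> borel_measurable (PiM I (\<lambda>_. cgauss))"
    using assms by (intro mix_ln_measurable)
  have lnpi: "ln pi \<ge> 0" using pi_gt3 by simp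
  have "\<bar>mix_ln S m b w z\<bar> \<le> ?B z" for z
  proof -
    have "\<bar>ln (\<Prod>i\<in>S. gden 1 0 (b w i - b w' i + z i))\<bar> \<le> ?B z" if w': "w' < m" for w'
    proof -
      have "\<bar>ln (\<Prod>i\<in>S. gden 1 0 (b w i - b w' i + z i))\<bar> \<le> (\<Sum>i\<in>S. \<bar>- (cmod ((b w i - b w' i) + z i))\<^sup>2 - ln pi\<bar>)"
        unfolding ln_prod_gden[OF fS] by (rule sum_abs)
      also have "\<dots> = (\<Sum>i\<in>S. (cmod ((b w i - b w' i) + z i))\<^sup>2 + ln pi)"
        using lnpi by (intro sum.cong refl) (smt (verit) zero_le_power2)
      also have "\<dots> \<le> ?B z"
        using w' lnpi by (intro member_le_sum[of w' "{..<m}" "\<lambda>w'. \<Sum>i\<in>S. (cmod ((b w i - b w' i) + z i))\<^sup>2 + ln pi"])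
          (auto intro!: sum_nonneg)
      finally show ?thesis .
    qed
    moreover have "(\<Prod>i\<in>S. gden 1 0 (b w i - b w' i + z i)) > 0" for w'
      by (auto intro!: prod_pos gden_pos)
    moreover have "{..<m} \<noteq> {}"
      using assms by (auto simp: lessThan_empty_iff)
    ultimately show ?thesis
      unfolding mix_ln_def using ln_average_bound[of "{..<m}" "\<lambda>w'. \<Prod>i\<in>S. gden 1 0 (b w i - b w' i + z i)" "?B z"]
      by simp
  qed
  then show "AE z in PiM I (\<lambda>_. cgauss). norm (mix_ln S m b w z) \<le> norm (?B z)"
    by (simp add: order_trans[OF _ abs_ge_self])
qed

text \<open>Rotating the noise coordinatewise by \<open>u\<close> preserves its law and multiplies
  every argument of the densities by \<open>u i\<close>, whose modulus is 1. A block of interference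
  thus has the same entropy at the disturbed receiver as at the receiver of the user who sent
  it.\<close>

lemma mix_ln_rotate:
  assumes "finite I" "S \<subseteq> I" and u: "\<And>i. cmod (u i) = 1"
    and b: "\<And>w i. i \<in> S \<Longrightarrow> b w i = u i * b' w i"
  shows "(\<integral>z. mix_ln S m b w z \<partial>PiM I (\<lambda>_. cgauss)) = (\<integral>z. mix_ln S m b' w z \<partial>PiM I (\<lambda>_. cgauss))"
proof -
  let ?\<nu> = "PiM I (\<lambda>_. cgauss)"
  have "distr ?\<nu> ?\<nu> (\<lambda>z. \<lambda>i\<in>I. u i * z i) = PiM I (\<lambda>i. distr cgauss cgauss ((*) (u i)))"
    using assms by (intro distr_PiM_coordinatewise prob_space_cgauss) auto
  also have "\<dots> = ?\<nu>" using u by (simp add: cgauss_rotate)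
  finally have "(\<integral>z. mix_ln S m b w z \<partial>?\<nu>) = (\<integral>z. mix_ln S m b w z \<partial>distr ?\<nu> ?\<nu> (\<lambda>z. \<lambda>i\<in>I. u i * z i))"
    by simp
  also have "\<dots> = (\<integral>z. mix_ln S m b w (\<lambda>i\<in>I. u i * z i) \<partial>?\<nu>)"
    using assms by (intro integral_distr mix_ln_measurable) auto
  also have "\<dots> = (\<integral>z. mix_ln S m b' w z \<partial>?\<nu>)"
  proof (intro Bochner_Integration.integral_cong refl)
    fix z
    have "gden 1 0 (b w i - b w' i + (\<lambda>i\<in>I. u i * z i) i) = gden 1 0 (b' w i - b' w' i + z i)" if "i \<in> S" for i w'
    proof -
      have "b w i - b w' i + (\<lambda>i\<in>I. u i * z i) i = u i * (b' w i - b' w' i + z i)"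
        using b[OF that] that assms by (auto simp: algebra_simps)
      then show ?thesis using u by (simp add: gden_def norm_mult)
    qed
    then show "mix_ln S m b w (\<lambda>i\<in>I. u i * z i) = mix_ln S m b' w z"
      by (simp add: mix_ln_def)
  qed
  finally show ?thesis .
qed

lemma PiM_cgauss_shift_measurable:
  "(\<lambda>z. \<lambda>i\<in>I. m i + z i) \<in> PiM I (\<lambda>_. cgauss) \<rightarrow>\<^sub>M PiM I (\<lambda>_. borel)"
  by (intro measurable_restrict borel_measurable_add PiM_cgauss_component_measurable) auto

text \<open>Passes from the noise to the output as integration variable; there the densities
  belonging to different messages can be added under one integral.\<close>

lemma nn_integral_PiM_cgauss_shift:
  assumes "finite I" and [measurable]: "F \<in> borel_measurable (PiM I (\<lambda>_. lborel))"
  shows "(\<integral>\<^sup>+z. F (\<lambda>i\<in>I. m i + z i) \<partial>PiM I (\<lambda>_. cgauss)) =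
    (\<integral>\<^sup>+y. ennreal (\<Prod>i\<in>I. gden 1 (m i) (y i)) * F y \<partial>PiM I (\<lambda>_. lborel))"
proof -
  let ?\<nu> = "PiM I (\<lambda>_. cgauss)" and ?Leb = "PiM I (\<lambda>_. lborel :: complex measure)"
  have "distr ?\<nu> (PiM I (\<lambda>_. borel)) (\<lambda>z. \<lambda>i\<in>I. m i + z i) = PiM I (\<lambda>i. distr cgauss borel ((+) (m i)))"
    using assms by (intro distr_PiM_coordinatewise prob_space_cgauss) auto
  also have "\<dots> = PiM I (\<lambda>i. density lborel (\<lambda>z. ennreal (gden 1 (m i) z)))"
    by (simp add: cgauss_shift)
  also have "\<dots> = density ?Leb (\<lambda>y. \<Prod>i\<in>I. ennreal (gden 1 (m i) (y i)))"
  proof (rule PiM_density[OF assms(1)])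
    show "sigma_finite_measure (density lborel (\<lambda>z. ennreal (gden 1 (m i) z)))" for i
      unfolding cgauss_shift[symmetric]
      by (intro prob_space_imp_sigma_finite cgauss.prob_space_distr) auto
  qed (auto intro: sigma_finite_lborel)
  also have "\<dots> = density ?Leb (\<lambda>y. ennreal (\<Prod>i\<in>I. gden 1 (m i) (y i)))"
    by (simp add: prod_ennreal gden_pos less_imp_le)
  finally have eq: "distr ?\<nu> (PiM I (\<lambda>_. borel)) (\<lambda>z. \<lambda>i\<in>I. m i + z i) = density ?Leb (\<lambda>y. ennreal (\<Prod>i\<in>I. gden 1 (m i) (y i)))" .
  have s: "sets (PiM I (\<lambda>_. borel)) = sets ?Leb" by (intro sets_PiM_cong) auto
  have F: "F \<in> borel_measurable (PiM I (\<lambda>_. borel))" using assms(2) by (simp add: measurable_cong_sets[OF s refl])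
  have "(\<integral>\<^sup>+z. F (\<lambda>i\<in>I. m i + z i) \<partial>?\<nu>) = (\<integral>\<^sup>+y. F y \<partial>distr ?\<nu> (PiM I (\<lambda>_. borel)) (\<lambda>z. \<lambda>i\<in>I. m i + z i))"
    by (rule nn_integral_distr[OF PiM_cgauss_shift_measurable, symmetric]) (simp add: F)
  also have "\<dots> = (\<integral>\<^sup>+y. ennreal (\<Prod>i\<in>I. gden 1 (m i) (y i)) * F y \<partial>?Leb)"
    unfolding eq by (rule nn_integral_density) measurable
  finally show ?thesis .
qed

lemma nn_integral_PiM_lborel_gden:
  assumes "finite I" "\<And>i. i \<in> I \<Longrightarrow> v i > 0"
  shows "(\<integral>\<^sup>+y. ennreal (\<Prod>i\<in>I. gden (v i) (m i) (y i)) \<partial>PiM I (\<lambda>_. lborel)) = 1"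
proof -
  interpret product_sigma_finite "\<lambda>_. lborel :: complex measure"
    by (intro product_sigma_finite_const sigma_finite_lborel)
  have "(\<integral>\<^sup>+y. ennreal (\<Prod>i\<in>I. gden (v i) (m i) (y i)) \<partial>PiM I (\<lambda>_. lborel))
      = (\<integral>\<^sup>+y. (\<Prod>i\<in>I. ennreal (gden (v i) (m i) (y i))) \<partial>PiM I (\<lambda>_. lborel))"
    using assms by (simp add: prod_ennreal gden_pos less_imp_le)
  also have "\<dots> = (\<Prod>i\<in>I. \<integral>\<^sup>+y. ennreal (gden (v i) (m i) y) \<partial>lborel)"
    using assms by (intro product_nn_integral_prod) auto
  also have "\<dots> = 1" using assms by (simp add: nn_integral_gden)
  finally show ?thesis .
qed

section \<open>The converse for fixed phases\<close>

text \<open>The outputs for fixed phases. An index \<open>i\<close> is a pair (channel use, subchannel), \<open>D i\<close> is the set of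
  receivers that suffer interference there, \<open>\<tau> i k\<close> is the transmitter interfering with \<open>k\<close>, and
  \<open>c k t w i\<close> is the noiseless contribution of transmitter \<open>t\<close>, sending message \<open>w\<close>, to receiver \<open>k\<close>.\<close>

locale paired_outputs =
  fixes I :: "'i set" and K :: nat and D :: "'i \<Rightarrow> nat set" and \<tau> :: "'i \<Rightarrow> nat \<Rightarrow> nat"
    and M :: "nat \<Rightarrow> nat" and c :: "nat \<Rightarrow> nat \<Rightarrow> nat \<Rightarrow> 'i \<Rightarrow> complex" and u :: "nat \<Rightarrow> nat \<Rightarrow> 'i \<Rightarrow> complex"
    and v :: real
  assumes finI: "finite I" and M1: "\<And>k. k < K \<Longrightarrow> M k \<ge> 1"
    and D: "\<And>i. i \<in> I \<Longrightarrow> D i \<subseteq> {..<K}"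
    and \<tau>: "\<And>i. i \<in> I \<Longrightarrow> bij_betw (\<tau> i) (D i) ({..<K} - D i)"
    and cu: "\<And>k t w i. c k t w i = u k t i * c t t w i" and u1: "\<And>k t i. cmod (u k t i) = 1"
    and v: "v > 0"
begin

abbreviation "\<nu> \<equiv> PiM I (\<lambda>_. cgauss)"

definition mean :: "nat \<Rightarrow> (nat \<Rightarrow> nat) \<Rightarrow> 'i \<Rightarrow> complex" where
  "mean k w i = c k k (w k) i + (if k \<in> D i then c k (\<tau> i k) (w (\<tau> i k)) i else 0)"

text \<open>Storing the clean coordinates at \<open>t = k\<close> lets one family serve two
  partitions: for fixed \<open>k\<close> the sets \<open>S k t\<close> split \<open>I\<close>, and
  the sets \<open>S j k\<close> with \<open>j \<noteq> k\<close> split \<open>S k k\<close>.\<close>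

definition S :: "nat \<Rightarrow> nat \<Rightarrow> 'i set" where
  "S k t = {i \<in> I. if t = k then k \<notin> D i else k \<in> D i \<and> \<tau> i k = t}"

definition c_avg :: "nat \<Rightarrow> nat \<Rightarrow> 'i \<Rightarrow> complex" where
  "c_avg k t i = (\<Sum>w<M t. c k t w i) / of_nat (M t)"

text \<open>The mean output over the uniform messages of both active users. It is meant for
  coordinates on which \<open>k\<close> is interfered, the only ones where \<open>p\<close> refers
  to it.\<close>

definition \<mu> :: "nat \<Rightarrow> 'i \<Rightarrow> complex" where
  "\<mu> k i = c_avg k k i + c_avg k (\<tau> i k) i"

text \<open>Power at the receiver rather than at the transmitter: \<open>c\<close> already contains
  the strength of the link.\<close>

definition pow :: "nat \<Rightarrow> 'i \<Rightarrow> real" where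
  "pow t i = (\<Sum>w<M t. (cmod (c t t w i))\<^sup>2) / real (M t)"

definition out_mix :: "nat \<Rightarrow> nat \<Rightarrow> nat \<Rightarrow> ('i \<Rightarrow> complex) \<Rightarrow> real" where
  "out_mix k t a y = (\<Sum>w<M t. \<Prod>i\<in>S k t. gden 1 (c k k a i + c k t w i) (y i)) / real (M t)"

text \<open>The true conditional density of the output of \<open>k\<close> given its message
  \<open>a\<close>. It factors over the other transmitters because their messages are independent
  and each coordinate carries at most one of them.\<close>

definition q :: "nat \<Rightarrow> nat \<Rightarrow> ('i \<Rightarrow> complex) \<Rightarrow> real" where
  "q k a y = (\<Prod>i\<in>S k k. gden 1 (c k k a i) (y i)) * (\<Prod>t\<in>{..<K} - {k}. out_mix k t a y)"

definition in_mix :: "nat \<Rightarrow> nat \<Rightarrow> ('i \<Rightarrow> complex) \<Rightarrow> real" where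
  "in_mix j k y = (\<Sum>w<M k. \<Prod>i\<in>S j k. gden 1 (c k k w i) (y i)) / real (M k)"

text \<open>A test density, in general not the law of the output: the blocks on which
  \<open>k\<close> disturbs different receivers are treated as if they carried independent
  messages.\<close>

definition p :: "nat \<Rightarrow> ('i \<Rightarrow> complex) \<Rightarrow> real" where
  "p k y = (\<Prod>i\<in>I - S k k. gden v (\<mu> k i) (y i)) * (\<Prod>j\<in>{..<K} - {k}. in_mix j k y)"

definition out :: "nat \<Rightarrow> (nat \<Rightarrow> nat) \<Rightarrow> ('i \<Rightarrow> complex) \<Rightarrow> 'i \<Rightarrow> complex" where
  "out k w z = (\<lambda>i\<in>I. mean k w i + z i)"

section \<open>Coordinate blocks and the densities of one receiver\<close>

lemma finS [simp]: "finite (S k t)"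
  using finI by (simp add: S_def)

lemma S_sub: "S k t \<subseteq> I" by (auto simp: S_def)

lemma \<tau>_props:
  assumes "i \<in> I" "k \<in> D i"
  shows "\<tau> i k < K" "\<tau> i k \<notin> D i" "\<tau> i k \<noteq> k"
  using bij_betwE[OF \<tau>[OF assms(1)]] assms by auto

lemma partition_by_transmitter:
  assumes "k < K" shows "I = (\<Union>t<K. S k t)" "disjoint_family_on (S k) {..<K}"
proof -
  have "i \<in> (\<Union>t<K. S k t)" if "i \<in> I" for i
    using that assms \<tau>_props[OF that, of k]
    by (intro UN_I[of "if k \<in> D i then \<tau> i k else k"]) (auto simp: S_def)
  then show "I = (\<Union>t<K. S k t)" using S_sub by blast
  show "disjoint_family_on (S k) {..<K}"
    by (auto simp: S_def disjoint_family_on_def split: if_splits)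
qed

text \<open>Surjectivity of \<open>\<tau> i\<close> onto the clean receivers gives the cover,
  injectivity the disjointness.\<close>

lemma partition_by_interfered:
  assumes "k < K" shows "S k k = (\<Union>j\<in>{..<K} - {k}. S j k)" "disjoint_family_on (\<lambda>j. S j k) ({..<K} - {k})"
proof -
  show "S k k = (\<Union>j\<in>{..<K} - {k}. S j k)"
  proof (intro equalityI subsetI)
    fix i assume "i \<in> S k k"
    then have i: "i \<in> I" "k \<notin> D i" by (auto simp: S_def)
    then obtain j where "j \<in> D i" "\<tau> i j = k"
      using \<tau>[OF i(1)] assms by (auto simp: bij_betw_def) (metis DiffI imageE lessThan_iff)
    then show "i \<in> (\<Union>j\<in>{..<K} - {k}. S j k)"
      using i D[OF i(1)] by (intro UN_I[of j]) (auto simp: S_def)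
  next
    fix i assume "i \<in> (\<Union>j\<in>{..<K} - {k}. S j k)"
    then show "i \<in> S k k" using \<tau>_props by (auto simp: S_def split: if_splits)
  qed
  show "disjoint_family_on (\<lambda>j. S j k) ({..<K} - {k})"
    unfolding disjoint_family_on_def
  proof (intro ballI impI)
    fix j j' assume *: "j \<in> {..<K} - {k}" "j' \<in> {..<K} - {k}" "j \<noteq> j'"
    show "S j k \<inter> S j' k = {}"
    proof (rule ccontr)
      assume "S j k \<inter> S j' k \<noteq> {}"
      then obtain i where "i \<in> S j k" "i \<in> S j' k" by blast
      then have "i \<in> I" "j \<in> D i" "j' \<in> D i" "\<tau> i j = \<tau> i j'"
        using * by (simp_all add: S_def)
      then show False
        using \<tau>[of i] * unfolding bij_betw_def by (metis inj_onD)
    qed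
  qed
qed

lemma prod_by_transmitter:
  fixes h :: "'i \<Rightarrow> real"
  assumes "k < K" shows "(\<Prod>i\<in>I. h i) = (\<Prod>t<K. \<Prod>i\<in>S k t. h i)"
proof -
  have "prod h (\<Union>t<K. S k t) = (\<Prod>t<K. \<Prod>i\<in>S k t. h i)"
    using partition_by_transmitter[OF assms]
    by (intro prod.UNION_disjoint) (auto simp: disjoint_family_on_def)
  then show ?thesis using partition_by_transmitter[OF assms] by simp
qed

lemma prod_by_interfered:
  fixes h :: "'i \<Rightarrow> real"
  assumes "k < K" shows "(\<Prod>i\<in>S k k. h i) = (\<Prod>j\<in>{..<K} - {k}. \<Prod>i\<in>S j k. h i)"
proof -
  have "prod h (\<Union>j\<in>{..<K} - {k}. S j k) = (\<Prod>j\<in>{..<K} - {k}. \<Prod>i\<in>S j k. h i)"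
    using partition_by_interfered[OF assms]
    by (intro prod.UNION_disjoint) (auto simp: disjoint_family_on_def)
  then show ?thesis using partition_by_interfered[OF assms] by simp
qed

lemma out_mix_pos: "t < K \<Longrightarrow> out_mix k t a y > 0"
  using M1[of t] by (auto simp: out_mix_def lessThan_empty_iff intro!: divide_pos_pos sum_pos prod_pos gden_pos)

lemma in_mix_pos: "k < K \<Longrightarrow> in_mix j k y > 0"
  using M1[of k] by (auto simp: in_mix_def lessThan_empty_iff intro!: divide_pos_pos sum_pos prod_pos gden_pos)

lemma q_pos: "q k a y > 0"
  by (auto simp: q_def intro!: mult_pos_pos prod_pos gden_pos out_mix_pos)

lemma p_pos: "k < K \<Longrightarrow> p k y > 0"
  by (auto simp: p_def v intro!: mult_pos_pos prod_pos gden_pos in_mix_pos)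

text \<open>Each coordinate involves the message of at most one other user, so the sum over all
  other messages is a product over transmitters; the factor in front is the number of tuples that
  \<open>q\<close> averages over.\<close>

lemma sum_density_eq_q:
  assumes k: "k < K" and a: "a < M k"
  shows "(\<Sum>w\<in>{w \<in> msgs K M. w k = a}. \<Prod>i\<in>I. gden 1 (mean k w i) (y i))
    = real (\<Prod>t\<in>{..<K} - {k}. M t) * q k a y"
proof -
  define g where "g t x = (if t = k then \<Prod>i\<in>S k k. gden 1 (c k k x i) (y i)
      else \<Prod>i\<in>S k t. gden 1 (c k k a i + c k t x i) (y i))" for t x
  have "{w \<in> msgs K M. w k = a} = PiE {..<K} (\<lambda>t. if t = k then {a} else {..<M t})"
  proof (intro set_eqI)
    fix w
    have "(\<forall>t\<in>{..<K}. w t \<in> {..<M t}) \<and> w k = a \<longleftrightarrow> (\<forall>t\<in>{..<K}. w t \<in> (if t = k then {a} else {..<M t}))"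
      using k a by force
    then show "w \<in> {w \<in> msgs K M. w k = a} \<longleftrightarrow> w \<in> PiE {..<K} (\<lambda>t. if t = k then {a} else {..<M t})"
      unfolding msgs_def PiE_iff mem_Collect_eq by blast
  qed
  moreover have "(\<Prod>i\<in>I. gden 1 (mean k w i) (y i)) = (\<Prod>t<K. g t (w t))" if "w k = a" for w
    unfolding prod_by_transmitter[OF k]
    by (intro prod.cong refl) (auto simp: g_def S_def mean_def that intro!: prod.cong)
  ultimately have "(\<Sum>w\<in>{w \<in> msgs K M. w k = a}. \<Prod>i\<in>I. gden 1 (mean k w i) (y i))
      = (\<Sum>w\<in>PiE {..<K} (\<lambda>t. if t = k then {a} else {..<M t}). \<Prod>t<K. g t (w t))"
    by (intro sum.cong) auto
  also have "\<dots> = (\<Prod>t<K. \<Sum>x\<in>(if t = k then {a} else {..<M t}). g t x)"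
    by (subst prod_sum_PiE) auto
  also have "\<dots> = g k a * (\<Prod>t\<in>{..<K} - {k}. \<Sum>x<M t. g t x)"
    using k by (subst prod.remove[of _ k]) (auto intro!: prod.cong)
  also have "(\<Prod>t\<in>{..<K} - {k}. \<Sum>x<M t. g t x) = (\<Prod>t\<in>{..<K} - {k}. real (M t) * out_mix k t a y)"
  proof (intro prod.cong refl)
    fix t assume t: "t \<in> {..<K} - {k}"
    then have "M t \<ge> 1" using M1[of t] by simp
    then show "(\<Sum>x<M t. g t x) = real (M t) * out_mix k t a y"
      using t by (simp add: g_def out_mix_def)
  qed
  also have "g k a * \<dots> = real (\<Prod>t\<in>{..<K} - {k}. M t) * q k a y"
    by (simp add: g_def q_def prod.distrib)
  finally show ?thesis .
qed

lemma gden_comp_measurable: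
  "i \<in> I \<Longrightarrow> (\<lambda>y. gden a b (y i)) \<in> borel_measurable (PiM I (\<lambda>_. lborel))"
  by (rule measurable_compose[OF measurable_component_singleton[of i I "\<lambda>_. lborel"]]) auto

lemma prod_gden_measurable:
  "A \<subseteq> I \<Longrightarrow> (\<lambda>y. \<Prod>i\<in>A. gden (a i) (b i) (y i)) \<in> borel_measurable (PiM I (\<lambda>_. lborel))"
  by (intro borel_measurable_prod gden_comp_measurable) auto

lemma in_mix_measurable: "in_mix j k \<in> borel_measurable (PiM I (\<lambda>_. lborel))"
  unfolding in_mix_def[abs_def]
  by (intro borel_measurable_divide borel_measurable_sum prod_gden_measurable S_sub) auto

lemma q_measurable: "q k a \<in> borel_measurable (PiM I (\<lambda>_. lborel))"
  unfolding q_def[abs_def] out_mix_def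
  by (intro borel_measurable_times borel_measurable_prod borel_measurable_divide
      borel_measurable_sum prod_gden_measurable S_sub) auto

lemma p_measurable: "p k \<in> borel_measurable (PiM I (\<lambda>_. lborel))"
  unfolding p_def[abs_def]
  by (intro borel_measurable_times borel_measurable_prod prod_gden_measurable in_mix_measurable) auto

text \<open>Multiplying out the product of mixtures gives one uniform mixture over
  \<open>?W\<close>, whose members choose a message of \<open>k\<close> separately for every
  disturbed receiver. Each component is a product of Gaussian densities and has mass 1.\<close>

lemma nn_integral_p:
  assumes k: "k < K"
  shows "(\<integral>\<^sup>+y. ennreal (p k y) \<partial>PiM I (\<lambda>_. lborel)) = 1"
proof -
  let ?J = "{..<K} - {k}" and ?Leb = "PiM I (\<lambda>_. lborel :: complex measure)"
  let ?W = "PiE ?J (\<lambda>_. {..<M k})"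
  \<comment> \<open>The receiver that \<open>k\<close> disturbs at coordinate \<open>i\<close>; on
    \<open>S k k\<close> it is unique by the partition. It tells which of the separately chosen
    messages applies there.\<close>
  define src where "src i = (THE j. j \<in> ?J \<and> i \<in> S j k)" for i
  have src: "src i = j" if "j \<in> ?J" "i \<in> S j k" for i j
    unfolding src_def
  proof (rule the_equality)
    show "j' = j" if "j' \<in> ?J \<and> i \<in> S j' k" for j'
      using that \<open>j \<in> ?J\<close> \<open>i \<in> S j k\<close> partition_by_interfered(2)[OF k]
      unfolding disjoint_family_on_def by blast
  qed (use that in auto)
  define V where "V i = (if i \<in> S k k then 1 else v)" for i
  define m where "m w i = (if i \<in> S k k then c k k (w (src i)) i else \<mu> k i)" for w :: "nat \<Rightarrow> nat" and i
  have p_eq: "p k y = (\<Sum>w\<in>?W. (\<Prod>i\<in>I. gden (V i) (m w i) (y i))) / real (card ?W)" for y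
  proof -
    have "(\<Prod>j\<in>?J. in_mix j k y) = (\<Prod>j\<in>?J. \<Sum>w<M k. \<Prod>i\<in>S j k. gden 1 (c k k w i) (y i)) / real (M k) ^ card ?J"
      by (simp add: in_mix_def prod_dividef)
    also have "(\<Prod>j\<in>?J. \<Sum>w<M k. \<Prod>i\<in>S j k. gden 1 (c k k w i) (y i))
        = (\<Sum>w\<in>?W. \<Prod>j\<in>?J. \<Prod>i\<in>S j k. gden 1 (c k k (w j) i) (y i))"
      by (rule prod_sum_PiE) auto
    also have "real (M k) ^ card ?J = real (card ?W)"
      by (simp add: card_PiE)
    finally have "p k y = (\<Sum>w\<in>?W. (\<Prod>i\<in>I - S k k. gden v (\<mu> k i) (y i)) *
        (\<Prod>j\<in>?J. \<Prod>i\<in>S j k. gden 1 (c k k (w j) i) (y i))) / real (card ?W)"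
      by (simp add: p_def sum_distrib_left)
    also have "\<dots> = (\<Sum>w\<in>?W. (\<Prod>i\<in>I. gden (V i) (m w i) (y i))) / real (card ?W)"
    proof (intro arg_cong2[where f = "(/)"] sum.cong refl)
      fix w
      have "(\<Prod>j\<in>?J. \<Prod>i\<in>S j k. gden 1 (c k k (w j) i) (y i)) =
          (\<Prod>j\<in>?J. \<Prod>i\<in>S j k. gden 1 (c k k (w (src i)) i) (y i))"
        by (intro prod.cong refl) (simp add: src)
      also have "\<dots> = (\<Prod>i\<in>S k k. gden 1 (c k k (w (src i)) i) (y i))"
        by (rule prod_by_interfered[OF k, symmetric])
      also have "\<dots> = (\<Prod>i\<in>S k k. gden (V i) (m w i) (y i))"
        by (intro prod.cong) (auto simp: V_def m_def)
      finally show "(\<Prod>i\<in>I - S k k. gden v (\<mu> k i) (y i)) * (\<Prod>j\<in>?J. \<Prod>i\<in>S j k. gden 1 (c k k (w j) i) (y i))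
          = (\<Prod>i\<in>I. gden (V i) (m w i) (y i))"
        using prod.subset_diff[OF S_sub[of k k] finI, of "\<lambda>i. gden (V i) (m w i) (y i)"]
        by (simp add: V_def m_def)
    qed
    finally show ?thesis .
  qed
  have cW: "card ?W > 0" using M1[OF k] by (simp add: card_PiE)
  have nonneg: "(\<Prod>i\<in>I. gden (V i) (m w i) (y i)) \<ge> 0" for w y
    using v by (auto simp: V_def intro!: prod_nonneg less_imp_le[OF gden_pos])
  have meas: "(\<lambda>y. ennreal (\<Prod>i\<in>I. gden (V i) (m w i) (y i))) \<in> borel_measurable ?Leb" for w
    by (intro measurable_compose[OF prod_gden_measurable measurable_ennreal]) simp
  have "(\<integral>\<^sup>+y. ennreal (p k y) \<partial>?Leb)
      = (\<integral>\<^sup>+y. ennreal (1 / real (card ?W)) * (\<Sum>w\<in>?W. ennreal (\<Prod>i\<in>I. gden (V i) (m w i) (y i))) \<partial>?Leb)"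
    by (simp add: p_eq nonneg sum_nonneg ennreal_mult' sum_ennreal flip: ennreal_mult'')
  also have "\<dots> = ennreal (1 / real (card ?W)) * (\<Sum>w\<in>?W. \<integral>\<^sup>+y. ennreal (\<Prod>i\<in>I. gden (V i) (m w i) (y i)) \<partial>?Leb)"
    by (subst nn_integral_cmult, intro borel_measurable_sum meas, subst nn_integral_sum) (auto intro: meas)
  also have "\<dots> = ennreal (1 / real (card ?W)) * of_nat (card ?W)"
    using finI v by (subst nn_integral_PiM_lborel_gden) (auto simp: V_def)
  also have "\<dots> = 1"
    using cW by (simp add: ennreal_of_nat_eq_real_of_nat flip: ennreal_mult)
  finally show ?thesis .
qed

end


section \<open>Log-likelihoods at the output and Gibbs' inequality for one receiver\<close>

lemma gden_shift: "gden a b x = gden a 0 (x - b)"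
  by (simp add: gden_def)

lemma gden_nz: "v > 0 \<Longrightarrow> gden v \<mu> z \<noteq> 0"
  by (simp add: gden_def)

context paired_outputs
begin

lemma out_mix_nz: "t < K \<Longrightarrow> out_mix k t a y \<noteq> 0" and in_mix_nz: "k < K \<Longrightarrow> in_mix j k y \<noteq> 0"
  using out_mix_pos[of t k a y] in_mix_pos[of k j y] by auto

text \<open>The receiver's own codeword cancels: clean coordinates leave pure noise, and each
  interfered block leaves the signal of its interferer in noise.\<close>

lemma ln_q_out:
  assumes "k < K" "w \<in> msgs K M"
  shows "ln (q k (w k) (out k w z)) = (\<Sum>i\<in>S k k. - (cmod (z i))\<^sup>2 - ln pi) +
    (\<Sum>t\<in>{..<K} - {k}. mix_ln (S k t) (M t) (c k t) (w t) z)"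
proof -
  have out: "out k w z i = c k k (w k) i + c k t (w t) i + z i" if "i \<in> S k t" "t \<noteq> k" for i t
    using that by (auto simp: S_def out_def mean_def)
  have out': "out k w z i = c k k (w k) i + z i" if "i \<in> S k k" for i
    using that by (auto simp: S_def out_def mean_def)
  have "ln (\<Prod>i\<in>S k k. gden 1 (c k k (w k) i) (out k w z i)) = (\<Sum>i\<in>S k k. - (cmod (z i))\<^sup>2 - ln pi)"
    by (subst ln_prod_gden[symmetric]) (auto simp: out' gden_shift[of _ "c k k (w k) i" for i] intro!: arg_cong[where f = ln] prod.cong)
  moreover have "ln (\<Prod>t\<in>{..<K} - {k}. out_mix k t (w k) (out k w z)) =
      (\<Sum>t\<in>{..<K} - {k}. ln (out_mix k t (w k) (out k w z)))"
    by (intro ln_prod) (auto simp: out_mix_pos out_mix_nz)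
  moreover have "ln (out_mix k t (w k) (out k w z)) = mix_ln (S k t) (M t) (c k t) (w t) z" if "t \<noteq> k" for t
  proof -
    have "gden 1 (c k k (w k) i + c k t w' i) (out k w z i) = gden 1 0 (c k t (w t) i - c k t w' i + z i)"
      if "i \<in> S k t" for i w'
      unfolding out[OF that \<open>t \<noteq> k\<close>] by (subst gden_shift) (simp add: algebra_simps)
    then show ?thesis by (simp add: out_mix_def mix_ln_def)
  qed
  ultimately show ?thesis
    unfolding q_def by (subst ln_mult) (auto simp: gden_nz out_mix_nz)
qed

text \<open>The mixture term for \<open>j\<close> concerns the signal of \<open>k\<close> on the
  block \<open>S j k\<close>. In \<open>ln_q_out\<close> for receiver \<open>j\<close> the same
  block occurs with \<open>c j k\<close> in place of \<open>c k k\<close>, which is the same signal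
  up to rotation.\<close>

lemma ln_p_out:
  assumes "k < K" "w \<in> msgs K M"
  shows "ln (p k (out k w z)) =
    (\<Sum>i\<in>I - S k k. - (cmod (mean k w i - \<mu> k i + z i))\<^sup>2 / v - ln (pi * v)) +
    (\<Sum>j\<in>{..<K} - {k}. mix_ln (S j k) (M k) (c k k) (w k) z)"
proof -
  have out: "out k w z i = c k k (w k) i + z i" if "i \<in> S j k" "j \<noteq> k" for i j
    using that \<tau>_props by (auto simp: S_def out_def mean_def)
  have "ln (\<Prod>i\<in>I - S k k. gden v (\<mu> k i) (out k w z i)) = (\<Sum>i\<in>I - S k k. ln (gden v (\<mu> k i) (out k w z i)))"
    using finI v by (intro ln_prod) (auto simp: gden_pos gden_nz)
  also have "\<dots> = (\<Sum>i\<in>I - S k k. - (cmod (mean k w i - \<mu> k i + z i))\<^sup>2 / v - ln (pi * v))"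
    using v by (intro sum.cong refl) (simp add: ln_gden out_def algebra_simps)
  finally have 1: "ln (\<Prod>i\<in>I - S k k. gden v (\<mu> k i) (out k w z i)) = \<dots>" .
  have 2: "ln (\<Prod>j\<in>{..<K} - {k}. in_mix j k (out k w z)) = (\<Sum>j\<in>{..<K} - {k}. ln (in_mix j k (out k w z)))"
    using assms by (intro ln_prod) (auto simp: in_mix_pos in_mix_nz)
  have "ln (in_mix j k (out k w z)) = mix_ln (S j k) (M k) (c k k) (w k) z" if "j \<noteq> k" for j
  proof -
    have "gden 1 (c k k w' i) (out k w z i) = gden 1 0 (c k k (w k) i - c k k w' i + z i)"
      if "i \<in> S j k" for i w'
      unfolding out[OF that \<open>j \<noteq> k\<close>] by (subst gden_shift) (simp add: algebra_simps)
    then show ?thesis by (simp add: in_mix_def mix_ln_def)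
  qed
  then show ?thesis
    unfolding p_def using 1 2 v assms finI
    by (subst ln_mult) (auto simp: gden_nz in_mix_nz)
qed

text \<open>A decoder with error probability \<open>\<epsilon>\<close> yields the conditional law of the message \<open>r\<close> below, whose
  cross entropy is at most \<open>ln 2 + \<epsilon> ln M\<close>; this replaces Fano's inequality.\<close>

definition r :: "(nat \<Rightarrow> ('i \<Rightarrow> complex) \<Rightarrow> nat) \<Rightarrow> nat \<Rightarrow> nat \<Rightarrow> ('i \<Rightarrow> complex) \<Rightarrow> real" where
  "r dec k a y = (if dec k y = a then 1 / 2 else 0) + 1 / (2 * real (M k))"

lemma r_pos: "k < K \<Longrightarrow> r dec k a y > 0"
  using M1[of k] by (auto simp: r_def intro!: add_nonneg_pos)

lemma sum_r_le: "k < K \<Longrightarrow> (\<Sum>a<M k. r dec k a y) \<le> 1"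
  using M1[of k] by (simp add: r_def sum.distrib sum.delta)

text \<open>If the decoder is right, \<open>real (M k) * r dec k a y\<close> is at least half of
  \<open>M k\<close>; otherwise the uniform half of \<open>r\<close> still leaves 1/2.\<close>

lemma ln_r_ge:
  assumes "k < K"
  shows "(if dec k y = a then ln (M k) else 0) - ln 2 \<le> ln (real (M k) * r dec k a y)"
proof -
  have M: "real (M k) \<ge> 1" using M1[OF assms] by simp
  have eq: "real (M k) * r dec k a y = (if dec k y = a then real (M k) / 2 else 0) + 1 / 2"
    using M by (simp add: r_def field_simps)
  have "(if dec k y = a then ln (M k) else 0) - ln 2 = ln ((if dec k y = a then real (M k) else 1) / 2)"
    using M by (simp add: ln_div)
  also have "\<dots> \<le> ln (real (M k) * r dec k a y)"
    unfolding eq using M by (subst ln_le_cancel_iff) auto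
  finally show ?thesis .
qed

text \<open>Grouping the message tuples by the message of \<open>k\<close> turns the sum of output
  densities into a multiple of \<open>q\<close>, which cancels the denominator. What remains is
  \<open>p\<close>, of mass 1, times weights \<open>r\<close> with sum at most 1. This is the
  normalisation behind Gibbs' inequality.\<close>

lemma likelihood_ratio_bound:
  assumes k: "k < K" and dec: "dec k \<in> PiM I (\<lambda>_. borel) \<rightarrow>\<^sub>M count_space UNIV"
  shows "(\<Sum>w\<in>msgs K M. \<integral>\<^sup>+z. ennreal (real (M k) * r dec k (w k) (out k w z) * p k (out k w z) / q k (w k) (out k w z)) \<partial>\<nu>)
    \<le> ennreal (real (card (msgs K M)))"
proof -
  let ?Leb = "PiM I (\<lambda>_. lborel :: complex measure)"
  define F where "F a y = real (M k) * r dec k a y * p k y / q k a y" for a y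
  have s: "sets ?Leb = sets (PiM I (\<lambda>_. borel))" by (intro sets_PiM_cong) auto
  have [measurable]: "dec k \<in> ?Leb \<rightarrow>\<^sub>M count_space UNIV"
    using dec by (simp add: measurable_cong_sets[OF s refl])
  note [measurable] = q_measurable p_measurable
  have [measurable]: "r dec k a \<in> borel_measurable ?Leb" for a
    unfolding r_def[abs_def] by measurable
  have F_meas [measurable]: "F a \<in> borel_measurable ?Leb" for a
    unfolding F_def[abs_def] by measurable
  have F_nonneg: "F a y \<ge> 0" for a y
    using r_pos[OF k] p_pos[OF k] q_pos unfolding F_def by (intro divide_nonneg_pos mult_nonneg_nonneg) (auto intro: less_imp_le)
  have g_meas [measurable]: "(\<lambda>y. \<Prod>i\<in>I. gden 1 (mean k w i) (y i)) \<in> borel_measurable ?Leb" for w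
    by (rule prod_gden_measurable) simp
  have g_nonneg: "(\<Prod>i\<in>I. gden 1 (mean k w i) (y i)) \<ge> 0" for w y
    by (intro prod_nonneg) (auto intro: less_imp_le[OF gden_pos])
  have "(\<Sum>w\<in>msgs K M. \<integral>\<^sup>+z. ennreal (F (w k) (out k w z)) \<partial>\<nu>)
      = (\<Sum>w\<in>msgs K M. \<integral>\<^sup>+y. ennreal (\<Prod>i\<in>I. gden 1 (mean k w i) (y i)) * ennreal (F (w k) y) \<partial>?Leb)"
    unfolding out_def by (intro sum.cong refl nn_integral_PiM_cgauss_shift finI) measurable
  also have "\<dots> = (\<integral>\<^sup>+y. (\<Sum>w\<in>msgs K M. ennreal (\<Prod>i\<in>I. gden 1 (mean k w i) (y i)) * ennreal (F (w k) y)) \<partial>?Leb)"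
    by (intro nn_integral_sum[symmetric]) measurable
  also have "\<dots> = (\<integral>\<^sup>+y. ennreal (\<Sum>w\<in>msgs K M. (\<Prod>i\<in>I. gden 1 (mean k w i) (y i)) * F (w k) y) \<partial>?Leb)"
    by (simp add: F_nonneg g_nonneg sum_ennreal flip: ennreal_mult)
  also have "\<dots> \<le> (\<integral>\<^sup>+y. ennreal (real (card (msgs K M))) * ennreal (p k y) \<partial>?Leb)"
  proof (intro nn_integral_mono)
    fix y
    let ?g = "\<lambda>w. \<Prod>i\<in>I. gden 1 (mean k w i) (y i)"
    have "(\<Sum>w\<in>msgs K M. ?g w * F (w k) y) = (\<Sum>a<M k. \<Sum>w\<in>{w \<in> msgs K M. w k = a}. ?g w * F (w k) y)"
      using k by (intro sum.group[symmetric] finite_msgs) (auto simp: msgs_def)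
    also have "\<dots> = (\<Sum>a<M k. (\<Sum>w\<in>{w \<in> msgs K M. w k = a}. ?g w) * F a y)"
      by (simp add: sum_distrib_right)
    also have "\<dots> = (\<Sum>a<M k. real (\<Prod>t\<in>{..<K} - {k}. M t) * q k a y * F a y)"
      using k by (simp add: sum_density_eq_q)
    also have "\<dots> = (\<Sum>a<M k. real (card (msgs K M)) * p k y * r dec k a y)"
    proof (intro sum.cong refl)
      fix a
      have "card (msgs K M) = M k * (\<Prod>t\<in>{..<K} - {k}. M t)"
        using k by (simp add: card_msgs prod.remove[of "{..<K}" k])
      then show "real (\<Prod>t\<in>{..<K} - {k}. M t) * q k a y * F a y = real (card (msgs K M)) * p k y * r dec k a y"
        using q_pos[of k a y] by (simp add: F_def)
    qed
    also have "\<dots> = real (card (msgs K M)) * p k y * (\<Sum>a<M k. r dec k a y)"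
      by (simp add: sum_distrib_left)
    also have "\<dots> \<le> real (card (msgs K M)) * p k y * 1"
      using p_pos[OF k, of y] by (intro mult_left_mono sum_r_le k) auto
    finally show "ennreal (\<Sum>w\<in>msgs K M. ?g w * F (w k) y) \<le> ennreal (real (card (msgs K M))) * ennreal (p k y)"
      using p_pos[OF k, of y] by (simp add: ennreal_leI flip: ennreal_mult)
  qed
  also have "\<dots> = ennreal (real (card (msgs K M)))"
    by (subst nn_integral_cmult) (simp_all add: nn_integral_p k p_measurable)
  finally show ?thesis by (simp add: F_def)
qed

text \<open>A clean coordinate contributes \<open>- (1 + ln pi)\<close>, minus the differential
  entropy of the noise.\<close>

lemma ln_q_integrable:
  assumes "k < K" "w \<in> msgs K M"
  shows "integrable \<nu> (\<lambda>z. ln (q k (w k) (out k w z)))"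
    and "(\<integral>z. ln (q k (w k) (out k w z)) \<partial>\<nu>) = - real (card (S k k)) * (1 + ln pi) +
      (\<Sum>t\<in>{..<K} - {k}. \<integral>z. mix_ln (S k t) (M t) (c k t) (w t) z \<partial>\<nu>)"
proof -
  interpret prob_space \<nu> by (rule prob_space_PiM_cgauss)
  have c: "has_bochner_integral \<nu> (\<lambda>_. x) x" for x :: real
    by (simp add: has_bochner_integral_iff prob_space)
  have i: "has_bochner_integral \<nu> (\<lambda>z. (cmod (z i))\<^sup>2) 1" if "i \<in> S k k" for i
    using integrable_PiM_cgauss_norm2[of i I 0] S_sub[of k k] that by (auto simp: has_bochner_integral_iff)
  have m: "t \<in> {..<K} - {k} \<Longrightarrow> integrable \<nu> (mix_ln (S k t) (M t) (c k t) (w t))" for t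
    by (intro mix_ln_integrable finI S_sub M1) auto
  have "has_bochner_integral \<nu> (\<lambda>z. ln (q k (w k) (out k w z))) ((\<Sum>i\<in>S k k. - 1 - ln pi) +
      (\<Sum>t\<in>{..<K} - {k}. \<integral>z. mix_ln (S k t) (M t) (c k t) (w t) z \<partial>\<nu>))"
    unfolding ln_q_out[OF assms]
    by (intro has_bochner_integral_add has_bochner_integral_sum has_bochner_integral_diff
        has_bochner_integral_minus i c has_bochner_integral_integrable m)
  then show "integrable \<nu> (\<lambda>z. ln (q k (w k) (out k w z)))"
    "(\<integral>z. ln (q k (w k) (out k w z)) \<partial>\<nu>) = - real (card (S k k)) * (1 + ln pi) +
      (\<Sum>t\<in>{..<K} - {k}. \<integral>z. mix_ln (S k t) (M t) (c k t) (w t) z \<partial>\<nu>)"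
    by (auto simp: has_bochner_integral_iff algebra_simps)
qed

lemma ln_p_integrable:
  assumes "k < K" "w \<in> msgs K M"
  shows "integrable \<nu> (\<lambda>z. ln (p k (out k w z)))"
    and "(\<integral>z. ln (p k (out k w z)) \<partial>\<nu>) =
      - (\<Sum>i\<in>I - S k k. ((cmod (mean k w i - \<mu> k i))\<^sup>2 + 1) / v + ln (pi * v)) +
      (\<Sum>j\<in>{..<K} - {k}. \<integral>z. mix_ln (S j k) (M k) (c k k) (w k) z \<partial>\<nu>)"
proof -
  interpret prob_space \<nu> by (rule prob_space_PiM_cgauss)
  have c: "has_bochner_integral \<nu> (\<lambda>_. x) x" for x :: real
    by (simp add: has_bochner_integral_iff prob_space)
  have i: "has_bochner_integral \<nu> (\<lambda>z. (cmod (mean k w i - \<mu> k i + z i))\<^sup>2) ((cmod (mean k w i - \<mu> k i))\<^sup>2 + 1)"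
    if "i \<in> I - S k k" for i
    using integrable_PiM_cgauss_norm2[of i I "mean k w i - \<mu> k i"] that by (auto simp: has_bochner_integral_iff)
  have m: "j \<in> {..<K} - {k} \<Longrightarrow> integrable \<nu> (mix_ln (S j k) (M k) (c k k) (w k))" for j
    using assms by (intro mix_ln_integrable finI S_sub M1) auto
  have "has_bochner_integral \<nu> (\<lambda>z. ln (p k (out k w z)))
     ((\<Sum>i\<in>I - S k k. - ((cmod (mean k w i - \<mu> k i))\<^sup>2 + 1) / v - ln (pi * v)) +
      (\<Sum>j\<in>{..<K} - {k}. \<integral>z. mix_ln (S j k) (M k) (c k k) (w k) z \<partial>\<nu>))"
    unfolding ln_p_out[OF assms]
    by (intro has_bochner_integral_add has_bochner_integral_sum has_bochner_integral_diff
        has_bochner_integral_minus has_bochner_integral_divide_zero i c has_bochner_integral_integrable m)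
  moreover have neg: "(\<Sum>i\<in>I - S k k. - ((cmod (mean k w i - \<mu> k i))\<^sup>2 + 1) / v - ln (pi * v)) =
      - (\<Sum>i\<in>I - S k k. ((cmod (mean k w i - \<mu> k i))\<^sup>2 + 1) / v + ln (pi * v))"
    by (subst sum_negf[symmetric]) (simp add: minus_divide_left)
  ultimately show "integrable \<nu> (\<lambda>z. ln (p k (out k w z)))"
    "(\<integral>z. ln (p k (out k w z)) \<partial>\<nu>) =
      - (\<Sum>i\<in>I - S k k. ((cmod (mean k w i - \<mu> k i))\<^sup>2 + 1) / v + ln (pi * v)) +
      (\<Sum>j\<in>{..<K} - {k}. \<integral>z. mix_ln (S j k) (M k) (c k k) (w k) z \<partial>\<nu>)"
    unfolding has_bochner_integral_iff neg by auto
qed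

lemma out_measurable: "out k w \<in> \<nu> \<rightarrow>\<^sub>M PiM I (\<lambda>_. borel)"
  unfolding out_def[abs_def] by (rule PiM_cgauss_shift_measurable)

text \<open>Integrate \<open>ln (\<rho> w z) \<le> \<rho> w z - 1\<close>, where the total mass of
  \<open>\<rho>\<close> is at most the number of message tuples, so the right-hand sides add up to
  at most 0. The logarithm splits into the terms of \<open>p\<close> and \<open>q\<close> and a
  decoder term, which \<open>ln_r_ge\<close> converts into a success probability.\<close>

lemma user_bound:
  assumes k: "k < K" and dec: "dec k \<in> PiM I (\<lambda>_. borel) \<rightarrow>\<^sub>M count_space UNIV"
  shows "(\<Sum>w\<in>msgs K M. measure \<nu> {z \<in> space \<nu>. dec k (out k w z) = w k} * ln (M k) - ln 2)
    \<le> (\<Sum>w\<in>msgs K M. (\<integral>z. ln (q k (w k) (out k w z)) \<partial>\<nu>) - (\<integral>z. ln (p k (out k w z)) \<partial>\<nu>))"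
proof -
  interpret prob_space \<nu> by (rule prob_space_PiM_cgauss)
  define \<rho> where "\<rho> w z = real (M k) * r dec k (w k) (out k w z) * p k (out k w z) / q k (w k) (out k w z)" for w z
  have s: "sets (PiM I (\<lambda>_. lborel :: complex measure)) = sets (PiM I (\<lambda>_. borel))" by (intro sets_PiM_cong) auto
  have [measurable]: "q k a \<in> borel_measurable (PiM I (\<lambda>_. borel))" "p k \<in> borel_measurable (PiM I (\<lambda>_. borel))" for a
    using q_measurable[of k a] p_measurable[of k] by (simp_all add: measurable_cong_sets[OF s refl])
  note [measurable] = dec out_measurable
  have [measurable]: "r dec k a \<in> borel_measurable (PiM I (\<lambda>_. borel))" for a
    unfolding r_def[abs_def] by measurable
  have \<rho>_meas [measurable]: "\<rho> w \<in> borel_measurable \<nu>" for w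
    unfolding \<rho>_def[abs_def] by measurable
  have \<rho>_pos: "\<rho> w z > 0" for w z
    using r_pos[OF k] p_pos[OF k] q_pos M1[OF k] unfolding \<rho>_def by simp
  have \<rho>_nonneg: "\<rho> w z \<ge> 0" for w z
    using \<rho>_pos by (rule less_imp_le)
  have sum_le: "(\<Sum>w\<in>msgs K M. \<integral>\<^sup>+z. ennreal (\<rho> w z) \<partial>\<nu>) \<le> ennreal (real (card (msgs K M)))"
    unfolding \<rho>_def by (rule likelihood_ratio_bound[where dec = dec, OF k dec])
  have int\<rho>: "integrable \<nu> (\<rho> w)" if "w \<in> msgs K M" for w
  proof (rule integrableI_nonneg)
    have "(\<integral>\<^sup>+z. ennreal (\<rho> w z) \<partial>\<nu>) \<le> (\<Sum>w\<in>msgs K M. \<integral>\<^sup>+z. ennreal (\<rho> w z) \<partial>\<nu>)"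
      using that finite_msgs by (intro member_le_sum) auto
    also note sum_le
    finally show "(\<integral>\<^sup>+z. ennreal (\<rho> w z) \<partial>\<nu>) < \<infinity>" by (simp add: le_less_trans ennreal_less_top)
  qed (use \<rho>_pos in \<open>auto intro: less_imp_le\<close>)
  have "(\<Sum>w\<in>msgs K M. \<integral>\<^sup>+z. ennreal (\<rho> w z) \<partial>\<nu>) = (\<Sum>w\<in>msgs K M. ennreal (\<integral>z. \<rho> w z \<partial>\<nu>))"
    by (intro sum.cong refl nn_integral_eq_integral int\<rho>) (auto simp: \<rho>_nonneg)
  also have "\<dots> = ennreal (\<Sum>w\<in>msgs K M. \<integral>z. \<rho> w z \<partial>\<nu>)"
    by (rule sum_ennreal) (simp add: \<rho>_nonneg)
  finally have \<rho>_le: "(\<Sum>w\<in>msgs K M. \<integral>z. \<rho> w z \<partial>\<nu>) \<le> real (card (msgs K M))"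
    using sum_le by simp
  have "measure \<nu> {z \<in> space \<nu>. dec k (out k w z) = w k} * ln (M k) - ln 2
      + (\<integral>z. ln (p k (out k w z)) \<partial>\<nu>) - (\<integral>z. ln (q k (w k) (out k w z)) \<partial>\<nu>) \<le> (\<integral>z. \<rho> w z \<partial>\<nu>) - 1"
    if w: "w \<in> msgs K M" for w
  proof -
    let ?E = "{z \<in> space \<nu>. dec k (out k w z) = w k}"
    have E [measurable]: "?E \<in> events" by measurable
    have iE: "integrable \<nu> (\<lambda>z. indicator ?E z * ln (M k) - ln 2)"
      by (intro Bochner_Integration.integrable_diff integrable_mult_left integrable_real_indicator) (auto simp: less_top[symmetric])
    have "(\<integral>z. (indicator ?E z * ln (M k) - ln 2) + ln (p k (out k w z)) - ln (q k (w k) (out k w z)) \<partial>\<nu>)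
        \<le> (\<integral>z. \<rho> w z - 1 \<partial>\<nu>)"
    proof (rule integral_mono)
      fix z assume z: "z \<in> space \<nu>"
      let ?y = "out k w z"
      have "ln (\<rho> w z) \<le> \<rho> w z - 1" using \<rho>_pos by (intro ln_le_minus_one)
      moreover have "ln (\<rho> w z) = ln (real (M k) * r dec k (w k) ?y) + ln (p k ?y) - ln (q k (w k) ?y)"
        unfolding \<rho>_def using r_pos[OF k, of dec "w k" ?y] p_pos[OF k, of ?y] q_pos[of k "w k" ?y] M1[OF k]
        by (subst ln_div, simp, simp, subst ln_mult) auto
      moreover have "indicator ?E z * ln (M k) - ln 2 \<le> ln (real (M k) * r dec k (w k) ?y)"
        using ln_r_ge[OF k, of dec ?y "w k"] z by (auto simp: indicator_def)
      ultimately show "indicator ?E z * ln (M k) - ln 2 + ln (p k ?y) - ln (q k (w k) ?y) \<le> \<rho> w z - 1"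
        by linarith
    qed (use iE int\<rho>[OF w] ln_p_integrable(1)[OF k w] ln_q_integrable(1)[OF k w] in auto)
    then show ?thesis
      using iE int\<rho>[OF w] ln_p_integrable(1)[OF k w] ln_q_integrable(1)[OF k w] E
      by (simp add: prob_space measure_space_inter less_top[symmetric])
  qed
  from sum_mono[OF this, of "msgs K M" "\<lambda>w. w"] show ?thesis
    using \<rho>_le by (simp add: sum.distrib sum_subtractf)
qed

end


section \<open>Power accounting and summation over the receivers\<close>

lemma sum_norm2_deviation_le:
  fixes f :: "nat \<Rightarrow> complex"
  assumes "m \<ge> 1"
  shows "(\<Sum>x<m. (cmod (f x - (\<Sum>x<m. f x) / of_nat m))\<^sup>2) \<le> (\<Sum>x<m. (cmod (f x))\<^sup>2)"
proof -
  define a where "a = (\<Sum>x<m. f x) / of_nat m"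
  have sum_f: "(\<Sum>x<m. f x) = of_nat m * a" using assms by (simp add: a_def)
  have "(cmod (f x - a))\<^sup>2 = (cmod (f x))\<^sup>2 - 2 * Re (cnj a * f x) + (cmod a)\<^sup>2" for x
    by (simp add: cmod_power2 power2_diff algebra_simps)
  then have "(\<Sum>x<m. (cmod (f x - a))\<^sup>2) = (\<Sum>x<m. (cmod (f x))\<^sup>2) - 2 * Re (cnj a * (\<Sum>x<m. f x)) + real m * (cmod a)\<^sup>2"
    by (simp add: sum.distrib sum_subtractf sum_distrib_left)
  also have "Re (cnj a * (\<Sum>x<m. f x)) = real m * (cmod a)\<^sup>2"
    by (simp add: sum_f cmod_power2 distrib_left) (simp add: power2_eq_square)
  finally show ?thesis unfolding a_def[symmetric] by simp
qed

lemma sum_deviation_zero: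
  fixes f :: "nat \<Rightarrow> complex"
  assumes "m \<ge> 1"
  shows "(\<Sum>x<m. f x - (\<Sum>x<m. f x) / of_nat m) = 0"
  using assms by (simp add: sum_subtractf)

context paired_outputs
begin

lemma card_D: assumes "i \<in> I" shows "real (card (D i)) = real K / 2" "real (card ({..<K} - D i)) = real K / 2"
proof -
  have "card (D i) = card ({..<K} - D i)" using \<tau>[OF assms] by (rule bij_betw_same_card)
  moreover have "card ({..<K} - D i) = K - card (D i)" "card (D i) \<le> K"
    using D[OF assms] card_mono[OF _ D[OF assms]] by (auto simp: card_Diff_subset finite_subset)
  ultimately show "real (card (D i)) = real K / 2" "real (card ({..<K} - D i)) = real K / 2" by linarith+
qed

text \<open>Deviations from the codebook averages have mean zero and depend on independent messages,
  so their cross term sums to zero. Centring only lowers power, and the phase factor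
  \<open>u\<close> of the interfering link does not change it.\<close>

lemma variance_le:
  assumes k: "k < K" and i: "i \<in> I" "k \<in> D i"
  shows "(\<Sum>w\<in>msgs K M. (cmod (mean k w i - \<mu> k i))\<^sup>2) \<le> real (card (msgs K M)) * (pow k i + pow (\<tau> i k) i)"
proof -
  define t where "t = \<tau> i k"
  have t: "t < K" "k \<noteq> t" using \<tau>_props[OF i] by (auto simp: t_def)
  define a where "a x = c k k x i - c_avg k k i" for x
  define b where "b x = c k t x i - c_avg k t i" for x
  define Q where "Q = (\<Prod>x\<in>{..<K} - {k, t}. card {..<M x})"
  have M: "M k \<ge> 1" "M t \<ge> 1" using M1 k t by auto
  have C: "real (card (msgs K M)) = real (M k) * real (M t) * real Q"
  proof -
    have "{..<K} - {k, t} = {..<K} - {k} - {t}" by auto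
    then show ?thesis
      using k t by (simp add: card_msgs Q_def prod.remove[of "{..<K}" k] prod.remove[of "{..<K} - {k}" t])
  qed
  have sum2: "(\<Sum>w\<in>msgs K M. f (w k) * g (w t)) = (\<Sum>x<M k. f x) * (\<Sum>x<M t. g x) * of_nat Q"
    for f g :: "nat \<Rightarrow> 'z :: comm_semiring_1"
    unfolding msgs_def Q_def using k t by (intro sum_PiE_prod2) auto
  have a2: "(\<Sum>w\<in>msgs K M. (cmod (a (w k)))\<^sup>2) \<le> real (card (msgs K M)) * pow k i"
  proof -
    have "(\<Sum>w\<in>msgs K M. (cmod (a (w k)))\<^sup>2) = (\<Sum>x<M k. (cmod (a x))\<^sup>2) * real (M t) * real Q"
      using sum2[of "\<lambda>x. (cmod (a x))\<^sup>2" "\<lambda>_. 1"] by simp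
    also have "\<dots> \<le> (\<Sum>x<M k. (cmod (c k k x i))\<^sup>2) * real (M t) * real Q"
      unfolding a_def c_avg_def by (intro mult_right_mono sum_norm2_deviation_le M) auto
    also have "\<dots> = real (card (msgs K M)) * pow k i"
      using M by (simp add: pow_def C)
    finally show ?thesis .
  qed
  have b2: "(\<Sum>w\<in>msgs K M. (cmod (b (w t)))\<^sup>2) \<le> real (card (msgs K M)) * pow t i"
  proof -
    have "(\<Sum>w\<in>msgs K M. (cmod (b (w t)))\<^sup>2) = real (M k) * (\<Sum>x<M t. (cmod (b x))\<^sup>2) * real Q"
      using sum2[of "\<lambda>_. 1" "\<lambda>x. (cmod (b x))\<^sup>2"] by simp
    also have "\<dots> \<le> real (M k) * (\<Sum>x<M t. (cmod (c k t x i))\<^sup>2) * real Q"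
      unfolding b_def c_avg_def by (intro mult_right_mono mult_left_mono sum_norm2_deviation_le M) auto
    also have "\<dots> = real (M k) * (\<Sum>x<M t. (cmod (c t t x i))\<^sup>2) * real Q"
      by (subst cu) (simp add: norm_mult u1)
    also have "\<dots> = real (card (msgs K M)) * pow t i"
      using M by (simp add: pow_def C)
    finally show ?thesis .
  qed
  \<comment> \<open>The sum over tuples factors, and the vanishing factor of user \<open>k\<close>
    is enough.\<close>
  have ab: "(\<Sum>w\<in>msgs K M. a (w k) * cnj (b (w t))) = 0"
  proof -
    have "(\<Sum>x<M k. a x) = 0"
      unfolding a_def c_avg_def by (rule sum_deviation_zero) (rule M)
    then show ?thesis using sum2[of a "\<lambda>x. cnj (b x)"] by simp
  qed
  have "(cmod (mean k w i - \<mu> k i))\<^sup>2 = (cmod (a (w k)))\<^sup>2 + (cmod (b (w t)))\<^sup>2 + 2 * Re (a (w k) * cnj (b (w t)))" for w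
  proof -
    have "mean k w i - \<mu> k i = a (w k) + b (w t)"
      using i by (simp add: mean_def \<mu>_def a_def b_def t_def)
    then show ?thesis by (simp add: cmod_power2 power2_sum algebra_simps)
  qed
  then have "(\<Sum>w\<in>msgs K M. (cmod (mean k w i - \<mu> k i))\<^sup>2) =
      (\<Sum>w\<in>msgs K M. (cmod (a (w k)))\<^sup>2) + (\<Sum>w\<in>msgs K M. (cmod (b (w t)))\<^sup>2) + 2 * Re (\<Sum>w\<in>msgs K M. a (w k) * cnj (b (w t)))"
    by (simp add: sum.distrib sum_distrib_left)
  then show ?thesis
    unfolding ab using a2 b2 by (simp add: t_def distrib_left)
qed

lemma sum_off_diagonal_swap:
  fixes h :: "nat \<Rightarrow> nat \<Rightarrow> real"
  shows "(\<Sum>k<K. \<Sum>t\<in>{..<K} - {k}. h k t) = (\<Sum>k<K. \<Sum>j\<in>{..<K} - {k}. h j k)"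
proof -
  have "(\<Sum>k<K. \<Sum>t\<in>{t \<in> {..<K}. t \<noteq> k}. h k t) = (\<Sum>t<K. \<Sum>k\<in>{k \<in> {..<K}. t \<noteq> k}. h k t)"
    by (rule sum.swap_restrict) auto
  moreover have "{t \<in> {..<K}. t \<noteq> k} = {..<K} - {k}" "{j \<in> {..<K}. k \<noteq> j} = {..<K} - {k}" for k
    by auto
  ultimately show ?thesis by simp
qed

text \<open>The entropy term \<open>g k t\<close> occurs with a plus sign at the disturbed receiver
  \<open>k\<close> and with a minus sign at receiver \<open>t\<close>, where it is part of the clean
  signal; over all users these cancel. The rest is counting, with K/2 interfered and K/2 clean
  receivers on every coordinate.\<close>

lemma converse_bound:
  assumes dec: "\<And>k. k < K \<Longrightarrow> dec k \<in> PiM I (\<lambda>_. borel) \<rightarrow>\<^sub>M count_space UNIV"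
  shows "(\<Sum>k<K. (\<Sum>w\<in>msgs K M. measure \<nu> {z \<in> space \<nu>. dec k (out k w z) = w k}) / real (card (msgs K M)) * ln (M k) - ln 2)
    \<le> (\<Sum>i\<in>I. real K / 2 * (ln v - 1 + 1 / v) + (\<Sum>t<K. pow t i) / v)"
proof -
  let ?C = "real (card (msgs K M))"
  have C: "?C > 0" using M1 by (force simp: card_msgs intro!: prod_pos)
  define g where "g k t w = (\<integral>z. mix_ln (S k t) (M t) (c t t) (w t) z \<partial>\<nu>)" for k t and w :: "nat \<Rightarrow> nat"
  define N where "N k i = (pow k i + pow (\<tau> i k) i + 1) / v + ln (pi * v)" for k i
  have rot: "(\<integral>z. mix_ln (S k t) (M t) (c k t) (w t) z \<partial>\<nu>) = g k t w" for k t w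
    unfolding g_def by (rule mix_ln_rotate[OF finI S_sub, of "u k t"]) (auto simp: u1 cu[symmetric])
  have user: "(\<Sum>w\<in>msgs K M. measure \<nu> {z \<in> space \<nu>. dec k (out k w z) = w k} * ln (M k) - ln 2)
    \<le> ?C * ((\<Sum>i\<in>I - S k k. N k i) - real (card (S k k)) * (1 + ln pi)) +
      (\<Sum>w\<in>msgs K M. (\<Sum>t\<in>{..<K} - {k}. g k t w) - (\<Sum>j\<in>{..<K} - {k}. g j k w))" if k: "k < K" for k
  proof -
    have "(\<Sum>w\<in>msgs K M. measure \<nu> {z \<in> space \<nu>. dec k (out k w z) = w k} * ln (M k) - ln 2)
      \<le> (\<Sum>w\<in>msgs K M. (\<integral>z. ln (q k (w k) (out k w z)) \<partial>\<nu>) - (\<integral>z. ln (p k (out k w z)) \<partial>\<nu>))"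
      using user_bound[where dec = dec, OF k dec[OF k]] .
    also have "\<dots> = (\<Sum>w\<in>msgs K M. - real (card (S k k)) * (1 + ln pi) +
        (\<Sum>i\<in>I - S k k. ((cmod (mean k w i - \<mu> k i))\<^sup>2 + 1) / v + ln (pi * v)) +
        ((\<Sum>t\<in>{..<K} - {k}. g k t w) - (\<Sum>j\<in>{..<K} - {k}. g j k w)))"
      using k by (intro sum.cong refl) (simp add: ln_q_integrable ln_p_integrable rot g_def)
    also have "\<dots> = - (?C * (real (card (S k k)) * (1 + ln pi))) +
        (\<Sum>w\<in>msgs K M. \<Sum>i\<in>I - S k k. ((cmod (mean k w i - \<mu> k i))\<^sup>2 + 1) / v + ln (pi * v)) +
        (\<Sum>w\<in>msgs K M. (\<Sum>t\<in>{..<K} - {k}. g k t w) - (\<Sum>j\<in>{..<K} - {k}. g j k w))"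
      by (simp only: sum.distrib) simp
    also have "(\<Sum>w\<in>msgs K M. \<Sum>i\<in>I - S k k. ((cmod (mean k w i - \<mu> k i))\<^sup>2 + 1) / v + ln (pi * v))
        = (\<Sum>i\<in>I - S k k. \<Sum>w\<in>msgs K M. ((cmod (mean k w i - \<mu> k i))\<^sup>2 + 1) / v + ln (pi * v))"
      by (rule sum.swap)
    also have "\<dots> \<le> (\<Sum>i\<in>I - S k k. ?C * N k i)"
    proof (rule sum_mono)
      fix i assume "i \<in> I - S k k"
      then have i: "i \<in> I" "k \<in> D i" by (auto simp: S_def)
      have "(\<Sum>w\<in>msgs K M. ((cmod (mean k w i - \<mu> k i))\<^sup>2 + 1) / v + ln (pi * v))
          = ((\<Sum>w\<in>msgs K M. (cmod (mean k w i - \<mu> k i))\<^sup>2) + ?C) / v + ?C * ln (pi * v)"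
        by (simp add: sum.distrib sum_divide_distrib[symmetric])
      also have "\<dots> \<le> (?C * (pow k i + pow (\<tau> i k) i) + ?C) / v + ?C * ln (pi * v)"
        using v variance_le[OF k i] by (intro add_mono divide_right_mono) auto
      also have "\<dots> = ?C * N k i" by (simp add: N_def algebra_simps)
      finally show "(\<Sum>w\<in>msgs K M. ((cmod (mean k w i - \<mu> k i))\<^sup>2 + 1) / v + ln (pi * v)) \<le> ?C * N k i" .
    qed
    finally show ?thesis by (simp add: sum_distrib_left right_diff_distrib)
  qed
  have cancel: "(\<Sum>k<K. \<Sum>w\<in>msgs K M. (\<Sum>t\<in>{..<K} - {k}. g k t w) - (\<Sum>j\<in>{..<K} - {k}. g j k w)) = 0"
  proof -
    have "(\<Sum>k<K. \<Sum>w\<in>msgs K M. (\<Sum>t\<in>{..<K} - {k}. g k t w) - (\<Sum>j\<in>{..<K} - {k}. g j k w))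
      = (\<Sum>w\<in>msgs K M. \<Sum>k<K. (\<Sum>t\<in>{..<K} - {k}. g k t w) - (\<Sum>j\<in>{..<K} - {k}. g j k w))"
      by (rule sum.swap)
    also have "\<dots> = 0"
      by (simp add: sum_subtractf sum_off_diagonal_swap[of "\<lambda>k t. g k t w" for w])
    finally show ?thesis .
  qed
  have count: "(\<Sum>k<K. (\<Sum>i\<in>I - S k k. N k i) - real (card (S k k)) * (1 + ln pi))
      = (\<Sum>i\<in>I. real K / 2 * (ln v - 1 + 1 / v) + (\<Sum>t<K. pow t i) / v)"
  proof -
    have "(\<Sum>k<K. \<Sum>i\<in>I - S k k. N k i) = (\<Sum>k<K. \<Sum>i\<in>{i \<in> I. k \<in> D i}. N k i)"
      by (intro sum.cong refl) (auto simp: S_def)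
    also have "\<dots> = (\<Sum>i\<in>I. \<Sum>k\<in>{k \<in> {..<K}. k \<in> D i}. N k i)"
      using finI by (intro sum.swap_restrict) auto
    also have "\<dots> = (\<Sum>i\<in>I. \<Sum>k\<in>D i. N k i)"
      using D by (intro sum.cong refl) auto
    finally have 1: "(\<Sum>k<K. \<Sum>i\<in>I - S k k. N k i) = (\<Sum>i\<in>I. \<Sum>k\<in>D i. N k i)" .
    have "(\<Sum>k<K. real (card (S k k)) * (1 + ln pi)) = (\<Sum>k<K. \<Sum>i\<in>{i \<in> I. k \<notin> D i}. 1 + ln pi)"
      by (intro sum.cong refl) (auto simp: S_def)
    also have "\<dots> = (\<Sum>i\<in>I. \<Sum>k\<in>{k \<in> {..<K}. k \<notin> D i}. 1 + ln pi)"
      using finI by (intro sum.swap_restrict) auto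
    also have "\<dots> = (\<Sum>i\<in>I. real (card ({..<K} - D i)) * (1 + ln pi))"
      by (intro sum.cong refl) (simp add: set_diff_eq)
    finally have 2: "(\<Sum>k<K. real (card (S k k)) * (1 + ln pi)) = (\<Sum>i\<in>I. real (card ({..<K} - D i)) * (1 + ln pi))" .
    have 3: "(\<Sum>k\<in>D i. N k i) - real (card ({..<K} - D i)) * (1 + ln pi)
        = real K / 2 * (ln v - 1 + 1 / v) + (\<Sum>t<K. pow t i) / v" if i: "i \<in> I" for i
    proof -
      \<comment> \<open>Every transmitter is counted exactly once: interfered users through their
        own signal, clean users as interferers.\<close>
      have "(\<Sum>k\<in>D i. pow (\<tau> i k) i) = (\<Sum>t\<in>{..<K} - D i. pow t i)"
        using sum.reindex_bij_betw[OF \<tau>[OF i], of "\<lambda>t. pow t i"] .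
      moreover have "(\<Sum>t<K. pow t i) = (\<Sum>t\<in>{..<K} - D i. pow t i) + (\<Sum>t\<in>D i. pow t i)"
        using D[OF i] by (intro sum.subset_diff) auto
      ultimately have "(\<Sum>k\<in>D i. N k i) = (\<Sum>t<K. pow t i) / v + real K / 2 * (1 / v + ln (pi * v))"
        unfolding N_def by (simp add: sum.distrib sum_divide_distrib[symmetric] card_D[OF i] algebra_simps add_divide_distrib)
      then show ?thesis
        using v by (simp add: card_D[OF i] ln_mult algebra_simps)
    qed
    show ?thesis
      unfolding sum_subtractf 1 2 using 3 by (simp flip: sum_subtractf)
  qed
  have "?C * (\<Sum>k<K. (\<Sum>w\<in>msgs K M. measure \<nu> {z \<in> space \<nu>. dec k (out k w z) = w k}) / ?C * ln (M k) - ln 2)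
      = (\<Sum>k<K. \<Sum>w\<in>msgs K M. measure \<nu> {z \<in> space \<nu>. dec k (out k w z) = w k} * ln (M k) - ln 2)"
  proof -
    have "?C * (A / ?C * l - ln 2) = A * l - ?C * ln 2" for A l
      using C by (simp add: field_simps)
    then show ?thesis
      by (subst sum_distrib_left) (simp add: sum_subtractf flip: sum_distrib_right)
  qed
  also have "\<dots> \<le> (\<Sum>k<K. ?C * ((\<Sum>i\<in>I - S k k. N k i) - real (card (S k k)) * (1 + ln pi)) +
      (\<Sum>w\<in>msgs K M. (\<Sum>t\<in>{..<K} - {k}. g k t w) - (\<Sum>j\<in>{..<K} - {k}. g j k w)))"
    by (intro sum_mono user) auto
  also have "\<dots> = ?C * (\<Sum>k<K. (\<Sum>i\<in>I - S k k. N k i) - real (card (S k k)) * (1 + ln pi))"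
    by (simp only: sum.distrib cancel sum_distrib_left add_0_right)
  finally show ?thesis
    unfolding count using C by simp
qed

end

section \<open>The converse\<close>

lemma prob_space_phase_meas: "prob_space phase_meas"
  unfolding phase_meas_def using pi_gt_zero by (intro prob_space_uniform_measure) auto

lemma prob_space_phase_space: "prob_space (phase_space N L K)"
  unfolding phase_space_def by (intro prob_space_PiM prob_space_phase_meas)

lemma prob_space_noise_space: "prob_space (noise_space N L K)"
  unfolding noise_space_def by (rule prob_space_PiM_cgauss)

lemma prob_space_chan_space: "prob_space (chan_space N L K)"
proof -
  interpret p: prob_space "phase_space N L K" by (rule prob_space_phase_space)
  interpret n: prob_space "noise_space N L K" by (rule prob_space_noise_space)
  interpret pair_prob_space "phase_space N L K" "noise_space N L K" ..
  show ?thesis unfolding chan_space_def by unfold_locales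
qed

lemma distr_noise_space_receiver:
  assumes "k < K"
  shows "distr (noise_space N L K) (PiM ({..<N} \<times> {..<L}) (\<lambda>_. cgauss)) (\<lambda>Z. \<lambda>i\<in>{..<N} \<times> {..<L}. Z (fst i, snd i, k))
    = PiM ({..<N} \<times> {..<L}) (\<lambda>_. cgauss)"
  unfolding noise_space_def using assms
  by (intro distr_PiM_reindex[where f = "\<lambda>i. (fst i, snd i, k)"] prob_space_cgauss) (auto simp: inj_on_def)

text \<open>The pairs of subchannel \<open>l\<close> are encoded by their receivers
  \<open>D l\<close> and the map \<open>\<tau> l\<close> to the transmitters. Bijectivity onto the
  complement expresses that the pairs are disjoint and cover all users.\<close>

locale paired_states =
  fixes K :: nat and SNR :: real and As :: "(nat \<Rightarrow> nat \<Rightarrow> real) list"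
    and D :: "nat \<Rightarrow> nat set" and \<tau> :: "nat \<Rightarrow> nat \<Rightarrow> nat"
  assumes SNR: "SNR > 0"
    and D: "\<And>l. l < length As \<Longrightarrow> D l \<subseteq> {..<K}"
    and \<tau>: "\<And>l. l < length As \<Longrightarrow> bij_betw (\<tau> l) (D l) ({..<K} - D l)"
    and strength: "\<And>l r t. l < length As \<Longrightarrow> r < K \<Longrightarrow> t < K \<Longrightarrow>
      (As ! l) r t = (if r = t \<or> r \<in> D l \<and> t = \<tau> l r then sqrt SNR else 0)"
begin

abbreviation "L \<equiv> length As"

definition sig :: "phases \<Rightarrow> nat \<Rightarrow> nat \<Rightarrow> nat \<times> nat \<Rightarrow> complex \<Rightarrow> complex" where
  "sig \<Phi> r t i x = complex_of_real (sqrt SNR) * cis (\<Phi> (fst i, snd i, r, t)) * x"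

lemma \<tau>_props:
  assumes "l < L" "r \<in> D l"
  shows "\<tau> l r < K" "\<tau> l r \<notin> D l" "\<tau> l r \<noteq> r"
  using bij_betwE[OF \<tau>[OF assms(1)]] assms by auto

lemma recv_eq:
  assumes "r < K"
  shows "recv As K N x \<Phi> Z r = (\<lambda>n l. if n < N \<and> l < L then
    sig \<Phi> r r (n, l) (x r n l) + (if r \<in> D l then sig \<Phi> r (\<tau> l r) (n, l) (x (\<tau> l r) n l) else 0) + Z (n, l, r) else 0)"
proof (intro ext)
  fix n l
  show "recv As K N x \<Phi> Z r n l = (if n < N \<and> l < L then
    sig \<Phi> r r (n, l) (x r n l) + (if r \<in> D l then sig \<Phi> r (\<tau> l r) (n, l) (x (\<tau> l r) n l) else 0) + Z (n, l, r) else 0)"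
  proof (cases "n < N \<and> l < L")
    case True
    define f where "f t = complex_of_real ((As ! l) r t) * cis (\<Phi> (n, l, r, t)) * x t n l" for t
    have f: "f t = (if t = r \<or> r \<in> D l \<and> t = \<tau> l r then sig \<Phi> r t (n, l) (x t n l) else 0)" if "t < K" for t
      using strength[of l r t] True assms that by (auto simp: f_def sig_def)
    have "(\<Sum>t<K. f t) = (\<Sum>t\<in>(if r \<in> D l then {r, \<tau> l r} else {r}). f t)"
      using assms \<tau>_props[of l r] True by (intro sum.mono_neutral_right) (auto simp: f)
    also have "\<dots> = sig \<Phi> r r (n, l) (x r n l) + (if r \<in> D l then sig \<Phi> r (\<tau> l r) (n, l) (x (\<tau> l r) n l) else 0)"
      using assms \<tau>_props[of l r] True by (auto simp: f)
    finally show ?thesis using True by (simp add: recv_def f_def)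
  qed (auto simp: recv_def)
qed

text \<open>For fixed phases the codewords are fixed vectors, as \<open>paired_outputs\<close>
  requires. The power appears with its actual value because the code constrains only its average
  over the phases.\<close>

lemma converse_given_phases:
  assumes code: "is_code As K N M enc dec" and \<Phi>: "\<Phi> \<in> space (phase_space N L K)"
  defines "err \<equiv> (\<Sum>w\<in>msgs K M. measure (noise_space N L K) {Z \<in> space (noise_space N L K).
      \<exists>r<K. dec r \<Phi> (recv As K N (\<lambda>t n l. enc t (w t) n \<Phi> l) \<Phi> Z r) \<noteq> w r}) / real (card (msgs K M))"
  defines "v \<equiv> 1 + 2 * SNR"
  shows "(\<Sum>k<K. ln (M k)) - real K * ln 2 - real N * real L * (real K / 2 * (ln v - 1 + 1 / v))
    \<le> (\<Sum>k<K. ln (M k)) * err + SNR / v * (\<Sum>t<K. \<Sum>l<L. (\<Sum>w<M t. \<Sum>n<N. (cmod (enc t w n \<Phi> l))\<^sup>2) / real (M t))"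
proof -
  let ?I = "{..<N} \<times> {..<L}" and ?NS = "noise_space N L K"
  define c where "c k t w i = sig \<Phi> k t i (enc t w (fst i) \<Phi> (snd i))" for k t w i
  \<comment> \<open>The phase of the link from \<open>t\<close> to \<open>k\<close> relative to the
    direct link of \<open>t\<close>.\<close>
  define u where "u k t i = cis (\<Phi> (fst i, snd i, k, t) - \<Phi> (fst i, snd i, t, t))" for k t i
  have M1: "\<And>k. k < K \<Longrightarrow> 1 \<le> M k" using code by (simp add: is_code_def)
  interpret P: paired_outputs ?I K "\<lambda>i. D (snd i)" "\<lambda>i. \<tau> (snd i)" M c u v
  proof
    show "c k t w i = u k t i * c t t w i" for k t w i
      unfolding c_def sig_def u_def by (simp add: cis_mult flip: mult.assoc)
  qed (use M1 D[THEN subsetD] \<tau> SNR in \<open>auto simp: u_def v_def\<close>)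
  interpret NS: prob_space ?NS by (rule prob_space_noise_space)
  define dec' where "dec' k y = dec k \<Phi> (\<lambda>n l. if n < N \<and> l < L then y (n, l) else 0)" for k y
  have recv: "recv As K N (\<lambda>t n l. enc t (w t) n \<Phi> l) \<Phi> Z k = (\<lambda>n l. if n < N \<and> l < L then P.mean k w (n, l) + Z (n, l, k) else 0)"
    if "k < K" for w Z k
    unfolding recv_eq[OF that] by (auto simp: P.mean_def c_def intro!: ext)
  have noise_meas: "(\<lambda>Z. dec k \<Phi> (recv As K N (\<lambda>t n l. enc t (w t) n \<Phi> l) \<Phi> Z k)) \<in> ?NS \<rightarrow>\<^sub>M count_space UNIV"
    if "k < K" "w \<in> msgs K M" for k w
  proof -
    have "(\<lambda>(\<Phi>, Z). dec k \<Phi> (recv As K N (\<lambda>t n l. enc t (w t) n \<Phi> l) \<Phi> Z k))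
        \<in> phase_space N L K \<Otimes>\<^sub>M ?NS \<rightarrow>\<^sub>M count_space UNIV"
      using code that by (simp add: is_code_def chan_space_def)
    from measurable_compose[OF measurable_Pair1'[OF \<Phi>] this] show ?thesis by simp
  qed
  have dec_meas: "dec' k \<in> PiM ?I (\<lambda>_. borel) \<rightarrow>\<^sub>M count_space UNIV" if k: "k < K" for k
  proof -
    \<comment> \<open>A code guarantees measurability of decoding only as a function of phases and
      noise. Every array \<open>y\<close> on the coordinates is a received signal, however: let all
      messages be 0 and the noise at receiver \<open>k\<close> be \<open>y\<close> minus the
      noiseless output.\<close>
    define w where "w = (\<lambda>k\<in>{..<K}. 0 :: nat)"
    have w: "w \<in> msgs K M" using M1 by (force simp: w_def msgs_def)
    define T where "T y = (\<lambda>j\<in>{..<N} \<times> {..<L} \<times> {..<K}. case j of (n, l, r) \<Rightarrow>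
        if r = k then y (n, l) - P.mean k w (n, l) else 0)" for y
    have "T \<in> PiM ?I (\<lambda>_. borel) \<rightarrow>\<^sub>M ?NS"
      unfolding T_def[abs_def] noise_space_def
    proof (rule measurable_restrict)
      fix j assume "j \<in> {..<N} \<times> {..<L} \<times> {..<K}"
      then obtain n l r where j: "j = (n, l, r)" "n < N" "l < L" "r < K" by (cases j) auto
      have "(\<lambda>y. y (n, l)) \<in> borel_measurable (PiM ?I (\<lambda>_. borel :: complex measure))"
        using j by (intro measurable_component_singleton) auto
      then show "(\<lambda>y. case j of (n, l, r) \<Rightarrow> if r = k then y (n, l) - P.mean k w (n, l) else 0)
          \<in> PiM ?I (\<lambda>_. borel) \<rightarrow>\<^sub>M cgauss"
        by (auto simp: j(1))
    qed
    from measurable_compose[OF this noise_meas[OF k w]]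
    have "(\<lambda>y. dec k \<Phi> (recv As K N (\<lambda>t n l. enc t (w t) n \<Phi> l) \<Phi> (T y) k)) \<in> PiM ?I (\<lambda>_. borel) \<rightarrow>\<^sub>M count_space UNIV" .
    moreover have "dec k \<Phi> (recv As K N (\<lambda>t n l. enc t (w t) n \<Phi> l) \<Phi> (T y) k) = dec' k y" for y
    proof -
      have "recv As K N (\<lambda>t n l. enc t (w t) n \<Phi> l) \<Phi> (T y) k = (\<lambda>n l. if n < N \<and> l < L then y (n, l) else 0)"
        unfolding recv[OF k] using k by (auto simp: T_def intro!: ext)
      then show ?thesis by (simp add: dec'_def)
    qed
    ultimately show ?thesis by (simp add: dec'_def[abs_def])
  qed
  define good where "good k w = measure P.\<nu> {z \<in> space P.\<nu>. dec' k (P.out k w z) = w k}" for k w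
  have good: "good k w = measure ?NS {Z \<in> space ?NS. dec k \<Phi> (recv As K N (\<lambda>t n l. enc t (w t) n \<Phi> l) \<Phi> Z k) = w k}"
    if k: "k < K" for k w
  proof -
    define T where "T Z = (\<lambda>i\<in>?I. Z (fst i, snd i, k) :: complex)" for Z
    have T: "T \<in> ?NS \<rightarrow>\<^sub>M P.\<nu>"
      unfolding T_def[abs_def] noise_space_def using k
      by (intro measurable_restrict) (auto intro!: measurable_component_singleton)
    have E: "{z \<in> space P.\<nu>. dec' k (P.out k w z) = w k} \<in> sets P.\<nu>"
      using dec_meas[OF k] P.out_measurable[of k w] by measurable
    have "good k w = measure (distr ?NS P.\<nu> T) {z \<in> space P.\<nu>. dec' k (P.out k w z) = w k}"
      unfolding good_def T_def[abs_def] distr_noise_space_receiver[OF k] ..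
    also have "\<dots> = measure ?NS (T -` {z \<in> space P.\<nu>. dec' k (P.out k w z) = w k} \<inter> space ?NS)"
      by (rule measure_distr[OF T E])
    also have "T -` {z \<in> space P.\<nu>. dec' k (P.out k w z) = w k} \<inter> space ?NS =
        {Z \<in> space ?NS. dec k \<Phi> (recv As K N (\<lambda>t n l. enc t (w t) n \<Phi> l) \<Phi> Z k) = w k}"
    proof -
      have "dec' k (P.out k w (T Z)) = dec k \<Phi> (recv As K N (\<lambda>t n l. enc t (w t) n \<Phi> l) \<Phi> Z k)" for Z
        unfolding dec'_def recv[OF k] by (intro arg_cong[where f = "dec k \<Phi>"] ext) (auto simp: P.out_def T_def)
      then show ?thesis using measurable_space[OF T] by auto
    qed
    finally show ?thesis .
  qed
  let ?C = "real (card (msgs K M))"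
  have C: "?C > 0" using M1 by (force simp: card_msgs intro!: prod_pos)
  \<comment> \<open>If nobody errs, then in particular user \<open>k\<close> decodes
    correctly.\<close>
  have ge: "1 - err \<le> (\<Sum>w\<in>msgs K M. good k w) / ?C" if k: "k < K" for k
  proof -
    have "1 - measure ?NS {Z \<in> space ?NS. \<exists>r<K. dec r \<Phi> (recv As K N (\<lambda>t n l. enc t (w t) n \<Phi> l) \<Phi> Z r) \<noteq> w r} \<le> good k w"
      if w: "w \<in> msgs K M" for w
    proof -
      have E [measurable]: "{Z \<in> space ?NS. dec r \<Phi> (recv As K N (\<lambda>t n l. enc t (w t) n \<Phi> l) \<Phi> Z r) = w r} \<in> sets ?NS" if "r < K" for r
        using noise_meas[OF that w] by measurable
      have "{Z \<in> space ?NS. \<exists>r<K. dec r \<Phi> (recv As K N (\<lambda>t n l. enc t (w t) n \<Phi> l) \<Phi> Z r) \<noteq> w r}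
          = (\<Union>r<K. space ?NS - {Z \<in> space ?NS. dec r \<Phi> (recv As K N (\<lambda>t n l. enc t (w t) n \<Phi> l) \<Phi> Z r) = w r})"
        by auto
      also have "\<dots> \<in> sets ?NS" using E by (intro sets.finite_UN) auto
      finally have "measure ?NS (space ?NS - {Z \<in> space ?NS. dec k \<Phi> (recv As K N (\<lambda>t n l. enc t (w t) n \<Phi> l) \<Phi> Z k) = w k})
          \<le> measure ?NS {Z \<in> space ?NS. \<exists>r<K. dec r \<Phi> (recv As K N (\<lambda>t n l. enc t (w t) n \<Phi> l) \<Phi> Z r) \<noteq> w r}"
        using k by (intro NS.finite_measure_mono) auto
      then show ?thesis using E[OF k] by (simp add: good[OF k] NS.prob_compl)
    qed
    from sum_mono[OF this, of "msgs K M" "\<lambda>w. w"]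
    have "?C - err * ?C \<le> (\<Sum>w\<in>msgs K M. good k w)"
      using C by (simp add: err_def sum_subtractf)
    then show ?thesis using C by (simp add: field_simps)
  qed
  have lnM: "ln (M k) \<ge> 0" if "k < K" for k using M1[OF that] by simp
  have "(\<Sum>k<K. (1 - err) * ln (M k) - ln 2) \<le> (\<Sum>k<K. (\<Sum>w\<in>msgs K M. good k w) / ?C * ln (M k) - ln 2)"
    by (intro sum_mono diff_right_mono mult_right_mono ge lnM) auto
  also have "\<dots> \<le> (\<Sum>i\<in>?I. real K / 2 * (ln v - 1 + 1 / v) + (\<Sum>t<K. P.pow t i) / v)"
    unfolding good_def by (rule P.converse_bound[OF dec_meas])
  also have "\<dots> = real N * real L * (real K / 2 * (ln v - 1 + 1 / v)) + (\<Sum>i\<in>?I. \<Sum>t<K. P.pow t i) / v"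
    by (simp add: sum.distrib sum_divide_distrib)
  also have "(\<Sum>i\<in>?I. \<Sum>t<K. P.pow t i) = SNR * (\<Sum>t<K. \<Sum>l<L. (\<Sum>w<M t. \<Sum>n<N. (cmod (enc t w n \<Phi> l))\<^sup>2) / real (M t))"
  proof -
    have pow: "P.pow t (n, l) = SNR * ((\<Sum>w<M t. (cmod (enc t w n \<Phi> l))\<^sup>2) / real (M t))" for t n l
      unfolding P.pow_def c_def sig_def using SNR
      by (simp add: norm_mult power_mult_distrib sum_distrib_left)
    have "(\<Sum>i\<in>?I. \<Sum>t<K. P.pow t i) = (\<Sum>n<N. \<Sum>l<L. \<Sum>t<K. P.pow t (n, l))"
      unfolding sum.cartesian_product[of "\<lambda>n l. \<Sum>t<K. P.pow t (n, l)"] by (simp add: split_beta')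
    also have "\<dots> = (\<Sum>n<N. \<Sum>t<K. \<Sum>l<L. P.pow t (n, l))"
      by (intro sum.cong refl sum.swap)
    also have "\<dots> = (\<Sum>t<K. \<Sum>n<N. \<Sum>l<L. P.pow t (n, l))"
      by (rule sum.swap)
    also have "\<dots> = (\<Sum>t<K. \<Sum>l<L. \<Sum>n<N. P.pow t (n, l))"
      by (intro sum.cong refl sum.swap)
    also have "\<dots> = SNR * (\<Sum>t<K. \<Sum>l<L. (\<Sum>n<N. \<Sum>w<M t. (cmod (enc t w n \<Phi> l))\<^sup>2) / real (M t))"
      unfolding pow by (simp add: sum_distrib_left sum_divide_distrib)
    finally show ?thesis by (simp add: sum.swap[of _ "{..<N}"])
  qed
  finally show ?thesis
    by (simp add: sum_subtractf sum_distrib_left[symmetric] left_diff_distrib mult.commute)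
qed

end


section \<open>Averaging the converse over the phases\<close>

context paired_states
begin

text \<open>Integration over the phases turns \<open>e\<close> into the error probability and
  subjects \<open>Q\<close> to the power constraint. Both enter the bound for fixed phases
  linearly.\<close>

lemma converse_code:
  assumes code: "is_code As K N M enc dec"
  shows "(1 - err_prob As K N M enc dec) * (\<Sum>k<K. ln (M k)) \<le>
    real K * ln 2 + real N * (real L * (real K / 2) * ln (1 + 2 * SNR))"
proof -
  let ?PS = "phase_space N L K" and ?NS = "noise_space N L K" and ?CS = "chan_space N L K"
  interpret PS: prob_space ?PS by (rule prob_space_phase_space)
  interpret NS: prob_space ?NS by (rule prob_space_noise_space)
  interpret CS: prob_space ?CS by (rule prob_space_chan_space)
  define v where "v = 1 + 2 * SNR"
  have v: "v > 0" using SNR by (simp add: v_def)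
  have M1: "\<And>k. k < K \<Longrightarrow> 1 \<le> M k" using code by (simp add: is_code_def)
  let ?C = "real (card (msgs K M))"
  have C: "?C > 0" using M1 by (force simp: card_msgs intro!: prod_pos)
  define E where "E w = {(\<Phi>, Z) \<in> space ?CS. \<exists>r<K. dec r \<Phi> (recv As K N (\<lambda>t n l. enc t (w t) n \<Phi> l) \<Phi> Z r) \<noteq> w r}" for w
  define a where "a = (\<Sum>k<K. ln (M k))"
  have a: "a \<ge> 0" using M1 by (auto simp: a_def intro!: sum_nonneg)
  define B where "B = real N * real L * (real K / 2 * (ln v - 1 + 1 / v))"
  define e where "e \<Phi> = (\<Sum>w\<in>msgs K M. measure ?NS (Pair \<Phi> -` E w)) / ?C" for \<Phi>
  define Q where "Q \<Phi> = (\<Sum>t<K. \<Sum>l<L. (\<Sum>w<M t. \<Sum>n<N. (cmod (enc t w n \<Phi> l))\<^sup>2) / real (M t))" for \<Phi>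
  have E_sets: "E w \<in> sets (?PS \<Otimes>\<^sub>M ?NS)" if w: "w \<in> msgs K M" for w
  proof -
    have "(\<lambda>x. case x of (\<Phi>, Z) \<Rightarrow> dec r \<Phi> (recv As K N (\<lambda>t n l. enc t (w t) n \<Phi> l) \<Phi> Z r)) \<in> ?CS \<rightarrow>\<^sub>M count_space UNIV"
      if "r < K" for r
      using code w that by (simp add: is_code_def)
    from measurable_sets[OF this, of _ "- {w r}" for r]
    have "(\<Union>r<K. (\<lambda>(\<Phi>, Z). dec r \<Phi> (recv As K N (\<lambda>t n l. enc t (w t) n \<Phi> l) \<Phi> Z r)) -` (- {w r}) \<inter> space ?CS) \<in> sets ?CS"
      by (intro sets.finite_UN) auto
    also have "(\<Union>r<K. (\<lambda>(\<Phi>, Z). dec r \<Phi> (recv As K N (\<lambda>t n l. enc t (w t) n \<Phi> l) \<Phi> Z r)) -` (- {w r}) \<inter> space ?CS) = E w"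
      by (auto simp: E_def)
    finally show ?thesis by (simp add: chan_space_def)
  qed
  have slice_meas [measurable]: "(\<lambda>\<Phi>. measure ?NS (Pair \<Phi> -` E w)) \<in> borel_measurable ?PS" if "w \<in> msgs K M" for w
    using NS.measurable_emeasure_Pair[OF E_sets[OF that]] unfolding measure_def by measurable
  have slice_int: "(\<integral>\<^sup>+\<Phi>. ennreal (measure ?NS (Pair \<Phi> -` E w)) \<partial>?PS) = ennreal (measure ?CS (E w))" if "w \<in> msgs K M" for w
    using NS.emeasure_pair_measure_alt[OF E_sets[OF that]]
    by (simp add: NS.emeasure_eq_measure chan_space_def[symmetric] CS.emeasure_eq_measure)
  have pointwise: "a - real K * ln 2 - B \<le> a * e \<Phi> + SNR / v * Q \<Phi>" if \<Phi>: "\<Phi> \<in> space ?PS" for \<Phi>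
  proof -
    have "{Z \<in> space ?NS. \<exists>r<K. dec r \<Phi> (recv As K N (\<lambda>t n l. enc t (w t) n \<Phi> l) \<Phi> Z r) \<noteq> w r} = Pair \<Phi> -` E w" for w
      using \<Phi> by (auto simp: E_def chan_space_def space_pair_measure)
    then show ?thesis
      using converse_given_phases[OF code \<Phi>] by (simp add: a_def B_def e_def Q_def v_def)
  qed
  have Q_meas_aux: "(\<lambda>\<Phi>. enc t w n \<Phi> l) \<in> borel_measurable ?PS" if "t < K" "w < M t" "n < N" "l < L" for t w n l
    using code that by (simp add: is_code_def)
  have Q_int: "(\<integral>\<^sup>+\<Phi>. ennreal (Q \<Phi>) \<partial>?PS) \<le> ennreal (real K * real L * real N)"
  proof -
    have "ennreal (Q \<Phi>) = (\<Sum>t<K. \<Sum>l<L. ennreal (1 / real (M t)) * (\<Sum>w<M t. \<Sum>n<N. ennreal ((cmod (enc t w n \<Phi> l))\<^sup>2)))" for \<Phi>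
      unfolding Q_def by (simp add: sum_nonneg sum_ennreal flip: ennreal_mult)
    then have "(\<integral>\<^sup>+\<Phi>. ennreal (Q \<Phi>) \<partial>?PS) =
        (\<integral>\<^sup>+\<Phi>. (\<Sum>t<K. \<Sum>l<L. ennreal (1 / real (M t)) * (\<Sum>w<M t. \<Sum>n<N. ennreal ((cmod (enc t w n \<Phi> l))\<^sup>2))) \<partial>?PS)"
      by simp
    also have "\<dots> = (\<Sum>t<K. \<Sum>l<L. ennreal (1 / real (M t)) * (\<Sum>w<M t. \<Sum>n<N. \<integral>\<^sup>+\<Phi>. ennreal ((cmod (enc t w n \<Phi> l))\<^sup>2) \<partial>?PS))"
    proof -
      have m: "(\<lambda>\<Phi>. ennreal ((cmod (enc t w n \<Phi> l))\<^sup>2)) \<in> borel_measurable ?PS"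
        if "t \<in> {..<K}" "w \<in> {..<M t}" "n \<in> {..<N}" "l \<in> {..<L}" for t w n l
      proof -
        have [measurable]: "(\<lambda>\<Phi>. enc t w n \<Phi> l) \<in> borel_measurable ?PS"
          using that by (intro Q_meas_aux) auto
        show ?thesis by measurable
      qed
      show ?thesis
        by (intro trans[OF nn_integral_sum] trans[OF nn_integral_cmult] sum.cong refl arg_cong2[where f = "(*)"]
            borel_measurable_sum borel_measurable_times_ennreal borel_measurable_const m)
    qed
    also have "\<dots> \<le> (\<Sum>t<K. \<Sum>l<L. ennreal (real N))"
    proof (intro sum_mono)
      fix t l assume "t \<in> {..<K}" "l \<in> {..<L}"
      then have "(\<Sum>w<M t. \<Sum>n<N. \<integral>\<^sup>+\<Phi>. ennreal ((cmod (enc t w n \<Phi> l))\<^sup>2) \<partial>?PS) \<le> ennreal (real N * real (M t))"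
        and "M t \<ge> 1"
        using code M1 by (auto simp: is_code_def)
      then have "ennreal (1 / real (M t)) * (\<Sum>w<M t. \<Sum>n<N. \<integral>\<^sup>+\<Phi>. ennreal ((cmod (enc t w n \<Phi> l))\<^sup>2) \<partial>?PS)
          \<le> ennreal (1 / real (M t)) * ennreal (real N * real (M t))"
        by (intro mult_left_mono) auto
      also have "\<dots> = ennreal (real N)"
        using \<open>M t \<ge> 1\<close> by (simp flip: ennreal_mult)
      finally show "ennreal (1 / real (M t)) * (\<Sum>w<M t. \<Sum>n<N. \<integral>\<^sup>+\<Phi>. ennreal ((cmod (enc t w n \<Phi> l))\<^sup>2) \<partial>?PS) \<le> ennreal (real N)" .
    qed
    also have "\<dots> = ennreal (real K * real L * real N)"
      by (simp add: ennreal_of_nat_eq_real_of_nat mult.assoc flip: ennreal_mult)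
    finally show ?thesis .
  qed
  have Q_meas [measurable]: "Q \<in> borel_measurable ?PS"
    unfolding Q_def[abs_def]
  proof (intro borel_measurable_sum borel_measurable_divide)
    fix t l w n assume "t \<in> {..<K}" "l \<in> {..<L}" "w \<in> {..<M t}" "n \<in> {..<N}"
    then have [measurable]: "(\<lambda>\<Phi>. enc t w n \<Phi> l) \<in> borel_measurable ?PS"
      by (intro Q_meas_aux) auto
    show "(\<lambda>\<Phi>. (cmod (enc t w n \<Phi> l))\<^sup>2) \<in> borel_measurable ?PS" by measurable
  qed simp
  have e_meas [measurable]: "e \<in> borel_measurable ?PS"
    unfolding e_def[abs_def] by measurable
  have e_int: "(\<integral>\<^sup>+\<Phi>. ennreal (e \<Phi>) \<partial>?PS) = ennreal (err_prob As K N M enc dec)"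
  proof -
    have "ennreal (e \<Phi>) = ennreal (1 / ?C) * (\<Sum>w\<in>msgs K M. ennreal (measure ?NS (Pair \<Phi> -` E w)))" for \<Phi>
      unfolding e_def by (simp add: sum_nonneg sum_ennreal flip: ennreal_mult)
    then have "(\<integral>\<^sup>+\<Phi>. ennreal (e \<Phi>) \<partial>?PS) =
        (\<integral>\<^sup>+\<Phi>. ennreal (1 / ?C) * (\<Sum>w\<in>msgs K M. ennreal (measure ?NS (Pair \<Phi> -` E w))) \<partial>?PS)"
      by (simp only:)
    also have "\<dots> = ennreal (1 / ?C) * (\<Sum>w\<in>msgs K M. ennreal (measure ?CS (E w)))"
      by (intro trans[OF nn_integral_cmult] trans[OF nn_integral_sum] sum.cong refl arg_cong2[where f = "(*)"]
          slice_int borel_measurable_sum measurable_compose[OF _ measurable_ennreal] slice_meas)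
    also have "\<dots> = ennreal (err_prob As K N M enc dec)"
    proof -
      have "err_prob As K N M enc dec = 1 / ?C * (\<Sum>w\<in>msgs K M. measure ?CS (E w))"
        by (simp add: err_prob_def E_def card_msgs)
      then show ?thesis by (simp only: sum_ennreal measure_nonneg ennreal_mult'' sum_nonneg)
    qed
    finally show ?thesis .
  qed
  have err0: "err_prob As K N M enc dec \<ge> 0"
    by (auto simp: err_prob_def intro!: divide_nonneg_nonneg sum_nonneg prod_nonneg)
  have Q0: "Q \<Phi> \<ge> 0" and e0: "e \<Phi> \<ge> 0" for \<Phi>
    by (auto simp: Q_def e_def intro!: sum_nonneg divide_nonneg_nonneg)
  \<comment> \<open>With nonnegative integrals, finiteness of the mean of \<open>Q\<close> need not
    be known beforehand. A negative left-hand side is truncated to 0, which does no harm since the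
    right-hand side is nonnegative.\<close>
  have "ennreal (a - real K * ln 2 - B) = (\<integral>\<^sup>+\<Phi>. ennreal (a - real K * ln 2 - B) \<partial>?PS)"
    by (simp add: PS.emeasure_space_1)
  also have "\<dots> \<le> (\<integral>\<^sup>+\<Phi>. ennreal a * ennreal (e \<Phi>) + ennreal (SNR / v) * ennreal (Q \<Phi>) \<partial>?PS)"
  proof (rule nn_integral_mono)
    fix \<Phi> assume "\<Phi> \<in> space ?PS"
    then have "ennreal (a - real K * ln 2 - B) \<le> ennreal (a * e \<Phi> + SNR / v * Q \<Phi>)"
      by (intro ennreal_leI pointwise)
    also have "\<dots> = ennreal a * ennreal (e \<Phi>) + ennreal (SNR / v) * ennreal (Q \<Phi>)"
      using a v SNR Q0[of \<Phi>] e0[of \<Phi>] by (simp add: ennreal_plus ennreal_mult del: times_divide_eq_left)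
    finally show "ennreal (a - real K * ln 2 - B) \<le> ennreal a * ennreal (e \<Phi>) + ennreal (SNR / v) * ennreal (Q \<Phi>)" .
  qed
  also have "\<dots> = ennreal a * (\<integral>\<^sup>+\<Phi>. ennreal (e \<Phi>) \<partial>?PS) + ennreal (SNR / v) * (\<integral>\<^sup>+\<Phi>. ennreal (Q \<Phi>) \<partial>?PS)"
    by (simp add: nn_integral_add nn_integral_cmult)
  also have "\<dots> \<le> ennreal a * ennreal (err_prob As K N M enc dec) + ennreal (SNR / v) * ennreal (real K * real L * real N)"
    using Q_int by (intro add_mono mult_left_mono) (auto simp: e_int)
  also have "\<dots> = ennreal (a * err_prob As K N M enc dec + SNR / v * (real K * real L * real N))"
    using a v SNR err0 by (simp flip: ennreal_mult ennreal_plus)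
  finally have "a - real K * ln 2 - B \<le> a * err_prob As K N M enc dec + SNR / v * (real K * real L * real N)"
    using a v SNR err0 by (subst (asm) ennreal_le_iff) auto
  \<comment> \<open>Here the value of \<open>v\<close> pays off: -1 and (1 + 2 SNR) / v cancel,
    leaving only the logarithm.\<close>
  moreover have "B + SNR / v * (real K * real L * real N) = real N * (real L * (real K / 2) * ln v)"
  proof -
    have "B + SNR / v * (real K * real L * real N) = real N * real L * (real K / 2) * (ln v - 1 + (1 + 2 * SNR) / v)"
      using v by (simp add: B_def add_divide_distrib algebra_simps)
    also have "\<dots> = real N * (real L * (real K / 2) * ln v)"
      using v by (simp add: v_def[symmetric])
    finally show ?thesis .
  qed
  ultimately have "a - a * err_prob As K N M enc dec \<le> real K * ln 2 + real N * (real L * (real K / 2) * ln v)"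
    by linarith
  then show ?thesis
    unfolding v_def a_def[symmetric] by (simp add: left_diff_distrib mult.commute[of a])
qed

lemma achievable_le:
  assumes "achievable As K R"
  shows "(\<Sum>k<K. R k) \<le> real L * (real K / 2) * log 2 (1 + 2 * SNR)"
proof (rule ccontr)
  define B where "B = real L * (real K / 2) * ln (1 + 2 * SNR)"
  define s where "s = (\<Sum>k<K. R k) * ln 2"
  assume "\<not> ?thesis"
  then have sB: "s > B"
    by (simp add: s_def B_def log_def field_simps)
  have B: "B \<ge> 0" using SNR by (simp add: B_def)
  \<comment> \<open>Makes \<open>(1 - \<epsilon>) * s\<close> the midpoint of \<open>s\<close> and
    \<open>B\<close>, hence still above \<open>B\<close>; a long block then outweighs the constant
    \<open>real K * ln 2\<close>.\<close>
  define \<epsilon> where "\<epsilon> = (s - B) / (2 * s)"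
  have s: "s > 0" using sB B by simp
  have \<epsilon>: "\<epsilon> > 0" "(1 - \<epsilon>) * s = (s + B) / 2" "\<epsilon> \<le> 1"
    using s sB B by (auto simp: \<epsilon>_def field_simps)
  obtain N0 where N0: "\<And>N. N \<ge> N0 \<Longrightarrow> \<exists>M enc dec. is_code As K N M enc dec \<and>
        (\<forall>k<K. real (M k) \<ge> 2 powr (real N * R k)) \<and> err_prob As K N M enc dec \<le> \<epsilon>"
    using assms \<epsilon> unfolding achievable_def by meson
  obtain N where N: "N \<ge> N0" "real N * ((s - B) / 2) > real K * ln 2"
  proof -
    obtain n :: nat where "real n > real K * ln 2 / ((s - B) / 2)"
      using reals_Archimedean2 by blast
    then have "real (max n N0) > real K * ln 2 / ((s - B) / 2)" by linarith
    then show ?thesis using that[of "max n N0"] sB by (simp add: field_simps)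
  qed
  obtain M enc dec where code: "is_code As K N M enc dec" and M: "\<And>k. k < K \<Longrightarrow> real (M k) \<ge> 2 powr (real N * R k)"
    and err: "err_prob As K N M enc dec \<le> \<epsilon>"
    using N0[OF N(1)] by blast
  have lnM: "real N * R k * ln 2 \<le> ln (M k)" if "k < K" for k
  proof -
    have "ln (2 powr (real N * R k)) \<le> ln (M k)"
      using M[OF that] by (intro ln_mono) auto
    then show ?thesis by (simp add: ln_powr)
  qed
  have "real N * s \<le> (\<Sum>k<K. ln (M k))"
    using sum_mono[of "{..<K}" "\<lambda>k. real N * R k * ln 2" "\<lambda>k. ln (M k)"] lnM
    by (simp add: s_def sum_distrib_left sum_distrib_right mult.assoc)
  then have "(1 - \<epsilon>) * (real N * s) \<le> (1 - err_prob As K N M enc dec) * (\<Sum>k<K. ln (M k))"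
    using err \<epsilon> s by (intro mult_mono) auto
  also have "\<dots> \<le> real K * ln 2 + real N * B"
    using converse_code[OF code] by (simp add: B_def)
  finally have "real N * ((1 - \<epsilon>) * s) \<le> real K * ln 2 + real N * B"
    by (simp add: ac_simps)
  then show False
    unfolding \<epsilon>(2) using N(2) by (simp add: field_simps)
qed

end

section \<open>Information density and linear forms\<close>

text \<open>Information density of the Gaussian channel with input power \<open>\<kappa>\<close> at the receiver (signal \<open>g\<close>, output \<open>y\<close>)
  and noise variance \<open>v\<close>.\<close>

definition iota :: "real \<Rightarrow> real \<Rightarrow> complex \<Rightarrow> complex \<Rightarrow> real" where
  "iota \<kappa> v y g = ln ((\<kappa> + v) / v) + (cmod y)\<^sup>2 / (\<kappa> + v) - (cmod (y - g))\<^sup>2 / v"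

lemma iota_measurable [measurable (raw)]:
  assumes [measurable]: "f \<in> borel_measurable M" "g \<in> borel_measurable M"
  shows "(\<lambda>x. iota \<kappa> v (f x) (g x)) \<in> borel_measurable M"
  unfolding iota_def by measurable

text \<open>The exponential of \<open>iota\<close> is the ratio of the conditional density of the
  output to its Gaussian marginal, so averaging over an independent input gives 1 at every
  \<open>y\<close>. Concretely, the prior times this ratio is the posterior density of the input:
  Gaussian with the mean-square estimate \<open>m\<close> as mean and with variance
  \<open>v / (\<kappa> + v)\<close>.\<close>

lemma nn_integral_exp_iota:
  assumes "v > 0" "\<kappa> > 0" and a: "(cmod a)\<^sup>2 = \<kappa>"
  shows "(\<integral>\<^sup>+x. ennreal (exp (iota \<kappa> v y (a * x))) \<partial>cgauss) = 1"
proof -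
  define m where "m = cnj a * y / of_real (\<kappa> + v)"
  have square: "(cmod x)\<^sup>2 + (cmod (y - a * x))\<^sup>2 / v - (cmod y)\<^sup>2 / (\<kappa> + v) = (cmod (x - m))\<^sup>2 / (v / (\<kappa> + v))" for x
  proof -
    define t where "t = Re (cnj y * a * x)"
    have ax: "(cmod (a * x))\<^sup>2 = \<kappa> * (cmod x)\<^sup>2"
      by (simp add: norm_mult power_mult_distrib a)
    have "(cmod (y - a * x))\<^sup>2 = (cmod y)\<^sup>2 - 2 * Re (cnj y * (a * x)) + (cmod (a * x))\<^sup>2"
      by (simp only: cmod_power2 power2_diff complex_mult_cnj minus_complex.sel times_complex.sel cnj.sel) (simp add: algebra_simps power2_eq_square)
    then have 1: "(cmod (y - a * x))\<^sup>2 = (cmod y)\<^sup>2 - 2 * t + \<kappa> * (cmod x)\<^sup>2"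
      by (simp add: t_def ax mult.assoc)
    have "(cmod (x - m))\<^sup>2 = (cmod x)\<^sup>2 - 2 * Re (cnj m * x) + (cmod m)\<^sup>2"
      by (simp only: cmod_power2 power2_diff complex_mult_cnj minus_complex.sel times_complex.sel cnj.sel) (simp add: algebra_simps power2_eq_square)
    moreover have "cnj m * x = (cnj y * a * x) / of_real (\<kappa> + v)"
      by (simp add: m_def mult.commute mult.left_commute)
    then have "Re (cnj m * x) = t / (\<kappa> + v)" by (simp only: Re_divide_of_real t_def)
    moreover have "(cmod m)\<^sup>2 = \<kappa> * (cmod y)\<^sup>2 / (\<kappa> + v)\<^sup>2"
      by (simp add: m_def norm_divide norm_mult power_divide power_mult_distrib a del: of_real_add)
    ultimately have 2: "(cmod (x - m))\<^sup>2 = (cmod x)\<^sup>2 - 2 * t / (\<kappa> + v) + \<kappa> * (cmod y)\<^sup>2 / (\<kappa> + v)\<^sup>2" by simp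
    have "X + (Y - 2 * t + \<kappa> * X) / v - Y / (\<kappa> + v) = (X - 2 * t / (\<kappa> + v) + \<kappa> * Y / (\<kappa> + v)\<^sup>2) / (v / (\<kappa> + v))" for X Y :: real
    proof -
      define s where "s = \<kappa> + v"
      have \<kappa>: "\<kappa> = s - v" and "s \<noteq> 0" "v \<noteq> 0" using assms by (auto simp: s_def)
      then have "X + (Y - 2 * t + (s - v) * X) / v - Y / s = (X - 2 * t / s + (s - v) * Y / s\<^sup>2) / (v / s)"
        by (simp add: field_simps power2_eq_square)
      then show ?thesis by (simp only: s_def[symmetric] \<kappa>) (simp add: s_def[symmetric])
    qed
    then show ?thesis unfolding 1 2 .
  qed
  have pos: "v / (\<kappa> + v) > 0" using assms by simp
  have "gden 1 0 x * exp (iota \<kappa> v y (a * x)) = gden (v / (\<kappa> + v)) m x" for x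
  proof -
    have "gden 1 0 x * exp (iota \<kappa> v y (a * x)) =
        exp (- ((cmod x)\<^sup>2 + (cmod (y - a * x))\<^sup>2 / v - (cmod y)\<^sup>2 / (\<kappa> + v))) * ((\<kappa> + v) / v) / pi"
    proof -
      define X Y W where "X = (cmod x)\<^sup>2" and "Y = (cmod y)\<^sup>2 / (\<kappa> + v)" and "W = (cmod (y - a * x))\<^sup>2 / v"
      have "exp (iota \<kappa> v y (a * x)) = (\<kappa> + v) / v * exp (Y - W)"
        using assms by (simp add: iota_def Y_def W_def exp_add exp_diff)
      moreover have "gden 1 0 x = exp (- X) / pi" by (simp add: gden_def X_def)
      moreover have "exp (- (X + W - Y)) = exp (- X) * exp (Y - W)" by (simp flip: exp_add)
      ultimately show ?thesis by (simp add: X_def[symmetric] Y_def[symmetric] W_def[symmetric] mult_ac)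
    qed
    also have "\<dots> = gden (v / (\<kappa> + v)) m x"
    proof -
      have "E * ((\<kappa> + v) / v) / pi = E / (pi * (v / (\<kappa> + v)))" for E
        using assms by (simp add: field_simps)
      then show ?thesis unfolding square gden_def by (simp only: minus_divide_left)
    qed
    finally show ?thesis .
  qed
  then have "(\<integral>\<^sup>+x. ennreal (exp (iota \<kappa> v y (a * x))) \<partial>cgauss) = (\<integral>\<^sup>+x. ennreal (gden (v / (\<kappa> + v)) m x) \<partial>lborel)"
    by (subst nn_integral_cgauss) (simp_all add: gden_pos less_imp_le flip: ennreal_mult)
  then show ?thesis by (simp add: nn_integral_gden pos)
qed

lemma linear_form_norm2:
  assumes "finite F" "F \<subseteq> J"
  shows "integrable (PiM J (\<lambda>_. cgauss)) (\<lambda>\<omega>. (cmod (\<Sum>j\<in>F. a j * \<omega> j))\<^sup>2)"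
    and "(\<integral>\<omega>. (cmod (\<Sum>j\<in>F. a j * \<omega> j))\<^sup>2 \<partial>PiM J (\<lambda>_. cgauss)) = (\<Sum>j\<in>F. (cmod (a j))\<^sup>2)"
proof -
  let ?P = "PiM J (\<lambda>_. cgauss)"
  interpret prob_space ?P by (rule prob_space_PiM_cgauss)
  define h where "h j k \<omega> = Re (a j * \<omega> j * cnj (a k * \<omega> k))" for j k and \<omega> :: "'a \<Rightarrow> complex"
  have sq: "(cmod (\<Sum>j\<in>F. a j * \<omega> j))\<^sup>2 = (\<Sum>j\<in>F. \<Sum>k\<in>F. h j k \<omega>)" for \<omega>
  proof -
    have "complex_of_real ((cmod (\<Sum>j\<in>F. a j * \<omega> j))\<^sup>2) = (\<Sum>j\<in>F. a j * \<omega> j) * cnj (\<Sum>j\<in>F. a j * \<omega> j)"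
      by (rule complex_norm_square)
    also have "\<dots> = (\<Sum>j\<in>F. \<Sum>k\<in>F. a j * \<omega> j * cnj (a k * \<omega> k))"
      by (simp add: sum_product)
    finally have "Re (complex_of_real ((cmod (\<Sum>j\<in>F. a j * \<omega> j))\<^sup>2)) = Re (\<Sum>j\<in>F. \<Sum>k\<in>F. a j * \<omega> j * cnj (a k * \<omega> k))"
      by (rule arg_cong)
    then show ?thesis by (simp add: h_def)
  qed
  have hb: "has_bochner_integral ?P (h j k) (if j = k then (cmod (a j))\<^sup>2 else 0)" if jk: "j \<in> F" "k \<in> F" for j k
  proof (cases "j = k")
    case True
    have "has_bochner_integral ?P (\<lambda>\<omega>. (cmod (\<omega> j))\<^sup>2) 1"
      using integrable_PiM_cgauss_norm2[of j J 0] assms jk by (auto simp: has_bochner_integral_iff)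
    from has_bochner_integral_mult_right[OF this, of "(cmod (a j))\<^sup>2"]
    have "has_bochner_integral ?P (\<lambda>\<omega>. (cmod (a j))\<^sup>2 * (cmod (\<omega> j))\<^sup>2) ((cmod (a j))\<^sup>2)" by simp
    moreover have "h j j = (\<lambda>\<omega>. (cmod (a j))\<^sup>2 * (cmod (\<omega> j))\<^sup>2)"
    proof
      fix \<omega>
      have "a j * \<omega> j * cnj (a j * \<omega> j) = complex_of_real ((cmod (a j * \<omega> j))\<^sup>2)" by (rule complex_norm_square[symmetric])
      then show "h j j \<omega> = (cmod (a j))\<^sup>2 * (cmod (\<omega> j))\<^sup>2" unfolding h_def by (simp only: Re_complex_of_real norm_mult power_mult_distrib)
    qed
    ultimately show ?thesis using True by simp
  next
    case False
    define X where "X i \<omega> = (if i = j then a j * \<omega> i else cnj (a k * \<omega> i))" for i and \<omega> :: "'a \<Rightarrow> complex"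
    have "indep_vars (\<lambda>_. cgauss) (\<lambda>i \<omega>. \<omega> i) J"
      by (intro indep_vars_PiM_coordinates prob_space_cgauss)
    moreover have "{j, k} \<subseteq> J" using jk assms by auto
    ultimately have "indep_vars (\<lambda>_. cgauss) (\<lambda>i \<omega>. \<omega> i) {j, k}"
      by (rule indep_vars_subset)
    then have ind: "indep_vars (\<lambda>_. borel) X {j, k}"
      unfolding X_def[abs_def]
    proof (rule indep_vars_compose2)
      fix i
      have "(\<lambda>x. if i = j then a j * x else cnj (a k * x)) \<in> borel_measurable borel"
        by (intro borel_measurable_continuous_onI, cases "i = j") (auto intro!: continuous_intros)
      then show "(\<lambda>x. if i = j then a j * x else cnj (a k * x)) \<in> borel_measurable cgauss"
        by (simp only: measurable_cong_sets[OF sets_cgauss refl])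
    qed
    have cid: "integrable ?P (\<lambda>\<omega>. \<omega> i)" "(\<integral>\<omega>. \<omega> i \<partial>?P) = 0" if "i \<in> {j, k}" for i
      using that jk assms integrable_PiM_cgauss_component[of i J "\<lambda>x. x"] integral_PiM_cgauss_component[of i J "\<lambda>x. x"]
      by (auto simp: cgauss_integrable_id cgauss_integral_id)
    have int: "integrable ?P (X i)" if "i \<in> {j, k}" for i
      using cid[OF that] that by (cases "i = j") (simp_all add: X_def[abs_def])
    have "expectation (X j) = 0" using cid[of j] by (simp add: X_def[abs_def])
    with indep_vars_lebesgue_integral[OF _ ind int] indep_vars_integrable[OF _ ind int] False
    have "integrable ?P (\<lambda>\<omega>. X j \<omega> * X k \<omega>)" "expectation (\<lambda>\<omega>. X j \<omega> * X k \<omega>) = 0"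
      by simp_all
    then have "integrable ?P (\<lambda>\<omega>. Re (X j \<omega> * X k \<omega>))" "expectation (\<lambda>\<omega>. Re (X j \<omega> * X k \<omega>)) = 0"
      using integral_Re by (auto simp del: times_complex.sel)
    moreover have "h j k = (\<lambda>\<omega>. Re (X j \<omega> * X k \<omega>))"
      using False by (auto simp: h_def X_def simp del: times_complex.sel)
    ultimately show ?thesis using False by (simp add: has_bochner_integral_iff)
  qed
  have "has_bochner_integral ?P (\<lambda>\<omega>. \<Sum>j\<in>F. \<Sum>k\<in>F. h j k \<omega>) (\<Sum>j\<in>F. \<Sum>k\<in>F. if j = k then (cmod (a j))\<^sup>2 else 0)"
    by (intro has_bochner_integral_sum hb)
  then show "integrable ?P (\<lambda>\<omega>. (cmod (\<Sum>j\<in>F. a j * \<omega> j))\<^sup>2)"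
    "(\<integral>\<omega>. (cmod (\<Sum>j\<in>F. a j * \<omega> j))\<^sup>2 \<partial>?P) = (\<Sum>j\<in>F. (cmod (a j))\<^sup>2)"
    unfolding sq using assms by (auto simp: has_bochner_integral_iff)
qed

definition moment4 :: real where "moment4 = (\<integral>z. (cmod z) ^ 4 \<partial>cgauss)"

lemma moment4_nonneg: "moment4 \<ge> 0"
  by (simp add: moment4_def)

text \<open>Cauchy-Schwarz twice. The bound is crude but proportional to the squared variance, so
  dividing by the variance makes it independent of SNR and power.\<close>

lemma linear_form_norm4:
  assumes "finite F" "F \<subseteq> J"
  shows "integrable (PiM J (\<lambda>_. cgauss)) (\<lambda>\<omega>. (cmod (\<Sum>j\<in>F. a j * \<omega> j)) ^ 4)"
    and "(\<integral>\<omega>. (cmod (\<Sum>j\<in>F. a j * \<omega> j)) ^ 4 \<partial>PiM J (\<lambda>_. cgauss)) \<le> (\<Sum>j\<in>F. (cmod (a j))\<^sup>2)\<^sup>2 * (real (card F))\<^sup>2 * moment4"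
proof -
  let ?P = "PiM J (\<lambda>_. cgauss)"
  define A where "A = (\<Sum>j\<in>F. (cmod (a j))\<^sup>2)"
  have bound: "(cmod (\<Sum>j\<in>F. a j * \<omega> j)) ^ 4 \<le> A\<^sup>2 * real (card F) * (\<Sum>j\<in>F. (cmod (\<omega> j)) ^ 4)" for \<omega> :: "'a \<Rightarrow> complex"
  proof -
    have "cmod (\<Sum>j\<in>F. a j * \<omega> j) \<le> (\<Sum>j\<in>F. cmod (a j) * cmod (\<omega> j))"
      by (rule order_trans[OF norm_sum]) (simp add: norm_mult)
    then have "(cmod (\<Sum>j\<in>F. a j * \<omega> j))\<^sup>2 \<le> (\<Sum>j\<in>F. cmod (a j) * cmod (\<omega> j))\<^sup>2"
      by (intro power_mono) auto
    also have "\<dots> \<le> A * (\<Sum>j\<in>F. (cmod (\<omega> j))\<^sup>2)"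
      unfolding A_def by (rule Cauchy_Schwarz_ineq_sum)
    finally have "((cmod (\<Sum>j\<in>F. a j * \<omega> j))\<^sup>2)\<^sup>2 \<le> (A * (\<Sum>j\<in>F. (cmod (\<omega> j))\<^sup>2))\<^sup>2"
      by (intro power_mono) auto
    also have "\<dots> = A\<^sup>2 * (\<Sum>j\<in>F. 1 * (cmod (\<omega> j))\<^sup>2)\<^sup>2" by (simp add: power_mult_distrib)
    also have "\<dots> \<le> A\<^sup>2 * ((\<Sum>j\<in>F. 1\<^sup>2) * (\<Sum>j\<in>F. ((cmod (\<omega> j))\<^sup>2)\<^sup>2))"
      by (intro mult_left_mono Cauchy_Schwarz_ineq_sum) auto
    finally show ?thesis by (simp add: mult.assoc)
  qed
  have i4: "integrable ?P (\<lambda>\<omega>. (cmod (\<omega> j)) ^ 4)" "(\<integral>\<omega>. (cmod (\<omega> j)) ^ 4 \<partial>?P) = moment4" if "j \<in> F" for j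
    using that assms integrable_PiM_cgauss_component[of j J "\<lambda>z. (cmod z) ^ 4"]
      integral_PiM_cgauss_component[of j J "\<lambda>z. (cmod z) ^ 4"] by (auto simp: cgauss_integrable_norm4 moment4_def)
  have ib: "integrable ?P (\<lambda>\<omega>. A\<^sup>2 * real (card F) * (\<Sum>j\<in>F. (cmod (\<omega> j)) ^ 4))"
    using i4 by auto
  have meas: "(\<lambda>\<omega>. (cmod (\<Sum>j\<in>F. a j * \<omega> j)) ^ 4) \<in> borel_measurable ?P"
    using assms by (intro borel_measurable_power measurable_compose[OF _ borel_measurable_norm]
        borel_measurable_sum borel_measurable_times PiM_cgauss_component_measurable) auto
  show int: "integrable ?P (\<lambda>\<omega>. (cmod (\<Sum>j\<in>F. a j * \<omega> j)) ^ 4)"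
    by (rule Bochner_Integration.integrable_bound[OF ib meas]) (use bound in \<open>auto intro: order_trans[OF _ abs_ge_self]\<close>)
  have "(\<integral>\<omega>. (cmod (\<Sum>j\<in>F. a j * \<omega> j)) ^ 4 \<partial>?P) \<le> (\<integral>\<omega>. A\<^sup>2 * real (card F) * (\<Sum>j\<in>F. (cmod (\<omega> j)) ^ 4) \<partial>?P)"
    by (intro integral_mono int ib bound)
  also have "\<dots> = A\<^sup>2 * real (card F) * (\<Sum>j\<in>F. moment4)"
    using i4 by (simp add: Bochner_Integration.integral_sum)
  finally show "(\<integral>\<omega>. (cmod (\<Sum>j\<in>F. a j * \<omega> j)) ^ 4 \<partial>?P) \<le> A\<^sup>2 * (real (card F))\<^sup>2 * moment4"
    by (simp add: power2_eq_square mult.assoc)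
qed

section \<open>Random Gaussian codes\<close>

lemma cis_measurable [measurable]: "cis \<in> borel_measurable borel"
  by (intro borel_measurable_continuous_onI continuous_on_cis continuous_on_id)

text \<open>The margin \<open>P < 1\<close> makes a random codebook meet the power constraint with
  high probability; \<open>\<gamma>\<close> holds the decoding thresholds.\<close>

locale gaussian_code = paired_states +
  fixes N :: nat and M :: "nat \<Rightarrow> nat" and P :: real and \<gamma> :: "nat \<Rightarrow> real"
  assumes P: "0 < P" "P < 1" and M1: "\<And>k. k < K \<Longrightarrow> M k \<ge> 1"
begin

definition \<kappa> :: real where "\<kappa> = SNR * P"

definition J :: "(nat \<times> nat \<times> nat \<times> nat) set" where
  "J = (SIGMA t:{..<K}. {..<M t} \<times> ({..<N} \<times> {..<L}))"

abbreviation "I \<equiv> {..<N} \<times> {..<L}"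
abbreviation "CB \<equiv> PiM J (\<lambda>_. cgauss)"
abbreviation "PS \<equiv> phase_space N L K"
abbreviation "NS \<equiv> noise_space N L K"

text \<open>Interference is treated as additional noise, with the received signal power
  \<open>\<kappa>\<close>.\<close>

definition nv :: "nat \<Rightarrow> nat \<Rightarrow> real" where
  "nv r l = (if r \<in> D l then 1 + \<kappa> else 1)"

definition codeword :: "(nat \<times> nat \<times> nat \<times> nat \<Rightarrow> complex) \<Rightarrow> nat \<Rightarrow> nat \<Rightarrow> nat \<times> nat \<Rightarrow> complex" where
  "codeword c t a i = complex_of_real (sqrt P) * c (t, a, i)"

definition Y :: "(nat \<times> nat \<times> nat \<times> nat \<Rightarrow> complex) \<Rightarrow> (nat \<Rightarrow> nat) \<Rightarrow> phases \<Rightarrow> noises \<Rightarrow> nat \<Rightarrow> nat \<times> nat \<Rightarrow> complex" where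
  "Y c w \<Phi> Z r i = sig \<Phi> r r i (codeword c r (w r) i) +
    (if r \<in> D (snd i) then sig \<Phi> r (\<tau> (snd i) r) i (codeword c (\<tau> (snd i) r) (w (\<tau> (snd i) r)) i) else 0) + Z (fst i, snd i, r)"

definition info_density :: "nat \<Rightarrow> (nat \<times> nat \<times> nat \<times> nat \<Rightarrow> complex) \<Rightarrow> nat \<Rightarrow> phases \<Rightarrow> (nat \<times> nat \<Rightarrow> complex) \<Rightarrow> real" where
  "info_density r c a \<Phi> y = (\<Sum>i\<in>I. iota \<kappa> (nv r (snd i)) (y i) (sig \<Phi> r r i (codeword c r a i)))"

definition enc :: "(nat \<times> nat \<times> nat \<times> nat \<Rightarrow> complex) \<Rightarrow> nat \<Rightarrow> nat \<Rightarrow> nat \<Rightarrow> phases \<Rightarrow> nat \<Rightarrow> complex" where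
  "enc c t a n \<Phi> l = codeword c t a (n, l)"

text \<open>Threshold decoding. If no message passes, the value of \<open>LEAST\<close> is
  unspecified; that case is covered by the event that the sent word misses the threshold.\<close>

definition dec :: "(nat \<times> nat \<times> nat \<times> nat \<Rightarrow> complex) \<Rightarrow> nat \<Rightarrow> phases \<Rightarrow> (nat \<Rightarrow> nat \<Rightarrow> complex) \<Rightarrow> nat" where
  "dec c r \<Phi> y = (LEAST a. a < M r \<and> \<gamma> r < info_density r c a \<Phi> (\<lambda>i. y (fst i) (snd i)))"

text \<open>Mutual information per channel use, in nats, with Gaussian inputs and interference
  treated as noise.\<close>

definition Irate :: "nat \<Rightarrow> real" where
  "Irate r = (\<Sum>l<L. ln ((\<kappa> + nv r l) / nv r l))"

lemma \<kappa>_pos: "\<kappa> > 0" using SNR P by (simp add: \<kappa>_def)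

lemma nv_pos: "nv r l > 0" using \<kappa>_pos by (simp add: nv_def)

lemma finite_J: "finite J" by (simp add: J_def)

lemma dec_recv:
  assumes "r < K"
  shows "dec c r \<Phi> (recv As K N (\<lambda>t n l. enc c t (w t) n \<Phi> l) \<Phi> Z r) =
    (LEAST a. a < M r \<and> \<gamma> r < info_density r c a \<Phi> (Y c w \<Phi> Z r))"
proof -
  have "info_density r c a \<Phi> (\<lambda>i. recv As K N (\<lambda>t n l. enc c t (w t) n \<Phi> l) \<Phi> Z r (fst i) (snd i)) = info_density r c a \<Phi> (Y c w \<Phi> Z r)" for a
    unfolding info_density_def recv_eq[OF assms] by (intro sum.cong refl) (auto simp: Y_def enc_def)
  then show ?thesis by (simp add: dec_def)
qed

lemma sig_measurable:
  assumes "(\<lambda>x. f x (fst i, snd i, r, t)) \<in> borel_measurable X" and [measurable]: "g \<in> borel_measurable X"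
  shows "(\<lambda>x. sig (f x) r t i (g x)) \<in> borel_measurable X"
  using measurable_compose[OF assms(1) cis_measurable] unfolding sig_def by measurable

text \<open>Codebook, phases and noise enter as measurable maps from an arbitrary space, so that
  each of them may be random or held fixed.\<close>

context
  fixes X :: "'x measure" and Cc Ph Zz
  assumes Cc: "Cc \<in> X \<rightarrow>\<^sub>M CB" and Ph: "Ph \<in> X \<rightarrow>\<^sub>M PS" and Zz: "Zz \<in> X \<rightarrow>\<^sub>M NS"
begin

lemma sig_codeword_measurable:
  assumes "r < K" "t < K" "a < M t" "i \<in> I"
  shows "(\<lambda>x. sig (Ph x) r t i (codeword (Cc x) t a i)) \<in> borel_measurable X"
proof (rule sig_measurable)
  show "(\<lambda>x. Ph x (fst i, snd i, r, t)) \<in> borel_measurable X"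
  proof -
    have "(\<lambda>\<Phi>. \<Phi> (fst i, snd i, r, t)) \<in> PS \<rightarrow>\<^sub>M phase_meas"
      unfolding phase_space_def using assms by (intro measurable_component_singleton) auto
    then have "(\<lambda>\<Phi>. \<Phi> (fst i, snd i, r, t)) \<in> borel_measurable PS"
      by (simp add: phase_meas_def measurable_cong_sets[OF refl sets_uniform_measure])
    from measurable_compose[OF Ph this] show ?thesis .
  qed
  have "(t, a, i) \<in> J" using assms by (auto simp: J_def)
  from measurable_compose[OF Cc PiM_cgauss_component_measurable[OF this]]
  show "(\<lambda>x. codeword (Cc x) t a i) \<in> borel_measurable X"
    unfolding codeword_def by measurable
qed

lemma Y_measurable:
  assumes "r < K" "w \<in> msgs K M" "i \<in> I"
  shows "(\<lambda>x. Y (Cc x) w (Ph x) (Zz x) r i) \<in> borel_measurable X"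
proof -
  have w: "w t < M t" if "t < K" for t using assms that by (auto simp: msgs_def)
  have "(\<lambda>Z. Z (fst i, snd i, r)) \<in> borel_measurable NS"
    unfolding noise_space_def using assms by (intro PiM_cgauss_component_measurable) auto
  note Z = measurable_compose[OF Zz this]
  have "(\<lambda>x. if r \<in> D (snd i) then sig (Ph x) r (\<tau> (snd i) r) i (codeword (Cc x) (\<tau> (snd i) r) (w (\<tau> (snd i) r)) i) else 0) \<in> borel_measurable X"
    using sig_codeword_measurable[of r "\<tau> (snd i) r"] \<tau>_props[of "snd i" r] assms w by (cases "r \<in> D (snd i)") auto
  then show ?thesis
    unfolding Y_def using Z sig_codeword_measurable[of r r "w r" i] w assms by (intro borel_measurable_add) auto
qed

lemma info_density_measurable:
  assumes "r < K" "w \<in> msgs K M" "a < M r"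
  shows "(\<lambda>x. info_density r (Cc x) a (Ph x) (Y (Cc x) w (Ph x) (Zz x) r)) \<in> borel_measurable X"
  unfolding info_density_def using assms
  by (intro borel_measurable_sum iota_measurable Y_measurable sig_codeword_measurable) auto

end

text \<open>Given everything but the word of message \<open>a\<close>, the output is determined,
  since \<open>a\<close> was not sent. Its symbols are fresh independent Gaussians, and the integral
  is a product of copies of \<open>nn_integral_exp_iota\<close>.\<close>

lemma wrong_word:
  assumes r: "r < K" and w: "w \<in> msgs K M" and a: "a < M r" "a \<noteq> w r" and \<Phi>: "\<Phi> \<in> space PS" and Z: "Z \<in> space NS"
  shows "(\<integral>\<^sup>+c. ennreal (exp (info_density r c a \<Phi> (Y c w \<Phi> Z r))) \<partial>CB) = 1"
proof -
  interpret product_sigma_finite "\<lambda>_ :: nat \<times> nat \<times> nat \<times> nat. cgauss"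
    by (intro product_sigma_finite_const prob_space_imp_sigma_finite prob_space_cgauss)
  define J1 where "J1 = (\<lambda>i. (r, a, i)) ` I"
  define J2 where "J2 = J - J1"
  have J1: "J1 \<subseteq> J" using r a by (auto simp: J1_def J_def)
  have J12: "J2 \<union> J1 = J" "J2 \<inter> J1 = {}" using J1 by (auto simp: J2_def)
  have fin: "finite J1" "finite J2" using finite_J by (auto simp: J1_def J2_def)
  let ?F = "\<lambda>c. ennreal (exp (info_density r c a \<Phi> (Y c w \<Phi> Z r)))"
  have meas: "?F \<in> borel_measurable CB"
  proof -
    have "(\<lambda>c. info_density r c a \<Phi> (Y c w \<Phi> Z r)) \<in> borel_measurable CB"
      using \<Phi> Z r w a by (intro info_density_measurable) auto
    then show ?thesis by measurable
  qed
  have coef: "(cmod (sig \<Phi> r r i (complex_of_real (sqrt P))))\<^sup>2 = \<kappa>" for i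
    using SNR P by (simp add: sig_def norm_mult power_mult_distrib \<kappa>_def)
  have lin: "sig \<Phi> r r i (codeword c r a i) = sig \<Phi> r r i (complex_of_real (sqrt P)) * c (r, a, i)" for c i
    by (simp add: sig_def codeword_def)
  have inner: "(\<integral>\<^sup>+y. ?F (merge J2 J1 (x, y)) \<partial>PiM J1 (\<lambda>_. cgauss)) = 1" for x
  proof -
    \<comment> \<open>The argument \<open>undefined\<close> fills the part \<open>J1\<close> of the
      codebook, which \<open>Y\<close> does not read.\<close>
    define h where "h j z = ennreal (exp (case j of (_, _, i) \<Rightarrow>
        iota \<kappa> (nv r (snd i)) (Y (merge J2 J1 (x, undefined)) w \<Phi> Z r i) (sig \<Phi> r r i (complex_of_real (sqrt P)) * z)))" for j :: "nat \<times> nat \<times> nat \<times> nat" and z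
    have Ym: "Y (merge J2 J1 (x, y)) w \<Phi> Z r i = Y (merge J2 J1 (x, undefined)) w \<Phi> Z r i" if "i \<in> I" for i y
    proof -
      have "(t, w t, i) \<notin> J1" for t using a by (auto simp: J1_def)
      then show ?thesis by (simp add: Y_def codeword_def merge_def)
    qed
    have "?F (merge J2 J1 (x, y)) = (\<Prod>j\<in>J1. h j (y j))" for y
    proof -
      have "?F (merge J2 J1 (x, y)) = (\<Prod>i\<in>I. ennreal (exp (iota \<kappa> (nv r (snd i)) (Y (merge J2 J1 (x, y)) w \<Phi> Z r i) (sig \<Phi> r r i (codeword (merge J2 J1 (x, y)) r a i)))))"
        by (simp add: info_density_def exp_sum prod_ennreal)
      also have "\<dots> = (\<Prod>i\<in>I. h (r, a, i) (y (r, a, i)))"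
      proof (intro prod.cong refl)
        fix i assume i: "i \<in> I"
        then have "merge J2 J1 (x, y) (r, a, i) = y (r, a, i)"
          by (simp add: merge_def J2_def J1_def)
        then show "ennreal (exp (iota \<kappa> (nv r (snd i)) (Y (merge J2 J1 (x, y)) w \<Phi> Z r i) (sig \<Phi> r r i (codeword (merge J2 J1 (x, y)) r a i)))) = h (r, a, i) (y (r, a, i))"
          unfolding lin Ym[OF i, of y] h_def by simp
      qed
      also have "\<dots> = (\<Prod>j\<in>J1. h j (y j))"
        unfolding J1_def by (subst prod.reindex) (auto simp: inj_on_def)
      finally show ?thesis .
    qed
    then have "(\<integral>\<^sup>+y. ?F (merge J2 J1 (x, y)) \<partial>PiM J1 (\<lambda>_. cgauss)) = (\<integral>\<^sup>+y. (\<Prod>j\<in>J1. h j (y j)) \<partial>PiM J1 (\<lambda>_. cgauss))"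
      by simp
    also have "\<dots> = (\<Prod>j\<in>J1. \<integral>\<^sup>+z. h j z \<partial>cgauss)"
      using fin by (intro product_nn_integral_prod) (auto simp: h_def split_beta')
    also have "\<dots> = 1"
      unfolding h_def split_beta' by (intro prod.neutral ballI nn_integral_exp_iota coef nv_pos \<kappa>_pos)
    finally show ?thesis .
  qed
  interpret J2: prob_space "PiM J2 (\<lambda>_. cgauss)" by (rule prob_space_PiM_cgauss)
  have "(\<integral>\<^sup>+c. ?F c \<partial>CB) = (\<integral>\<^sup>+x. (\<integral>\<^sup>+y. ?F (merge J2 J1 (x, y)) \<partial>PiM J1 (\<lambda>_. cgauss)) \<partial>PiM J2 (\<lambda>_. cgauss))"
    using product_nn_integral_fold[of J2 J1 ?F] J12 fin meas by simp
  then show ?thesis unfolding inner by (simp add: J2.emeasure_space_1)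
qed

text \<open>The information density differs from \<open>real N * Irate r\<close> by a sum of centred
  terms \<open>U i\<close>, each quadratic in at most three Gaussians, with disjoint blocks for
  distinct \<open>i\<close>. Chebyshev applies; the constant is 18 = 2 * 3^2, from two normalised
  fourth moments of forms in at most three variables.\<close>

lemma true_word:
  assumes r: "r < K" and w: "w \<in> msgs K M" and \<Phi>: "\<Phi> \<in> space PS" and \<gamma>: "\<gamma> r < real N * Irate r"
  shows "emeasure (CB \<Otimes>\<^sub>M NS) {x \<in> space (CB \<Otimes>\<^sub>M NS). info_density r (fst x) (w r) \<Phi> (Y (fst x) w \<Phi> (snd x) r) \<le> \<gamma> r}
    \<le> ennreal (real N * real L * (18 * moment4) / (real N * Irate r - \<gamma> r)\<^sup>2)"
proof -
  define NI where "NI = {..<N} \<times> {..<L} \<times> {..<K}"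
  let ?\<Omega> = "PiM (J <+> NI) (\<lambda>_. cgauss)"
  interpret \<Omega>: prob_space ?\<Omega> by (rule prob_space_PiM_cgauss)
  have NS: "NS = PiM NI (\<lambda>_. cgauss)" by (simp add: noise_space_def NI_def)
  define T where "T = (\<lambda>(x, y). \<lambda>j\<in>J <+> NI. case_sum x y j :: complex)"
  have cs: "case_sum (\<lambda>_. cgauss) (\<lambda>_. cgauss) = (\<lambda>_. cgauss)" by (auto split: sum.split)
  have distr: "distr (CB \<Otimes>\<^sub>M NS) ?\<Omega> T = ?\<Omega>"
    using distr_PiM_Plus[of J NI "\<lambda>_. cgauss" "\<lambda>_. cgauss"] finite_J
    unfolding NS T_def cs by (simp add: NI_def prob_space_cgauss)
  have Tm: "T \<in> CB \<Otimes>\<^sub>M NS \<rightarrow>\<^sub>M ?\<Omega>"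
    unfolding T_def split_beta'
  proof (rule measurable_restrict)
    fix j assume "j \<in> J <+> NI"
    then show "(\<lambda>x. case_sum (fst x) (snd x) j) \<in> CB \<Otimes>\<^sub>M NS \<rightarrow>\<^sub>M cgauss"
      by (cases j) (auto simp: NS)
  qed
  define b :: "nat \<times> nat \<Rightarrow> (nat \<times> nat \<times> nat \<times> nat) + (nat \<times> nat \<times> nat)" where "b i = Inl (r, w r, i)" for i
  \<comment> \<open>The variables of the effective noise, namely thermal noise and possibly one
    interfering symbol. Adding the own symbol \<open>b i\<close> gives \<open>F i\<close>, the
    variables of the whole output.\<close>
  define F' where "F' i = (if r \<in> D (snd i) then {Inl (\<tau> (snd i) r, w (\<tau> (snd i) r), i)} else {}) \<union> {Inr (fst i, snd i, r)}" for i :: "nat \<times> nat"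
  define F where "F i = insert (b i) (F' i)" for i
  define coef where "coef i j = (case j of Inl (t, _) \<Rightarrow> sig \<Phi> r t i (complex_of_real (sqrt P)) | Inr _ \<Rightarrow> 1)"
    for i and j :: "(nat \<times> nat \<times> nat \<times> nat) + (nat \<times> nat \<times> nat)"
  define v where "v i = nv r (snd i)" for i :: "nat \<times> nat"
  have v: "v i > 0" for i by (simp add: v_def nv_pos)
  define U where "U i \<omega> = (cmod (\<Sum>j\<in>F i. coef i j * \<omega> j))\<^sup>2 / (\<kappa> + v i) - (cmod (\<Sum>j\<in>F' i. coef i j * \<omega> j))\<^sup>2 / v i" for i and \<omega> :: "_ \<Rightarrow> complex"
  have w_less: "w t < M t" if "t < K" for t using w that by (auto simp: msgs_def)
  have bF': "b i \<notin> F' i" if "i \<in> I" for i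
    using that \<tau>_props[of "snd i" r] by (auto simp: b_def F'_def)
  have Fsub: "F i \<subseteq> J <+> NI" "F' i \<subseteq> J <+> NI" if "i \<in> I" for i
    using that r w_less \<tau>_props[of "snd i" r] by (auto simp: b_def F_def F'_def J_def NI_def)
  have finF: "finite (F i)" "finite (F' i)" for i by (auto simp: F_def F'_def)
  have cardF: "card (F i) \<le> 3" "card (F' i) \<le> 3" for i
    by (auto simp: F_def F'_def card_insert_if)
  have coefl: "(cmod (coef i (Inl (t, z))))\<^sup>2 = \<kappa>" for i t z
    using SNR P by (simp add: coef_def sig_def norm_mult power_mult_distrib \<kappa>_def)
  have sumF': "(\<Sum>j\<in>F' i. (cmod (coef i j))\<^sup>2) = v i" for i
    using coefl by (simp add: F'_def v_def nv_def) (simp add: coef_def)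
  have sumF: "(\<Sum>j\<in>F i. (cmod (coef i j))\<^sup>2) = \<kappa> + v i" if "i \<in> I" for i
    using bF'[OF that] finF by (simp add: F_def sumF') (simp add: b_def coefl)
  have disj: "disjoint_family_on F I"
    by (auto simp: disjoint_family_on_def F_def F'_def b_def split: if_splits)
  have U_restrict: "U i (restrict \<omega> (F i)) = U i \<omega>" for i \<omega>
  proof -
    have "(\<Sum>j\<in>F' i. coef i j * restrict \<omega> (F i) j) = (\<Sum>j\<in>F' i. coef i j * \<omega> j)"
      by (intro sum.cong) (auto simp: F_def)
    then show ?thesis by (simp add: U_def)
  qed
  have lf_meas: "(\<lambda>\<omega>. (cmod (\<Sum>j\<in>G. coef i j * \<omega> j))\<^sup>2) \<in> borel_measurable (PiM H (\<lambda>_. cgauss))" if "G \<subseteq> H" for G H i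
    using that by (intro borel_measurable_power measurable_compose[OF _ borel_measurable_norm]
        borel_measurable_sum borel_measurable_times PiM_cgauss_component_measurable) auto
  have U_meas: "U i \<in> borel_measurable (PiM H (\<lambda>_. cgauss))" if "F i \<subseteq> H" for i H
    unfolding U_def[abs_def] using that
    by (intro borel_measurable_diff borel_measurable_divide lf_meas) (auto simp: F_def)
  have U_mean: "(\<integral>\<omega>. U i \<omega> \<partial>?\<Omega>) = 0" if i: "i \<in> I" for i
  proof -
    have "(\<integral>\<omega>. U i \<omega> \<partial>?\<Omega>) = (\<kappa> + v i) / (\<kappa> + v i) - v i / v i"
      unfolding U_def using linear_form_norm2[OF finF(1) Fsub(1)[OF i], of "coef i"]
        linear_form_norm2[OF finF(2) Fsub(2)[OF i], of "coef i"]
      by (simp add: sumF[OF i] sumF')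
    then show ?thesis using v[of i] \<kappa>_pos by simp
  qed
  define W where "W i \<omega> = (cmod (\<Sum>j\<in>F i. coef i j * \<omega> j)) ^ 4 / (\<kappa> + v i)\<^sup>2 + (cmod (\<Sum>j\<in>F' i. coef i j * \<omega> j)) ^ 4 / (v i)\<^sup>2" for i and \<omega> :: "_ \<Rightarrow> complex"
  have U2: "(U i \<omega>)\<^sup>2 \<le> W i \<omega>" for i \<omega>
  proof -
    have "(x - y)\<^sup>2 \<le> x\<^sup>2 + y\<^sup>2" if "x \<ge> 0" "y \<ge> 0" for x y :: real
      using that by (simp add: power2_diff)
    from this[of "(cmod (\<Sum>j\<in>F i. coef i j * \<omega> j))\<^sup>2 / (\<kappa> + v i)" "(cmod (\<Sum>j\<in>F' i. coef i j * \<omega> j))\<^sup>2 / v i"]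
    show ?thesis using v[of i] \<kappa>_pos by (simp add: U_def W_def power_divide)
  qed
  have W_int: "integrable ?\<Omega> (W i)" if i: "i \<in> I" for i
    unfolding W_def[abs_def] using linear_form_norm4(1)[OF finF(1) Fsub(1)[OF i], of "coef i"]
        linear_form_norm4(1)[OF finF(2) Fsub(2)[OF i], of "coef i"] by simp
  have W_le: "(\<integral>\<omega>. W i \<omega> \<partial>?\<Omega>) \<le> 18 * moment4" if i: "i \<in> I" for i
  proof -
    have q: "X / A\<^sup>2 \<le> 9 * moment4" if "X \<le> A\<^sup>2 * (real n)\<^sup>2 * moment4" "A > 0" "n \<le> 3" for X A :: real and n :: nat
    proof -
      have "(real n)\<^sup>2 \<le> 3\<^sup>2" using that by (intro power_mono) auto
      then have "A\<^sup>2 * (real n)\<^sup>2 * moment4 \<le> A\<^sup>2 * 9 * moment4"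
        using moment4_nonneg by (intro mult_right_mono mult_left_mono) auto
      then have "X \<le> A\<^sup>2 * 9 * moment4" using that by linarith
      then show ?thesis using that by (simp add: divide_le_eq mult_ac)
    qed
    have "(\<integral>\<omega>. W i \<omega> \<partial>?\<Omega>) = (\<integral>\<omega>. (cmod (\<Sum>j\<in>F i. coef i j * \<omega> j)) ^ 4 \<partial>?\<Omega>) / (\<kappa> + v i)\<^sup>2 + (\<integral>\<omega>. (cmod (\<Sum>j\<in>F' i. coef i j * \<omega> j)) ^ 4 \<partial>?\<Omega>) / (v i)\<^sup>2"
      unfolding W_def using linear_form_norm4(1)[OF finF(1) Fsub(1)[OF i], of "coef i"]
        linear_form_norm4(1)[OF finF(2) Fsub(2)[OF i], of "coef i"] by simp
    also have "\<dots> \<le> 9 * moment4 + 9 * moment4"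
      using v[of i] \<kappa>_pos
      by (intro add_mono q[OF linear_form_norm4(2)[OF finF(1) Fsub(1)[OF i], of "coef i", unfolded sumF[OF i]]]
          q[OF linear_form_norm4(2)[OF finF(2) Fsub(2)[OF i], of "coef i", unfolded sumF']] cardF) auto
    finally show ?thesis by simp
  qed
  have U2_int: "integrable ?\<Omega> (\<lambda>\<omega>. (U i \<omega>)\<^sup>2)" if i: "i \<in> I" for i
    using U2[of i] U_meas[OF Fsub(1)[OF i]]
    by (intro Bochner_Integration.integrable_bound[OF W_int[OF i]]) (auto intro: order_trans[OF _ abs_ge_self])
  have U2_le: "(\<integral>\<omega>. (U i \<omega>)\<^sup>2 \<partial>?\<Omega>) \<le> 18 * moment4" if i: "i \<in> I" for i
    using integral_mono[OF U2_int[OF i] W_int[OF i] U2] W_le[OF i] by linarith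
  define g where "g = real N * Irate r - \<gamma> r"
  have g: "g > 0" using \<gamma> by (simp add: g_def)
  have "measure ?\<Omega> {\<omega> \<in> space ?\<Omega>. g \<le> \<bar>\<Sum>i\<in>I. U i (restrict \<omega> (F i))\<bar>} \<le> real (card I) * (18 * moment4) / g\<^sup>2"
    by (rule Chebyshev_sum_blocks[OF _ Fsub(1) disj], unfold U_restrict)
      (assumption | rule U2_int U2_le U_mean U_meas g order_refl finite_cartesian_product finite_lessThan)+
  then have bound: "emeasure ?\<Omega> {\<omega> \<in> space ?\<Omega>. g \<le> \<bar>\<Sum>i\<in>I. U i \<omega>\<bar>} \<le> ennreal (real N * real L * (18 * moment4) / g\<^sup>2)"
    by (simp add: U_restrict \<Omega>.emeasure_eq_measure ennreal_leI)
  have E: "{\<omega> \<in> space ?\<Omega>. g \<le> \<bar>\<Sum>i\<in>I. U i \<omega>\<bar>} \<in> sets ?\<Omega>"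
  proof -
    have "(\<lambda>\<omega>. \<bar>\<Sum>i\<in>I. U i \<omega>\<bar>) \<in> borel_measurable ?\<Omega>"
      using U_meas Fsub by (intro borel_measurable_abs borel_measurable_sum) auto
    then show ?thesis by measurable
  qed
  have info_density_eq: "info_density r c (w r) \<Phi> (Y c w \<Phi> Z r) = real N * Irate r + (\<Sum>i\<in>I. U i (T (c, Z)))" for c Z
  proof -
    have "iota \<kappa> (v i) (Y c w \<Phi> Z r i) (sig \<Phi> r r i (codeword c r (w r) i)) = ln ((\<kappa> + v i) / v i) + U i (T (c, Z))" if i: "i \<in> I" for i
    proof -
      have val: "T (c, Z) j = case_sum c Z j" if "j \<in> F i" for j
        using Fsub(1)[OF i] that by (auto simp: T_def)
      have "(\<Sum>j\<in>F' i. coef i j * T (c, Z) j) = (\<Sum>j\<in>F' i. coef i j * case_sum c Z j)"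
        by (intro sum.cong) (auto simp: val F_def)
      also have "\<dots> = Y c w \<Phi> Z r i - sig \<Phi> r r i (codeword c r (w r) i)"
        by (auto simp: F'_def coef_def Y_def codeword_def sig_def)
      finally have 1: "(\<Sum>j\<in>F' i. coef i j * T (c, Z) j) = Y c w \<Phi> Z r i - sig \<Phi> r r i (codeword c r (w r) i)" .
      have "(\<Sum>j\<in>F i. coef i j * T (c, Z) j) = coef i (b i) * c (r, w r, i) + (\<Sum>j\<in>F' i. coef i j * T (c, Z) j)"
        using bF'[OF i] finF val[of "b i"] by (simp add: F_def) (simp add: b_def)
      also have "\<dots> = Y c w \<Phi> Z r i"
        unfolding 1 by (simp add: b_def coef_def sig_def codeword_def)
      finally have 2: "(\<Sum>j\<in>F i. coef i j * T (c, Z) j) = Y c w \<Phi> Z r i" .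
      show ?thesis unfolding U_def 1 2 iota_def by simp
    qed
    then have "info_density r c (w r) \<Phi> (Y c w \<Phi> Z r) = (\<Sum>i\<in>I. ln ((\<kappa> + v i) / v i)) + (\<Sum>i\<in>I. U i (T (c, Z)))"
      by (simp add: info_density_def v_def[symmetric] sum.distrib)
    moreover have "(\<Sum>i\<in>I. ln ((\<kappa> + v i) / v i)) = real N * Irate r"
      unfolding Irate_def v_def
      using sum.cartesian_product[of "\<lambda>n l. ln ((\<kappa> + nv r l) / nv r l)" "{..<L}" "{..<N}"] by (simp add: split_beta')
    ultimately show ?thesis by simp
  qed
  have "emeasure (CB \<Otimes>\<^sub>M NS) {x \<in> space (CB \<Otimes>\<^sub>M NS). info_density r (fst x) (w r) \<Phi> (Y (fst x) w \<Phi> (snd x) r) \<le> \<gamma> r}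
      \<le> emeasure (CB \<Otimes>\<^sub>M NS) (T -` {\<omega> \<in> space ?\<Omega>. g \<le> \<bar>\<Sum>i\<in>I. U i \<omega>\<bar>} \<inter> space (CB \<Otimes>\<^sub>M NS))"
  proof (rule emeasure_mono)
    show "{x \<in> space (CB \<Otimes>\<^sub>M NS). info_density r (fst x) (w r) \<Phi> (Y (fst x) w \<Phi> (snd x) r) \<le> \<gamma> r}
        \<subseteq> T -` {\<omega> \<in> space ?\<Omega>. g \<le> \<bar>\<Sum>i\<in>I. U i \<omega>\<bar>} \<inter> space (CB \<Otimes>\<^sub>M NS)"
      using measurable_space[OF Tm] by (auto simp: info_density_eq g_def)
    show "T -` {\<omega> \<in> space ?\<Omega>. g \<le> \<bar>\<Sum>i\<in>I. U i \<omega>\<bar>} \<inter> space (CB \<Otimes>\<^sub>M NS) \<in> sets (CB \<Otimes>\<^sub>M NS)"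
      by (rule measurable_sets[OF Tm E])
  qed
  also have "\<dots> = emeasure ?\<Omega> {\<omega> \<in> space ?\<Omega>. g \<le> \<bar>\<Sum>i\<in>I. U i \<omega>\<bar>}"
    by (subst (2) distr[symmetric], subst emeasure_distr[OF Tm E]) simp
  also note bound
  finally show ?thesis by (simp add: g_def)
qed

end


section \<open>Power, error events and averages over random codebooks\<close>

context gaussian_code
begin

text \<open>The constraint averages over messages, so it concerns only the total energy of a
  codebook on one subchannel, a sum of independent terms of mean \<open>P\<close>. In units of
  \<open>P\<close> a violation is an excess of \<open>1 / P - 1\<close> per term, and Chebyshev
  applies.\<close>

lemma power_violation:
  assumes t: "t < K" and l: "l < L" and N: "N \<ge> 1"
  shows "emeasure CB {c \<in> space CB. real N * real (M t) < (\<Sum>a<M t. \<Sum>n<N. (cmod (codeword c t a (n, l)))\<^sup>2)}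
    \<le> ennreal (moment4 / (real N * (1 / P - 1)\<^sup>2))"
proof -
  interpret prob_space CB by (rule prob_space_PiM_cgauss)
  define A where "A = {..<M t} \<times> {..<N}"
  define j where "j x = (t, fst x, snd x, l)" for x :: "nat \<times> nat"
  define T where "T x \<omega> = (cmod (\<omega> (j x)))\<^sup>2 - 1" for x and \<omega> :: "nat \<times> nat \<times> nat \<times> nat \<Rightarrow> complex"
  have jJ: "j x \<in> J" if "x \<in> A" for x using that t l by (auto simp: j_def J_def A_def)
  have restr: "T x (restrict \<omega> {j x}) = T x \<omega>" for x \<omega> by (simp add: T_def)
  have m: "M t \<ge> 1" using M1[OF t] .
  define g where "g = real N * real (M t) * (1 / P - 1)"
  have P': "1 / P - 1 > 0" using P by simp
  have g: "g > 0" using N m P' by (simp add: g_def)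
  have sq: "((cmod z)\<^sup>2 - 1)\<^sup>2 = (cmod z) ^ 4 - 2 * (cmod z)\<^sup>2 + 1" for z
    by (simp add: power2_diff)
  have int: "integrable CB (\<lambda>\<omega>. (T x \<omega>)\<^sup>2)" "(\<integral>\<omega>. (T x \<omega>)\<^sup>2 \<partial>CB) \<le> moment4" "(\<integral>\<omega>. T x \<omega> \<partial>CB) = 0"
    if x: "x \<in> A" for x
  proof -
    have i: "integrable cgauss (\<lambda>z. ((cmod z)\<^sup>2 - 1)\<^sup>2)"
      unfolding sq using cgauss_integrable_norm4 cgauss_integrable_norm2 by simp
    then show "integrable CB (\<lambda>\<omega>. (T x \<omega>)\<^sup>2)"
      unfolding T_def using integrable_PiM_cgauss_component[OF jJ[OF x], of "\<lambda>z. ((cmod z)\<^sup>2 - 1)\<^sup>2"] by simp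
    have "(\<integral>\<omega>. (T x \<omega>)\<^sup>2 \<partial>CB) = (\<integral>z. ((cmod z)\<^sup>2 - 1)\<^sup>2 \<partial>cgauss)"
      unfolding T_def using integral_PiM_cgauss_component[OF jJ[OF x], of "\<lambda>z. ((cmod z)\<^sup>2 - 1)\<^sup>2"] by simp
    also have "\<dots> = moment4 - 2 * 1 + 1"
      unfolding sq using cgauss_integrable_norm4 cgauss_integrable_norm2 cgauss.prob_space
      by (simp add: moment4_def cgauss_integral_norm2)
    finally show "(\<integral>\<omega>. (T x \<omega>)\<^sup>2 \<partial>CB) \<le> moment4" by simp
    have "(\<integral>\<omega>. T x \<omega> \<partial>CB) = (\<integral>z. (cmod z)\<^sup>2 - 1 \<partial>cgauss)"
      unfolding T_def using integral_PiM_cgauss_component[OF jJ[OF x], of "\<lambda>z. (cmod z)\<^sup>2 - 1"] by simp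
    also have "\<dots> = 0"
      using cgauss_integrable_norm2 cgauss.prob_space by (simp add: cgauss_integral_norm2)
    finally show "(\<integral>\<omega>. T x \<omega> \<partial>CB) = 0" .
  qed
  have meas: "T x \<in> borel_measurable (PiM H (\<lambda>_. cgauss))" if "j x \<in> H" for x H
    unfolding T_def[abs_def] using measurable_compose[OF PiM_cgauss_component_measurable[OF that] borel_measurable_norm]
    by measurable
  have "measure CB {\<omega> \<in> space CB. g \<le> \<bar>\<Sum>x\<in>A. T x (restrict \<omega> {j x})\<bar>} \<le> real (card A) * moment4 / g\<^sup>2"
  proof (rule Chebyshev_sum_blocks)
    show "disjoint_family_on (\<lambda>x. {j x}) A" by (auto simp: disjoint_family_on_def j_def)
    show "finite A" by (simp add: A_def)
  qed (unfold restr, use int jJ g meas in \<open>blast+\<close>)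
  then have le: "measure CB {\<omega> \<in> space CB. g \<le> \<bar>\<Sum>x\<in>A. T x \<omega>\<bar>} \<le> real (card A) * moment4 / g\<^sup>2"
    unfolding restr .
  have "real (card A) * moment4 / g\<^sup>2 = moment4 / (real N * real (M t) * (1 / P - 1)\<^sup>2)"
    using N m by (simp add: A_def g_def power_mult_distrib power2_eq_square)
  also have "\<dots> \<le> moment4 / (real N * 1 * (1 / P - 1)\<^sup>2)"
    using N m P' moment4_nonneg by (intro divide_left_mono mult_right_mono mult_left_mono mult_pos_pos) auto
  finally have le': "real (card A) * moment4 / g\<^sup>2 \<le> moment4 / (real N * (1 / P - 1)\<^sup>2)" by simp
  have "{c \<in> space CB. real N * real (M t) < (\<Sum>a<M t. \<Sum>n<N. (cmod (codeword c t a (n, l)))\<^sup>2)}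
      \<subseteq> {\<omega> \<in> space CB. g \<le> \<bar>\<Sum>x\<in>A. T x \<omega>\<bar>}"
  proof safe
    fix c assume viol: "real N * real (M t) < (\<Sum>a<M t. \<Sum>n<N. (cmod (codeword c t a (n, l)))\<^sup>2)"
    have "(\<Sum>a<M t. \<Sum>n<N. (cmod (codeword c t a (n, l)))\<^sup>2) = P * (\<Sum>x\<in>A. (cmod (c (j x)))\<^sup>2)"
      unfolding A_def sum.cartesian_product using P
      by (simp add: codeword_def norm_mult power_mult_distrib sum_distrib_left j_def split_beta')
    then have "real N * real (M t) / P < (\<Sum>x\<in>A. (cmod (c (j x)))\<^sup>2)"
      using viol P by (simp add: field_simps)
    moreover have "(\<Sum>x\<in>A. T x c) = (\<Sum>x\<in>A. (cmod (c (j x)))\<^sup>2) - real N * real (M t)"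
      by (simp add: T_def sum_subtractf A_def)
    moreover have "g = real N * real (M t) / P - real N * real (M t)"
      by (simp add: g_def right_diff_distrib)
    ultimately show "g \<le> \<bar>\<Sum>x\<in>A. T x c\<bar>" by linarith
  qed
  moreover have "{\<omega> \<in> space CB. g \<le> \<bar>\<Sum>x\<in>A. T x \<omega>\<bar>} \<in> sets CB"
  proof -
    have "(\<lambda>\<omega>. \<bar>\<Sum>x\<in>A. T x \<omega>\<bar>) \<in> borel_measurable CB"
      using meas jJ by (intro borel_measurable_abs borel_measurable_sum) auto
    then show ?thesis by measurable
  qed
  ultimately have "emeasure CB {c \<in> space CB. real N * real (M t) < (\<Sum>a<M t. \<Sum>n<N. (cmod (codeword c t a (n, l)))\<^sup>2)}
      \<le> emeasure CB {\<omega> \<in> space CB. g \<le> \<bar>\<Sum>x\<in>A. T x \<omega>\<bar>}"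
    by (intro emeasure_mono)
  also have "\<dots> \<le> ennreal (moment4 / (real N * (1 / P - 1)\<^sup>2))"
    using le le' by (simp add: emeasure_eq_measure ennreal_leI)
  finally show ?thesis .
qed

text \<open>Fubini: a bound on codebook and noise that is uniform in the phases passes to the
  codebook average of the probability over phases and noise. The set \<open>S'\<close> is
  \<open>S\<close> with the triples bracketed differently, so that codebook and phases can be
  exchanged.\<close>

lemma averaging:
  assumes S: "S \<in> sets (CB \<Otimes>\<^sub>M (PS \<Otimes>\<^sub>M NS))"
    and b: "\<And>\<Phi>. \<Phi> \<in> space PS \<Longrightarrow> emeasure (CB \<Otimes>\<^sub>M NS) {x \<in> space (CB \<Otimes>\<^sub>M NS). (fst x, \<Phi>, snd x) \<in> S} \<le> b"
  shows "(\<integral>\<^sup>+c. emeasure (PS \<Otimes>\<^sub>M NS) (Pair c -` S) \<partial>CB) \<le> b"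
proof -
  interpret CB: prob_space CB by (rule prob_space_PiM_cgauss)
  interpret PS: prob_space PS by (rule prob_space_phase_space)
  interpret NS: prob_space NS by (rule prob_space_noise_space)
  interpret CP: pair_sigma_finite CB PS ..
  define S' where "S' = {x \<in> space ((CB \<Otimes>\<^sub>M PS) \<Otimes>\<^sub>M NS). (fst (fst x), snd (fst x), snd x) \<in> S}"
  have S': "S' \<in> sets ((CB \<Otimes>\<^sub>M PS) \<Otimes>\<^sub>M NS)"
  proof -
    have "(\<lambda>x. (fst (fst x), snd (fst x), snd x)) \<in> ((CB \<Otimes>\<^sub>M PS) \<Otimes>\<^sub>M NS) \<rightarrow>\<^sub>M (CB \<Otimes>\<^sub>M (PS \<Otimes>\<^sub>M NS))" by measurable
    from measurable_sets[OF this S] show ?thesis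
      by (simp add: S'_def vimage_def Int_def conj_commute)
  qed
  have "(\<integral>\<^sup>+c. emeasure (PS \<Otimes>\<^sub>M NS) (Pair c -` S) \<partial>CB) = (\<integral>\<^sup>+c. \<integral>\<^sup>+\<Phi>. emeasure NS (Pair (c, \<Phi>) -` S') \<partial>PS \<partial>CB)"
  proof (rule nn_integral_cong)
    fix c assume c: "c \<in> space CB"
    have "Pair c -` S \<in> sets (PS \<Otimes>\<^sub>M NS)" using S by (rule sets_Pair1)
    then have "emeasure (PS \<Otimes>\<^sub>M NS) (Pair c -` S) = (\<integral>\<^sup>+\<Phi>. emeasure NS (Pair \<Phi> -` (Pair c -` S)) \<partial>PS)"
      by (rule NS.emeasure_pair_measure_alt)
    also have "\<dots> = (\<integral>\<^sup>+\<Phi>. emeasure NS (Pair (c, \<Phi>) -` S') \<partial>PS)"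
    proof (intro nn_integral_cong arg_cong[where f = "emeasure NS"])
      fix \<Phi> assume "\<Phi> \<in> space PS"
      then show "Pair \<Phi> -` (Pair c -` S) = Pair (c, \<Phi>) -` S'"
        using c sets.sets_into_space[OF S] by (auto simp: S'_def space_pair_measure)
    qed
    finally show "emeasure (PS \<Otimes>\<^sub>M NS) (Pair c -` S) = (\<integral>\<^sup>+\<Phi>. emeasure NS (Pair (c, \<Phi>) -` S') \<partial>PS)" .
  qed
  also have "\<dots> = (\<integral>\<^sup>+\<Phi>. \<integral>\<^sup>+c. emeasure NS (Pair (c, \<Phi>) -` S') \<partial>CB \<partial>PS)"
    using NS.measurable_emeasure_Pair[OF S'] by (intro CP.Fubini'[symmetric]) (simp add: split_beta')
  also have "\<dots> \<le> (\<integral>\<^sup>+\<Phi>. b \<partial>PS)"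
  proof (rule nn_integral_mono)
    fix \<Phi> assume \<Phi>: "\<Phi> \<in> space PS"
    let ?S = "{x \<in> space (CB \<Otimes>\<^sub>M NS). (fst x, \<Phi>, snd x) \<in> S}"
    have "?S \<in> sets (CB \<Otimes>\<^sub>M NS)"
    proof -
      have "(\<lambda>x. (fst x, \<Phi>, snd x)) \<in> (CB \<Otimes>\<^sub>M NS) \<rightarrow>\<^sub>M (CB \<Otimes>\<^sub>M (PS \<Otimes>\<^sub>M NS))" using \<Phi> by measurable
      from measurable_sets[OF this S] show ?thesis by (simp add: vimage_def Int_def conj_commute)
    qed
    then have "emeasure (CB \<Otimes>\<^sub>M NS) ?S = (\<integral>\<^sup>+c. emeasure NS (Pair c -` ?S) \<partial>CB)"
      by (rule NS.emeasure_pair_measure_alt)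
    also have "\<dots> = (\<integral>\<^sup>+c. emeasure NS (Pair (c, \<Phi>) -` S') \<partial>CB)"
      using \<Phi> by (intro nn_integral_cong arg_cong[where f = "emeasure NS"]) (auto simp: S'_def space_pair_measure)
    finally show "(\<integral>\<^sup>+c. emeasure NS (Pair (c, \<Phi>) -` S') \<partial>CB) \<le> b" using b[OF \<Phi>] by simp
  qed
  also have "\<dots> = b" by (simp add: PS.emeasure_space_1)
  finally show ?thesis .
qed

definition missed where
  "missed r w = {x \<in> space (CB \<Otimes>\<^sub>M (PS \<Otimes>\<^sub>M NS)).
    info_density r (fst x) (w r) (fst (snd x)) (Y (fst x) w (fst (snd x)) (snd (snd x)) r) \<le> \<gamma> r}"

definition confused where
  "confused r w a = {x \<in> space (CB \<Otimes>\<^sub>M (PS \<Otimes>\<^sub>M NS)).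
    \<gamma> r < info_density r (fst x) a (fst (snd x)) (Y (fst x) w (fst (snd x)) (snd (snd x)) r)}"

lemma error_events_sets:
  assumes "r < K" "w \<in> msgs K M"
  shows "missed r w \<in> sets (CB \<Otimes>\<^sub>M (PS \<Otimes>\<^sub>M NS))" "a < M r \<Longrightarrow> confused r w a \<in> sets (CB \<Otimes>\<^sub>M (PS \<Otimes>\<^sub>M NS))"
proof -
  let ?X = "CB \<Otimes>\<^sub>M (PS \<Otimes>\<^sub>M NS)"
  have m: "(\<lambda>x. info_density r (fst x) a (fst (snd x)) (Y (fst x) w (fst (snd x)) (snd (snd x)) r)) \<in> borel_measurable ?X" if "a < M r" for a
    by (rule info_density_measurable[where X = ?X]) (use assms that in auto)
  have "w r < M r" using assms by (auto simp: msgs_def)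
  from m[OF this] show "missed r w \<in> sets ?X" unfolding missed_def by measurable
  assume "a < M r"
  from m[OF this] show "confused r w a \<in> sets ?X" unfolding confused_def by measurable
qed

lemma average_true:
  assumes "r < K" "w \<in> msgs K M" "\<gamma> r < real N * Irate r"
  shows "(\<integral>\<^sup>+c. emeasure (PS \<Otimes>\<^sub>M NS) (Pair c -` missed r w) \<partial>CB)
    \<le> ennreal (real N * real L * (18 * moment4) / (real N * Irate r - \<gamma> r)\<^sup>2)"
proof (rule averaging[OF error_events_sets(1)[OF assms(1,2)]])
  fix \<Phi> assume \<Phi>: "\<Phi> \<in> space PS"
  have "{x \<in> space (CB \<Otimes>\<^sub>M NS). (fst x, \<Phi>, snd x) \<in> missed r w}
      = {x \<in> space (CB \<Otimes>\<^sub>M NS). info_density r (fst x) (w r) \<Phi> (Y (fst x) w \<Phi> (snd x) r) \<le> \<gamma> r}"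
    using \<Phi> by (auto simp: missed_def space_pair_measure)
  then show "emeasure (CB \<Otimes>\<^sub>M NS) {x \<in> space (CB \<Otimes>\<^sub>M NS). (fst x, \<Phi>, snd x) \<in> missed r w}
      \<le> ennreal (real N * real L * (18 * moment4) / (real N * Irate r - \<gamma> r)\<^sup>2)"
    using true_word[OF assms(1,2) \<Phi> assms(3)] by simp
qed

text \<open>Markov's inequality for the exponential of the information density, whose mean over the
  codebook is 1 by \<open>wrong_word\<close>.\<close>

lemma average_wrong:
  assumes "r < K" "w \<in> msgs K M" "a < M r" "a \<noteq> w r"
  shows "(\<integral>\<^sup>+c. emeasure (PS \<Otimes>\<^sub>M NS) (Pair c -` confused r w a) \<partial>CB) \<le> ennreal (exp (- \<gamma> r))"
proof (rule averaging[OF error_events_sets(2)[OF assms(1-3)]])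
  fix \<Phi> assume \<Phi>: "\<Phi> \<in> space PS"
  interpret CB: prob_space CB by (rule prob_space_PiM_cgauss)
  interpret NS: prob_space NS by (rule prob_space_noise_space)
  interpret CN: pair_sigma_finite CB NS ..
  define f where "f x = info_density r (fst x) a \<Phi> (Y (fst x) w \<Phi> (snd x) r)" for x
  have f [measurable]: "f \<in> borel_measurable (CB \<Otimes>\<^sub>M NS)"
    unfolding f_def[abs_def] using \<Phi> assms by (intro info_density_measurable) auto
  have "{x \<in> space (CB \<Otimes>\<^sub>M NS). (fst x, \<Phi>, snd x) \<in> confused r w a} = {x \<in> space (CB \<Otimes>\<^sub>M NS). \<gamma> r < f x}" (is "?S = _")
    using \<Phi> by (auto simp: confused_def space_pair_measure f_def)
  moreover have "{x \<in> space (CB \<Otimes>\<^sub>M NS). \<gamma> r < f x} \<in> sets (CB \<Otimes>\<^sub>M NS)" by measurable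
  ultimately have "emeasure (CB \<Otimes>\<^sub>M NS) ?S = (\<integral>\<^sup>+x. indicator {x \<in> space (CB \<Otimes>\<^sub>M NS). \<gamma> r < f x} x \<partial>(CB \<Otimes>\<^sub>M NS))"
    by simp
  also have "\<dots> \<le> (\<integral>\<^sup>+x. ennreal (exp (- \<gamma> r)) * ennreal (exp (f x)) \<partial>(CB \<Otimes>\<^sub>M NS))"
    by (intro nn_integral_mono) (auto simp: indicator_def simp flip: ennreal_mult exp_add)
  also have "\<dots> = ennreal (exp (- \<gamma> r)) * (\<integral>\<^sup>+x. ennreal (exp (f x)) \<partial>(CB \<Otimes>\<^sub>M NS))"
    by (rule nn_integral_cmult) measurable
  also have "(\<integral>\<^sup>+x. ennreal (exp (f x)) \<partial>(CB \<Otimes>\<^sub>M NS)) = (\<integral>\<^sup>+Z. \<integral>\<^sup>+c. ennreal (exp (f (c, Z))) \<partial>CB \<partial>NS)"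
    by (rule CN.nn_integral_snd[symmetric]) measurable
  also have "\<dots> = (\<integral>\<^sup>+Z. 1 \<partial>NS)"
    by (intro nn_integral_cong) (simp add: f_def wrong_word[OF assms \<Phi>])
  finally show "emeasure (CB \<Otimes>\<^sub>M NS) ?S \<le> ennreal (exp (- \<gamma> r))" by (simp add: NS.emeasure_space_1)
qed

lemma is_code_gaussian:
  assumes c: "c \<in> space CB"
    and pow: "\<And>t l. t < K \<Longrightarrow> l < L \<Longrightarrow> (\<Sum>a<M t. \<Sum>n<N. (cmod (codeword c t a (n, l)))\<^sup>2) \<le> real N * real (M t)"
  shows "is_code As K N M (enc c) (dec c)"
  unfolding is_code_def
proof (intro conjI allI impI ballI)
  interpret PS: prob_space PS by (rule prob_space_phase_space)
  show "M k \<ge> 1" if "k < K" for k using M1[OF that] .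
  show "enc c t w n \<Phi> = enc c t w n \<Phi>'" for t w n \<Phi> \<Phi>' by (simp add: enc_def[abs_def])
  show "(\<lambda>\<Phi>. enc c t w n \<Phi> l) \<in> borel_measurable PS" for t w n l by (simp add: enc_def)
  show "(\<Sum>w<M t. \<Sum>n<N. \<integral>\<^sup>+\<Phi>. ennreal ((cmod (enc c t w n \<Phi> l))\<^sup>2) \<partial>PS) \<le> ennreal (real N * real (M t))"
    if "t < K" "l < L" for t l
    using pow[OF that] by (simp add: enc_def PS.emeasure_space_1 sum_nonneg sum_ennreal ennreal_leI)
  show "(\<lambda>(\<Phi>, Z). dec c r \<Phi> (recv As K N (\<lambda>t n l. enc c t (w t) n \<Phi> l) \<Phi> Z r))
      \<in> chan_space N L K \<rightarrow>\<^sub>M count_space UNIV" if r: "r < K" and w: "w \<in> msgs K M" for r w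
    unfolding dec_recv[OF r] chan_space_def split_beta'
  proof (rule measurable_Least)
    fix a
    show "(\<lambda>x. a < M r \<and> \<gamma> r < info_density r c a (fst x) (Y c w (fst x) (snd x) r)) \<in> PS \<Otimes>\<^sub>M NS \<rightarrow>\<^sub>M count_space UNIV"
    proof (cases "a < M r")
      case True
      have "(\<lambda>x. info_density r c a (fst x) (Y c w (fst x) (snd x) r)) \<in> borel_measurable (PS \<Otimes>\<^sub>M NS)"
        using True r w c by (intro info_density_measurable) auto
      then show ?thesis by measurable
    qed simp
  qed
qed

text \<open>If the sent word passes the threshold and no other does, it is the only candidate of the
  decoder. The rest is a union bound.\<close>

lemma err_prob_le:
  assumes c: "c \<in> space CB"
  shows "ennreal (err_prob As K N M (enc c) (dec c)) \<le> ennreal (1 / real (card (msgs K M))) *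
    (\<Sum>w\<in>msgs K M. \<Sum>r<K. emeasure (PS \<Otimes>\<^sub>M NS) (Pair c -` missed r w) +
      (\<Sum>a\<in>{..<M r} - {w r}. emeasure (PS \<Otimes>\<^sub>M NS) (Pair c -` confused r w a)))"
proof -
  let ?C = "real (card (msgs K M))" and ?X = "PS \<Otimes>\<^sub>M NS"
  interpret CS: prob_space ?X using prob_space_chan_space[of N L K] by (simp add: chan_space_def)
  define E where "E w = {(\<Phi>, Z) \<in> space ?X. \<exists>r<K. dec c r \<Phi> (recv As K N (\<lambda>t n l. enc c t (w t) n \<Phi> l) \<Phi> Z r) \<noteq> w r}" for w
  have "emeasure ?X (E w) \<le> (\<Sum>r<K. emeasure ?X (Pair c -` missed r w) + (\<Sum>a\<in>{..<M r} - {w r}. emeasure ?X (Pair c -` confused r w a)))"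
    if w: "w \<in> msgs K M" for w
  proof -
    have sT: "Pair c -` missed r w \<in> sets ?X" if "r < K" for r using error_events_sets(1)[OF that w] by (rule sets_Pair1)
    have sW: "Pair c -` confused r w a \<in> sets ?X" if "r < K" "a < M r" for r a using error_events_sets(2)[OF that(1) w that(2)] by (rule sets_Pair1)
    have "E w \<subseteq> (\<Union>r<K. Pair c -` missed r w \<union> (\<Union>a\<in>{..<M r} - {w r}. Pair c -` confused r w a))"
    proof
      fix x assume "x \<in> E w"
      then obtain \<Phi> Z r where x: "x = (\<Phi>, Z)" "(\<Phi>, Z) \<in> space ?X" and r: "r < K"
        and ne: "(LEAST a. a < M r \<and> \<gamma> r < info_density r c a \<Phi> (Y c w \<Phi> Z r)) \<noteq> w r"
        by (auto simp: E_def dec_recv)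
      have sp: "(c, \<Phi>, Z) \<in> space (CB \<Otimes>\<^sub>M ?X)" using x c by (simp add: space_pair_measure)
      have wr: "w r < M r" using w r by (auto simp: msgs_def)
      have "x \<in> Pair c -` missed r w \<union> (\<Union>a\<in>{..<M r} - {w r}. Pair c -` confused r w a)"
      proof (rule ccontr)
        assume neg: "\<not> ?thesis"
        then have "(c, \<Phi>, Z) \<notin> missed r w" unfolding x by blast
        then have "\<gamma> r < info_density r c (w r) \<Phi> (Y c w \<Phi> Z r)"
          using sp unfolding missed_def by simp
        then have pass: "w r < M r \<and> \<gamma> r < info_density r c (w r) \<Phi> (Y c w \<Phi> Z r)" using wr by blast
        have only: "a = w r" if "a < M r" "\<gamma> r < info_density r c a \<Phi> (Y c w \<Phi> Z r)" for a
        proof (rule ccontr)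
          assume "a \<noteq> w r"
          then have "(c, \<Phi>, Z) \<notin> confused r w a" using neg that(1) unfolding x by blast
          then show False using sp that(2) unfolding confused_def by simp
        qed
        have "(LEAST a. a < M r \<and> \<gamma> r < info_density r c a \<Phi> (Y c w \<Phi> Z r)) = w r"
        proof (rule Least_equality)
          show "w r \<le> a" if "a < M r \<and> \<gamma> r < info_density r c a \<Phi> (Y c w \<Phi> Z r)" for a
            using only[of a] that by blast
        qed (rule pass)
        then show False using ne by simp
      qed
      then show "x \<in> (\<Union>r<K. Pair c -` missed r w \<union> (\<Union>a\<in>{..<M r} - {w r}. Pair c -` confused r w a))"
        using r by blast
    qed
    then have "emeasure ?X (E w) \<le> emeasure ?X (\<Union>r<K. Pair c -` missed r w \<union> (\<Union>a\<in>{..<M r} - {w r}. Pair c -` confused r w a))"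
      using sT sW by (intro emeasure_mono sets.finite_UN sets.Un) auto
    also have "\<dots> \<le> (\<Sum>r<K. emeasure ?X (Pair c -` missed r w \<union> (\<Union>a\<in>{..<M r} - {w r}. Pair c -` confused r w a)))"
      using sT sW by (intro emeasure_subadditive_finite) auto
    also have "\<dots> \<le> (\<Sum>r<K. emeasure ?X (Pair c -` missed r w) + (\<Sum>a\<in>{..<M r} - {w r}. emeasure ?X (Pair c -` confused r w a)))"
    proof (intro sum_mono)
      fix r assume r: "r \<in> {..<K}"
      have "emeasure ?X (Pair c -` missed r w \<union> (\<Union>a\<in>{..<M r} - {w r}. Pair c -` confused r w a))
          \<le> emeasure ?X (Pair c -` missed r w) + emeasure ?X (\<Union>a\<in>{..<M r} - {w r}. Pair c -` confused r w a)"
        using sT sW r by (intro emeasure_subadditive sets.finite_UN) auto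
      also have "\<dots> \<le> emeasure ?X (Pair c -` missed r w) + (\<Sum>a\<in>{..<M r} - {w r}. emeasure ?X (Pair c -` confused r w a))"
        using sW r by (intro add_left_mono emeasure_subadditive_finite) auto
      finally show "emeasure ?X (Pair c -` missed r w \<union> (\<Union>a\<in>{..<M r} - {w r}. Pair c -` confused r w a))
          \<le> emeasure ?X (Pair c -` missed r w) + (\<Sum>a\<in>{..<M r} - {w r}. emeasure ?X (Pair c -` confused r w a))" .
    qed
    finally show ?thesis .
  qed
  then have "(\<Sum>w\<in>msgs K M. ennreal (measure ?X (E w))) \<le> (\<Sum>w\<in>msgs K M. \<Sum>r<K. emeasure ?X (Pair c -` missed r w) +
      (\<Sum>a\<in>{..<M r} - {w r}. emeasure ?X (Pair c -` confused r w a)))"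
    unfolding CS.emeasure_eq_measure[symmetric] by (intro sum_mono)
  moreover have "ennreal (err_prob As K N M (enc c) (dec c)) = ennreal (1 / ?C) * (\<Sum>w\<in>msgs K M. ennreal (measure ?X (E w)))"
  proof -
    have "err_prob As K N M (enc c) (dec c) = 1 / ?C * (\<Sum>w\<in>msgs K M. measure ?X (E w))"
      by (simp add: err_prob_def E_def card_msgs chan_space_def)
    then show ?thesis by (simp only: sum_ennreal measure_nonneg ennreal_mult'' sum_nonneg)
  qed
  ultimately show ?thesis by (simp add: mult_left_mono)
qed

end

section \<open>The sum capacity\<close>

context gaussian_code
begin

text \<open>If every codebook were bad, each would break a power constraint, adding at least 1 to
  \<open>G2\<close>, or have error probability above \<open>\<epsilon>\<close>. Since
  \<open>\<epsilon> \<le> 1\<close>, the random variable \<open>G1 / ?C + G2\<close> would be at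
  least \<open>\<epsilon>\<close> everywhere, against the bound on its mean. One average thus
  settles power and reliability together.\<close>

lemma exists_code:
  assumes N: "N \<ge> 1" and \<gamma>: "\<And>r. r < K \<Longrightarrow> \<gamma> r < real N * Irate r"
    and small: "(\<Sum>r<K. real N * real L * (18 * moment4) / (real N * Irate r - \<gamma> r)\<^sup>2 + real (M r) * exp (- \<gamma> r)) +
      real K * real L * (moment4 / (real N * (1 / P - 1)\<^sup>2)) < \<epsilon>" and \<epsilon>: "\<epsilon> \<le> 1"
  shows "\<exists>c. is_code As K N M (enc c) (dec c) \<and> err_prob As K N M (enc c) (dec c) \<le> \<epsilon>"
proof (rule ccontr)
  assume neg: "\<not> ?thesis"
  interpret CB: prob_space CB by (rule prob_space_PiM_cgauss)
  let ?X = "PS \<Otimes>\<^sub>M NS" and ?C = "real (card (msgs K M))"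
  interpret X: prob_space ?X using prob_space_chan_space[of N L K] by (simp add: chan_space_def)
  have C: "?C > 0" using M1 by (force simp: card_msgs intro!: prod_pos)
  define V where "V t l = {c \<in> space CB. real N * real (M t) < (\<Sum>a<M t. \<Sum>n<N. (cmod (codeword c t a (n, l)))\<^sup>2)}" for t l
  have V: "V t l \<in> sets CB" if "t < K" "l < L" for t l
  proof -
    have "(\<lambda>c. (cmod (codeword c t a (n, l)))\<^sup>2) \<in> borel_measurable CB" if "a < M t" "n < N" for a n
    proof -
      have "(t, a, n, l) \<in> J" using that \<open>t < K\<close> \<open>l < L\<close> by (auto simp: J_def)
      note [measurable] = PiM_cgauss_component_measurable[OF this]
      show ?thesis unfolding codeword_def by measurable
    qed
    then have "(\<lambda>c. \<Sum>a<M t. \<Sum>n<N. (cmod (codeword c t a (n, l)))\<^sup>2) \<in> borel_measurable CB"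
      by (intro borel_measurable_sum) auto
    then show ?thesis unfolding V_def by measurable
  qed
  define A where "A r w c = emeasure ?X (Pair c -` missed r w)" for r w c
  define B where "B r w a c = emeasure ?X (Pair c -` confused r w a)" for r w a c
  have A_meas: "A r w \<in> borel_measurable CB" if "r < K" "w \<in> msgs K M" for r w
    unfolding A_def[abs_def] using X.measurable_emeasure_Pair[OF error_events_sets(1)[OF that]] .
  have B_meas: "B r w a \<in> borel_measurable CB" if "r < K" "w \<in> msgs K M" "a < M r" for r w a
    unfolding B_def[abs_def] using X.measurable_emeasure_Pair[OF error_events_sets(2)[OF that]] .
  define G1 where "G1 c = (\<Sum>w\<in>msgs K M. \<Sum>r<K. A r w c + (\<Sum>a\<in>{..<M r} - {w r}. B r w a c))" for c
  define G2 where "G2 c = (\<Sum>t<K. \<Sum>l<L. indicator (V t l) c :: ennreal)" for c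
  have ge: "ennreal \<epsilon> \<le> ennreal (1 / ?C) * G1 c + G2 c" if c: "c \<in> space CB" for c
  proof (rule ccontr)
    assume "\<not> ?thesis"
    then have less: "ennreal (1 / ?C) * G1 c + G2 c < ennreal \<epsilon>" by simp
    have "c \<notin> V t l" if "t < K" "l < L" for t l
    proof
      assume "c \<in> V t l"
      then have "1 \<le> (indicator (V t l) c :: ennreal)" by simp
      also have "\<dots> \<le> (\<Sum>l<L. indicator (V t l) c)"
        using that by (intro member_le_sum) auto
      also have "\<dots> \<le> G2 c"
        unfolding G2_def using that by (intro member_le_sum[of t "{..<K}" "\<lambda>t. \<Sum>l<L. indicator (V t l) c"]) auto
      also have "\<dots> \<le> ennreal (1 / ?C) * G1 c + G2 c" by simp
      also note less
      also have "ennreal \<epsilon> \<le> 1" using \<epsilon> by simp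
      finally show False by simp
    qed
    then have "is_code As K N M (enc c) (dec c)"
      using c by (intro is_code_gaussian) (auto simp: V_def not_less)
    moreover have "ennreal (err_prob As K N M (enc c) (dec c)) < ennreal \<epsilon>"
    proof -
      have "ennreal (err_prob As K N M (enc c) (dec c)) \<le> ennreal (1 / ?C) * G1 c"
        using err_prob_le[OF c] by (simp add: G1_def A_def B_def)
      also have "\<dots> \<le> ennreal (1 / ?C) * G1 c + G2 c" by simp
      also note less
      finally show ?thesis .
    qed
    then have "err_prob As K N M (enc c) (dec c) \<le> \<epsilon>"
      by (metis ennreal_leI leD linorder_le_cases)
    ultimately show False using neg by blast
  qed
  define \<alpha> where "\<alpha> r = real N * real L * (18 * moment4) / (real N * Irate r - \<gamma> r)\<^sup>2" for r
  have \<alpha>: "\<alpha> r \<ge> 0" for r using moment4_nonneg by (simp add: \<alpha>_def)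
  have G1_meas: "G1 \<in> borel_measurable CB"
    unfolding G1_def[abs_def] using A_meas B_meas by (intro borel_measurable_sum borel_measurable_add) auto
  have G2_meas: "G2 \<in> borel_measurable CB"
    unfolding G2_def[abs_def] using V by (intro borel_measurable_sum borel_measurable_indicator) auto
  have G1_int: "(\<integral>\<^sup>+c. G1 c \<partial>CB) \<le> ennreal (?C * (\<Sum>r<K. \<alpha> r + real (M r) * exp (- \<gamma> r)))"
  proof -
    have "(\<integral>\<^sup>+c. G1 c \<partial>CB) = (\<Sum>w\<in>msgs K M. \<Sum>r<K. (\<integral>\<^sup>+c. A r w c \<partial>CB) + (\<Sum>a\<in>{..<M r} - {w r}. \<integral>\<^sup>+c. B r w a c \<partial>CB))"
      unfolding G1_def using A_meas B_meas
      by (intro trans[OF nn_integral_sum] trans[OF nn_integral_add] sum.cong refl arg_cong2[where f = "(+)"] nn_integral_sum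
          borel_measurable_sum borel_measurable_add) auto
    also have "\<dots> \<le> (\<Sum>w\<in>msgs K M. \<Sum>r<K. ennreal (\<alpha> r + real (M r) * exp (- \<gamma> r)))"
    proof (intro sum_mono)
      fix w r assume w: "w \<in> msgs K M" and "r \<in> {..<K}"
      then have r: "r < K" by simp
      have "(\<Sum>a\<in>{..<M r} - {w r}. \<integral>\<^sup>+c. B r w a c \<partial>CB) \<le> (\<Sum>a\<in>{..<M r} - {w r}. ennreal (exp (- \<gamma> r)))"
        unfolding B_def by (intro sum_mono average_wrong r w) auto
      also have "\<dots> \<le> (\<Sum>a<M r. ennreal (exp (- \<gamma> r)))"
        by (intro sum_mono2) auto
      also have "\<dots> = ennreal (real (M r) * exp (- \<gamma> r))"
        by (simp add: ennreal_of_nat_eq_real_of_nat ennreal_mult)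
      finally have "(\<integral>\<^sup>+c. A r w c \<partial>CB) + (\<Sum>a\<in>{..<M r} - {w r}. \<integral>\<^sup>+c. B r w a c \<partial>CB) \<le> ennreal (\<alpha> r) + ennreal (real (M r) * exp (- \<gamma> r))"
        unfolding A_def \<alpha>_def by (intro add_mono average_true r w \<gamma>)
      then show "(\<integral>\<^sup>+c. A r w c \<partial>CB) + (\<Sum>a\<in>{..<M r} - {w r}. \<integral>\<^sup>+c. B r w a c \<partial>CB) \<le> ennreal (\<alpha> r + real (M r) * exp (- \<gamma> r))"
        using \<alpha> by (simp add: ennreal_plus)
    qed
    also have "\<dots> = ennreal (?C * (\<Sum>r<K. \<alpha> r + real (M r) * exp (- \<gamma> r)))"
    proof -
      have nn: "\<alpha> r + real (M r) * exp (- \<gamma> r) \<ge> 0" for r using \<alpha>[of r] by simp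
      show ?thesis
        unfolding sum_ennreal[OF nn]
        by (simp add: ennreal_of_nat_eq_real_of_nat sum_nonneg[OF nn] ennreal_mult)
    qed
    finally show ?thesis .
  qed
  have G2_int: "(\<integral>\<^sup>+c. G2 c \<partial>CB) \<le> ennreal (real K * real L * (moment4 / (real N * (1 / P - 1)\<^sup>2)))"
  proof -
    have "(\<integral>\<^sup>+c. G2 c \<partial>CB) = (\<Sum>t<K. \<Sum>l<L. \<integral>\<^sup>+c. indicator (V t l) c \<partial>CB)"
      unfolding G2_def using V
      by (intro trans[OF nn_integral_sum] sum.cong refl nn_integral_sum borel_measurable_sum borel_measurable_indicator) auto
    also have "\<dots> = (\<Sum>t<K. \<Sum>l<L. emeasure CB (V t l))"
      using V by (intro sum.cong refl nn_integral_indicator) auto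
    also have "\<dots> \<le> (\<Sum>t<K. \<Sum>l<L. ennreal (moment4 / (real N * (1 / P - 1)\<^sup>2)))"
      unfolding V_def by (intro sum_mono power_violation N) auto
    also have "\<dots> = ennreal (real K * real L * (moment4 / (real N * (1 / P - 1)\<^sup>2)))"
      using moment4_nonneg by (simp add: ennreal_of_nat_eq_real_of_nat mult.assoc flip: ennreal_mult)
    finally show ?thesis .
  qed
  define S where "S = (\<Sum>r<K. \<alpha> r + real (M r) * exp (- \<gamma> r))"
  define q where "q = real K * real L * (moment4 / (real N * (1 / P - 1)\<^sup>2))"
  have S0: "S \<ge> 0" and q0: "q \<ge> 0" using \<alpha> moment4_nonneg by (auto simp: S_def q_def intro!: sum_nonneg)
  have "ennreal \<epsilon> = (\<integral>\<^sup>+c. ennreal \<epsilon> \<partial>CB)" by (simp add: CB.emeasure_space_1)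
  also have "\<dots> \<le> (\<integral>\<^sup>+c. ennreal (1 / ?C) * G1 c + G2 c \<partial>CB)"
    by (intro nn_integral_mono ge)
  also have "\<dots> = ennreal (1 / ?C) * (\<integral>\<^sup>+c. G1 c \<partial>CB) + (\<integral>\<^sup>+c. G2 c \<partial>CB)"
    using G1_meas G2_meas by (simp add: nn_integral_add nn_integral_cmult)
  also have "\<dots> \<le> ennreal (1 / ?C) * ennreal (?C * S) + ennreal q"
    using G1_int G2_int by (intro add_mono mult_left_mono) (auto simp: S_def q_def)
  also have "\<dots> = ennreal (S + q)"
    using C S0 q0 by (simp add: ennreal_plus flip: ennreal_mult)
  finally have "\<epsilon> \<le> S + q" using S0 q0 by (subst (asm) ennreal_le_iff) auto
  then show False using small by (simp add: S_def q_def \<alpha>_def)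
qed

end

section \<open>Rates, block lengths and the limit of vanishing back-off\<close>

context paired_states
begin

text \<open>The quantity \<open>Irate\<close> as a function of the power alone, available before
  block length and message sets are chosen.\<close>

definition rate :: "real \<Rightarrow> nat \<Rightarrow> real" where
  "rate P r = (\<Sum>l<L. let v = (if r \<in> D l then 1 + SNR * P else 1) in ln ((SNR * P + v) / v))"

lemma sum_rate:
  assumes "P > 0"
  shows "(\<Sum>r<K. rate P r) = real L * (real K / 2) * ln (1 + 2 * (SNR * P))"
proof -
  define \<kappa> where "\<kappa> = SNR * P"
  have \<kappa>: "\<kappa> > 0" using SNR assms by (simp add: \<kappa>_def)
  have "(\<Sum>r<K. let v = (if r \<in> D l then 1 + \<kappa> else 1) in ln ((\<kappa> + v) / v)) = real K / 2 * ln (1 + 2 * \<kappa>)"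
    if l: "l < L" for l
  proof -
    have "card (D l) = card ({..<K} - D l)" using \<tau>[OF l] by (rule bij_betw_same_card)
    moreover have "card ({..<K} - D l) = K - card (D l)" "card (D l) \<le> K"
      using D[OF l] card_mono[OF _ D[OF l]] by (auto simp: card_Diff_subset finite_subset)
    ultimately have card: "real (card (D l)) = real K / 2" "real (card ({..<K} - D l)) = real K / 2" by linarith+
    have "(\<Sum>r<K. let v = (if r \<in> D l then 1 + \<kappa> else 1) in ln ((\<kappa> + v) / v))
        = (\<Sum>r\<in>{..<K} - D l. ln (\<kappa> + 1)) + (\<Sum>r\<in>D l. ln ((2 * \<kappa> + 1) / (1 + \<kappa>)))"
      using D[OF l] by (subst sum.subset_diff[of "D l"]) (auto simp: Let_def intro!: sum.cong)
    also have "\<dots> = real K / 2 * (ln (\<kappa> + 1) + ln ((2 * \<kappa> + 1) / (1 + \<kappa>)))"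
      by (simp add: card distrib_left)
    also have "ln (\<kappa> + 1) + ln ((2 * \<kappa> + 1) / (1 + \<kappa>)) = ln (1 + 2 * \<kappa>)"
      using \<kappa> by (simp add: ln_div add.commute)
    finally show ?thesis .
  qed
  then have "(\<Sum>l<L. \<Sum>r<K. let v = (if r \<in> D l then 1 + \<kappa> else 1) in ln ((\<kappa> + v) / v)) = real L * (real K / 2) * ln (1 + 2 * \<kappa>)"
    by (subst sum.cong[OF refl, of _ _ "\<lambda>_. real K / 2 * ln (1 + 2 * \<kappa>)"]) auto
  then show ?thesis
    unfolding rate_def \<kappa>_def[symmetric] by (subst sum.swap)
qed

lemma rate_pos:
  assumes "P > 0" "L \<ge> 1" shows "rate P r > 0"
proof -
  have \<kappa>: "SNR * P > 0" using SNR assms by simp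
  have pos: "ln ((SNR * P + v) / v) > 0" if "v > 0" for v
    using that \<kappa> by (intro ln_gt_zero) simp
  show ?thesis
    unfolding rate_def Let_def
  proof (intro sum_pos pos)
    show "{..<L} \<noteq> {}" using assms(2) by (auto simp: lessThan_empty_iff)
  qed (use \<kappa> in auto)
qed

text \<open>One parameter \<open>\<eta>\<close> reduces both power and rate. The threshold lies
  halfway between the reduced rate and \<open>R r\<close>, which leaves a gap of
  \<open>\<eta> * R r / 2\<close> per channel use on either side.\<close>

lemma achievable_gaussian:
  assumes \<eta>: "0 < \<eta>" "\<eta> < 1" and L: "L \<ge> 1"
  shows "achievable As K (\<lambda>k. (1 - \<eta>) * rate (1 - \<eta>) k / ln 2)"
  unfolding achievable_def
proof (intro conjI allI impI)
  define P where "P = 1 - \<eta>"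
  have P: "0 < P" "P < 1" using \<eta> by (auto simp: P_def)
  define R where "R r = rate P r" for r
  have R: "R r > 0" for r using rate_pos[OF P(1) L] by (simp add: R_def)
  show "0 \<le> (1 - \<eta>) * rate (1 - \<eta>) k / ln 2" for k
    using R[of k] \<eta> by (simp add: R_def P_def)
  fix \<epsilon> :: real assume "\<epsilon> > 0"
  \<comment> \<open>Capped at 1 to meet the hypothesis of \<open>exists_code\<close>.\<close>
  define e where "e = min \<epsilon> 1"
  have e: "e > 0" "e \<le> 1" "e \<le> \<epsilon>" using \<open>\<epsilon> > 0\<close> by (auto simp: e_def)
  \<comment> \<open>All failure probabilities together are at most \<open>B / real N\<close>: missed
    words by Chebyshev, confusions through 2 exp (-d) \<le> 2 / d with d the accumulated gap, and
    power violations.\<close>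
  define B where "B = (\<Sum>r<K. real L * (18 * moment4) / (\<eta> * R r / 2)\<^sup>2 + 4 / (\<eta> * R r)) + real K * real L * (moment4 / (1 / P - 1)\<^sup>2)"
  have "B \<ge> 0" unfolding B_def using moment4_nonneg R \<eta>
    by (intro add_nonneg_nonneg sum_nonneg divide_nonneg_nonneg mult_nonneg_nonneg) (auto simp: less_imp_le)
  obtain N0 :: nat where N0: "real N0 > B / e" using reals_Archimedean2 by blast
  show "\<exists>N0. \<forall>N\<ge>N0. \<exists>M enc dec. is_code As K N M enc dec \<and>
        (\<forall>k<K. real (M k) \<ge> 2 powr (real N * ((1 - \<eta>) * rate (1 - \<eta>) k / ln 2))) \<and> err_prob As K N M enc dec \<le> \<epsilon>"
  proof (intro exI[of _ "max N0 1"] allI impI)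
    fix N assume "max N0 1 \<le> N"
    then have N: "N \<ge> 1" "real N > B / e" using N0 by auto
    \<comment> \<open>Rounding up preserves the rate and at most doubles the size, since the
      exponential is at least 1.\<close>
    define M where "M r = nat \<lceil>exp (real N * (1 - \<eta>) * R r)\<rceil>" for r
    define \<gamma> where "\<gamma> r = real N * (1 - \<eta> / 2) * R r" for r
    have M_ge: "real (M r) \<ge> exp (real N * (1 - \<eta>) * R r)" for r
      unfolding M_def by (rule real_nat_ceiling_ge)
    have M1: "M r \<ge> 1" for r
      using less_le_trans[OF exp_gt_zero M_ge[of r]] by simp
    have M_le: "real (M r) \<le> 2 * exp (real N * (1 - \<eta>) * R r)" for r
    proof -
      have "exp (real N * (1 - \<eta>) * R r) \<ge> 1" using R[of r] \<eta> by simp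
      moreover have "real (M r) \<le> exp (real N * (1 - \<eta>) * R r) + 1"
        unfolding M_def by simp
      ultimately show ?thesis by linarith
    qed
    interpret G: gaussian_code K SNR As D \<tau> N M P \<gamma>
      by standard (use P M1 in auto)
    have Ir: "G.Irate r = R r" for r
      unfolding G.Irate_def R_def rate_def G.nv_def G.\<kappa>_def Let_def ..
    have gap: "real N * R r - \<gamma> r = real N * (\<eta> * R r / 2)" for r
      by (simp add: \<gamma>_def algebra_simps)
    have "\<exists>c. is_code As K N M (G.enc c) (G.dec c) \<and> err_prob As K N M (G.enc c) (G.dec c) \<le> e"
    proof (rule G.exists_code)
      show "\<gamma> r < real N * G.Irate r" for r
      proof -
        have "real N * (\<eta> * R r / 2) > 0" using N(1) R[of r] \<eta> by simp
        then show ?thesis using gap[of r] by (simp add: Ir)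
      qed
      have t1: "real N * real L * (18 * moment4) / (real N * G.Irate r - \<gamma> r)\<^sup>2 = real L * (18 * moment4) / (\<eta> * R r / 2)\<^sup>2 / real N" for r
        unfolding Ir gap power_mult_distrib using N(1) by (simp add: power2_eq_square)
      have t2: "real (M r) * exp (- \<gamma> r) \<le> 4 / (\<eta> * R r) / real N" for r
      proof -
        define d where "d = real N * (\<eta> * R r / 2)"
        have d: "d > 0" using N(1) R[of r] \<eta> by (simp add: d_def)
        have "real (M r) * exp (- \<gamma> r) \<le> 2 * exp (real N * (1 - \<eta>) * R r) * exp (- \<gamma> r)"
          by (intro mult_right_mono M_le) auto
        also have "\<dots> = 2 * exp (- d)"
          by (simp add: d_def \<gamma>_def algebra_simps flip: exp_add)
        also have "\<dots> \<le> 2 * (1 / d)"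
        proof -
          have "d \<le> exp d" using exp_ge_add_one_self[of d] by linarith
          then show ?thesis using d by (simp add: exp_minus field_simps)
        qed
        also have "\<dots> = 4 / (\<eta> * R r) / real N" by (simp add: d_def field_simps)
        finally show ?thesis .
      qed
      have "(\<Sum>r<K. real N * real L * (18 * moment4) / (real N * G.Irate r - \<gamma> r)\<^sup>2 + real (M r) * exp (- \<gamma> r)) +
          real K * real L * (moment4 / (real N * (1 / P - 1)\<^sup>2))
        \<le> (\<Sum>r<K. real L * (18 * moment4) / (\<eta> * R r / 2)\<^sup>2 / real N + 4 / (\<eta> * R r) / real N) +
          real K * real L * (moment4 / (1 / P - 1)\<^sup>2) / real N"
        unfolding t1 by (intro add_mono sum_mono order_refl t2) (simp add: mult.commute)
      also have "\<dots> = B / real N"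
        by (simp add: B_def add_divide_distrib sum_divide_distrib)
      also have "\<dots> < e" using N e by (simp add: field_simps)
      finally show "(\<Sum>r<K. real N * real L * (18 * moment4) / (real N * G.Irate r - \<gamma> r)\<^sup>2 + real (M r) * exp (- \<gamma> r)) +
          real K * real L * (moment4 / (real N * (1 / P - 1)\<^sup>2)) < e" .
    qed (use N e in auto)
    then obtain c where "is_code As K N M (G.enc c) (G.dec c)" "err_prob As K N M (G.enc c) (G.dec c) \<le> \<epsilon>"
      using e by (meson order_trans)
    moreover have "2 powr (real N * ((1 - \<eta>) * rate (1 - \<eta>) k / ln 2)) \<le> real (M k)" for k
      using M_ge[of k] by (simp add: powr_def R_def P_def mult.assoc)
    ultimately show "\<exists>M enc dec. is_code As K N M enc dec \<and>
        (\<forall>k<K. real (M k) \<ge> 2 powr (real N * ((1 - \<eta>) * rate (1 - \<eta>) k / ln 2))) \<and> err_prob As K N M enc dec \<le> \<epsilon>"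
      by blast
  qed
qed

text \<open>The achievable sum rates \<open>f \<eta>\<close> tend to the bound of the converse as
  \<open>\<eta>\<close> decreases to 0, so the supremum equals that bound whether or not it is
  attained.\<close>

lemma psum_capacity_eq:
  assumes L: "L \<ge> 1"
  shows "psum_capacity K As = real L * (real K / 2) * log 2 (1 + 2 * SNR)"
proof -
  let ?C = "real L * (real K / 2) * log 2 (1 + 2 * SNR)"
  let ?S = "{\<Sum>k<K. R k | R. achievable As K R}"
  have bdd: "bdd_above ?S" using achievable_le by (auto intro!: bdd_aboveI[of _ ?C])
  define f where "f \<eta> = (1 - \<eta>) * (real L * (real K / 2) * log 2 (1 + 2 * (SNR * (1 - \<eta>))))" for \<eta>
  have mem: "f \<eta> \<in> ?S" if "0 < \<eta>" "\<eta> < 1" for \<eta>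
  proof -
    have "(\<Sum>k<K. (1 - \<eta>) * rate (1 - \<eta>) k / ln 2) = (1 - \<eta>) * (\<Sum>k<K. rate (1 - \<eta>) k) / ln 2"
      by (simp add: sum_distrib_left sum_divide_distrib)
    also have "\<dots> = f \<eta>" using that by (simp add: sum_rate f_def log_def)
    finally show ?thesis using achievable_gaussian[OF that L] by (auto intro!: exI[of _ "\<lambda>k. (1 - \<eta>) * rate (1 - \<eta>) k / ln 2"])
  qed
  have "(f \<longlongrightarrow> ?C) (at_right 0)"
    unfolding f_def using SNR by (auto intro!: tendsto_eq_intros)
  moreover have "\<forall>\<^sub>F \<eta> in at_right 0. f \<eta> \<le> Sup ?S"
    by (rule eventually_mono[OF eventually_at_right_real[of 0 "1::real"]]) (auto intro!: cSup_upper[OF mem bdd])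
  ultimately have "?C \<le> Sup ?S"
    by (rule tendsto_upperbound) simp
  \<comment> \<open>The value 1/2 serves only to show that the set of sum rates is nonempty.\<close>
  moreover have "Sup ?S \<le> ?C"
    using mem[of "1/2"] achievable_le by (intro cSup_least) auto
  ultimately show ?thesis by (simp add: psum_capacity_def)
qed

end

text \<open>For even \<open>K\<close>, disjointness and cardinality force the K/2 pairs to contain
  all users, so their receivers and their transmitters are complementary sets, matched by the
  pairs.\<close>

lemma paired_stateD:
  assumes "paired_state K SNR A" "even K"
  shows "\<exists>D \<tau>. D \<subseteq> {..<K} \<and> bij_betw \<tau> D ({..<K} - D) \<and>
    (\<forall>r<K. \<forall>t<K. A r t = (if r = t \<or> r \<in> D \<and> t = \<tau> r then sqrt SNR else 0))"
proof -
  from assms(1) obtain B where B: "B \<subseteq> {..<K} \<times> {..<K}" "card B = K div 2"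
    and ne': "\<forall>(r, t)\<in>B. r \<noteq> t"
    and disj': "\<forall>(r, t)\<in>B. \<forall>(r', t')\<in>B. (r, t) \<noteq> (r', t') \<longrightarrow> {r, t} \<inter> {r', t'} = {}"
    and A: "\<forall>r<K. \<forall>t<K. A r t = (if r = t \<or> (r, t) \<in> B then sqrt SNR else 0)"
    unfolding paired_state_def by (elim exE conjE)
  have ne: "r \<noteq> t" if "(r, t) \<in> B" for r t
    using bspec[OF ne' that] by simp
  have disj: "{r, t} \<inter> {r', t'} = {}" if "(r, t) \<in> B" "(r', t') \<in> B" "(r, t) \<noteq> (r', t')" for r t r' t'
    using bspec[OF bspec[OF disj' that(1), unfolded prod.case] that(2)] that(3) unfolding prod.case by (rule mp)
  have fin: "finite B" using B(1) finite_subset by blast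
  have inj: "inj_on fst B" "inj_on snd B"
  proof -
    have disj': "{fst x, snd x} \<inter> {fst y, snd y} = {}" if "x \<in> B" "y \<in> B" "x \<noteq> y" for x y
      using disj[of "fst x" "snd x" "fst y" "snd y"] that by simp
    show "inj_on fst B" "inj_on snd B"
      by (rule inj_onI, rule ccontr, use disj' in blast)+
  qed
  have int: "fst ` B \<inter> snd ` B = {}"
  proof (rule ccontr)
    assume "\<not> ?thesis"
    then obtain r t r' where "(r, t) \<in> B" "(r', r) \<in> B" by auto
    then show False using disj[of r t r' r] ne by fastforce
  qed
  have "card (fst ` B \<union> snd ` B) = card B + card B"
    using fin int inj by (simp add: card_Un_disjoint card_image)
  also have "\<dots> = card {..<K}" using B(2) assms(2) by (simp add: mult_2[symmetric])
  finally have cover: "fst ` B \<union> snd ` B = {..<K}"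
    using B(1) by (intro card_subset_eq) auto
  define \<tau> where "\<tau> = snd \<circ> inv_into B fst"
  have \<tau>: "\<tau> r = t" if "(r, t) \<in> B" for r t
    using inv_into_f_f[OF inj(1) that] by (simp add: \<tau>_def)
  have "bij_betw (inv_into B fst) (fst ` B) B"
    using inj(1) by (intro bij_betw_inv_into) (simp add: bij_betw_def)
  moreover have "bij_betw snd B (snd ` B)" using inj(2) by (simp add: bij_betw_def)
  ultimately have "bij_betw \<tau> (fst ` B) (snd ` B)"
    unfolding \<tau>_def by (rule bij_betw_trans)
  moreover have "snd ` B = {..<K} - fst ` B" using cover int by blast
  moreover have "(r, t) \<in> B \<longleftrightarrow> r \<in> fst ` B \<and> t = \<tau> r" for r t
    using \<tau> by force
  ultimately show ?thesis
    using A cover by (intro exI[of _ "fst ` B"] exI[of _ \<tau>]) auto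
qed

lemma psum_capacity_paired:
  assumes "even K" "SNR > 0" "As \<noteq> []" "\<forall>A\<in>set As. paired_state K SNR A"
  shows "psum_capacity K As = real (length As) * (real K / 2) * log 2 (1 + 2 * SNR)"
proof -
  have "\<forall>A\<in>set As. \<exists>x. fst x \<subseteq> {..<K} \<and> bij_betw (snd x) (fst x) ({..<K} - fst x) \<and>
      (\<forall>r<K. \<forall>t<K. A r t = (if r = t \<or> r \<in> fst x \<and> t = snd x r then sqrt SNR else 0))"
  proof
    fix A assume "A \<in> set As"
    then obtain D \<tau> where "D \<subseteq> {..<K} \<and> bij_betw \<tau> D ({..<K} - D) \<and>
      (\<forall>r<K. \<forall>t<K. A r t = (if r = t \<or> r \<in> D \<and> t = \<tau> r then sqrt SNR else 0))"
      using paired_stateD[OF _ assms(1), of SNR A] assms(4) by blast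
    then show "\<exists>x. fst x \<subseteq> {..<K} \<and> bij_betw (snd x) (fst x) ({..<K} - fst x) \<and>
      (\<forall>r<K. \<forall>t<K. A r t = (if r = t \<or> r \<in> fst x \<and> t = snd x r then sqrt SNR else 0))"
      by (intro exI[of _ "(D, \<tau>)"]) simp
  qed
  from bchoice[OF this] obtain F where F: "\<And>A. A \<in> set As \<Longrightarrow> fst (F A) \<subseteq> {..<K} \<and>
      bij_betw (snd (F A)) (fst (F A)) ({..<K} - fst (F A)) \<and>
      (\<forall>r<K. \<forall>t<K. A r t = (if r = t \<or> r \<in> fst (F A) \<and> t = snd (F A) r then sqrt SNR else 0))"
    by blast
  interpret paired_states K SNR As "\<lambda>l. fst (F (As ! l))" "\<lambda>l. snd (F (As ! l))"
  proof
    fix l assume "l < length As"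
    then have l: "As ! l \<in> set As" by simp
    note F = F[OF l]
    show "fst (F (As ! l)) \<subseteq> {..<K}" "bij_betw (snd (F (As ! l))) (fst (F (As ! l))) ({..<K} - fst (F (As ! l)))"
      using F by blast+
    show "(As ! l) r t = (if r = t \<or> r \<in> fst (F (As ! l)) \<and> t = snd (F (As ! l)) r then sqrt SNR else 0)" if "r < K" "t < K" for r t
      using F that by blast
  qed (use assms in auto)
  show ?thesis using assms(3) by (intro psum_capacity_eq) (simp add: Suc_le_eq)
qed

theorem theorem7:
  fixes K :: nat and SNR :: real and As :: "(nat \<Rightarrow> nat \<Rightarrow> real) list"
  assumes "K \<ge> 2" and "even K" and "SNR > 0" and "As \<noteq> []"
    and "\<forall>A\<in>set As. paired_state K SNR A"
  shows "psum_capacity K As = (\<Sum>A\<leftarrow>As. psum_capacity K [A]) \<and>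
         psum_capacity K As = real (length As) * (real K / 2) * log 2 (1 + 2 * SNR)"
proof -
  \<comment> \<open>A single state is the case of one subchannel of the same capacity
    formula.\<close>
  have "psum_capacity K [A] = real K / 2 * log 2 (1 + 2 * SNR)" if "A \<in> set As" for A
    using psum_capacity_paired[of K SNR "[A]"] assms that by simp
  then have "(\<Sum>A\<leftarrow>As. psum_capacity K [A]) = (\<Sum>A\<leftarrow>As. real K / 2 * log 2 (1 + 2 * SNR))"
    by (intro arg_cong[where f = sum_list] map_cong) auto
  also have "\<dots> = real (length As) * (real K / 2) * log 2 (1 + 2 * SNR)"
    by (simp add: sum_list_triv)
  finally show ?thesis using psum_capacity_paired[OF assms(2-5)] by simp
qed

end
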